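(* The Hadwiger Number problem can be solved in $O(n^3)$ time on cographs.
   Context: The Hadwiger number $h(G)$ of a graph $G$ is the largest integer $h$ such that the complete graph $K_h$ is a minor of $G$. The Hadwiger Number problem asks, given an $n$-vertex graph $G$ and an integer $h$, whether $h(G)\geq h$ (equivalently, whether $G$ has $K_h$ as a minor). A cograph is a $P_4$-free graph. $n$ and $m$ denote the number of vertices and edges of the input graph. *)

theory Defs
  imports Complex_Main "HOL-Library.Landau_Symbols"
begin

type_synonym 'a graph = "'a set \<times> 'a set set"

abbreviation verts :: "'a graph \<Rightarrow> 'a set" where "verts \<equiv> fst"
abbreviation edges :: "'a graph \<Rightarrow> 'a set set" where "edges \<equiv> snd"

definition simple_graph :: "'a graph \<Rightarrow> bool" where
  "simple_graph G \<longleftrightarrow>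
     finite (verts G) \<and> (\<forall>e \<in> edges G. e \<subseteq> verts G \<and> card e = 2)"

definition graph_iso :: "'a graph \<Rightarrow> 'b graph \<Rightarrow> bool" where
  "graph_iso G H \<longleftrightarrow>
     (\<exists>f. bij_betw f (verts G) (verts H) \<and> edges H = (`) f ` edges G)"

definition complete_graph :: "nat \<Rightarrow> nat graph" where
  "complete_graph h = ({..<h}, {{i, j} | i j. i < h \<and> j < h \<and> i \<noteq> j})"

definition path_graph :: "nat \<Rightarrow> nat graph" where
  "path_graph k = ({..<k}, {{i, Suc i} | i. Suc i < k})"

definition induced_subgraph :: "'a graph \<Rightarrow> 'a set \<Rightarrow> 'a graph" where
  "induced_subgraph G U = (U, {e \<in> edges G. e \<subseteq> U})"

definition cograph :: "'a graph \<Rightarrow> bool" where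
  "cograph G \<longleftrightarrow>
     simple_graph G \<and>
     \<not> (\<exists>U \<subseteq> verts G. graph_iso (path_graph 4) (induced_subgraph G U))"

definition delete_vertex :: "'a graph \<Rightarrow> 'a \<Rightarrow> 'a graph" where
  "delete_vertex G v = (verts G - {v}, {e \<in> edges G. v \<notin> e})"

definition delete_edge :: "'a graph \<Rightarrow> 'a set \<Rightarrow> 'a graph" where
  "delete_edge G e = (verts G, edges G - {e})"

text \<open>
  Contraction of the edge \<open>{u, v}\<close>: the vertex \<open>u\<close> plays the role of the new vertex.
  Removing \<open>{u}\<close> discards the loop; parallel edges coincide because edges form a set.
\<close>
definition contract_edge :: "'a graph \<Rightarrow> 'a \<Rightarrow> 'a \<Rightarrow> 'a graph" where
  "contract_edge G u v = (verts G - {v}, (`) (id(v := u)) ` edges G - {{u}})"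

inductive minor_step :: "'a graph \<Rightarrow> 'a graph \<Rightarrow> bool" where
  "v \<in> verts G \<Longrightarrow> minor_step G (delete_vertex G v)"
| "e \<in> edges G \<Longrightarrow> minor_step G (delete_edge G e)"
| "{u, v} \<in> edges G \<Longrightarrow> u \<noteq> v \<Longrightarrow> minor_step G (contract_edge G u v)"

definition is_minor :: "'b graph \<Rightarrow> 'a graph \<Rightarrow> bool" where
  "is_minor H G \<longleftrightarrow> (\<exists>G'. minor_step\<^sup>*\<^sup>* G G' \<and> graph_iso H G')"

definition hadwiger_number :: "'a graph \<Rightarrow> nat" where
  "hadwiger_number G = (GREATEST h. is_minor (complete_graph h) G)"

text \<open>
  Running time is measured on a random access machine with one memory of integer cells, indirect
  addressing, and unit-cost arithmetic on words. Programs are structured; compiling them to jumps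
  changes the running time by a constant factor only. To keep unit cost honest, the semantics is
  parameterised by a bound \<open>B\<close>: a program gets stuck when an address is negative or when a
  value it computes exceeds \<open>B\<close> in absolute value.
\<close>

type_synonym memory = "nat \<Rightarrow> int"

datatype expr =
  Const int | Read expr | Add expr expr | Sub expr expr | Mul expr expr

datatype test =
  Less expr expr | Equal expr expr | Neg test | Conj test test

text \<open>\<open>Write a e\<close> stores the value of \<open>e\<close> in the cell whose address is the value of \<open>a\<close>.\<close>
datatype prog =
  Skip | Write expr expr | Seq prog prog | Cond test prog prog | While test prog

fun expr_val :: "memory \<Rightarrow> expr \<Rightarrow> int" where
  "expr_val s (Const c) = c"
| "expr_val s (Read e) = s (nat (expr_val s e))"
| "expr_val s (Add e f) = expr_val s e + expr_val s f"
| "expr_val s (Sub e f) = expr_val s e - expr_val s f"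
| "expr_val s (Mul e f) = expr_val s e * expr_val s f"

fun expr_ok :: "int \<Rightarrow> memory \<Rightarrow> expr \<Rightarrow> bool" where
  "expr_ok B s (Const c) \<longleftrightarrow> \<bar>c\<bar> \<le> B"
| "expr_ok B s (Read e) \<longleftrightarrow>
     expr_ok B s e \<and> 0 \<le> expr_val s e \<and> \<bar>expr_val s (Read e)\<bar> \<le> B"
| "expr_ok B s (Add e f) \<longleftrightarrow>
     expr_ok B s e \<and> expr_ok B s f \<and> \<bar>expr_val s (Add e f)\<bar> \<le> B"
| "expr_ok B s (Sub e f) \<longleftrightarrow>
     expr_ok B s e \<and> expr_ok B s f \<and> \<bar>expr_val s (Sub e f)\<bar> \<le> B"
| "expr_ok B s (Mul e f) \<longleftrightarrow>
     expr_ok B s e \<and> expr_ok B s f \<and> \<bar>expr_val s (Mul e f)\<bar> \<le> B"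

fun expr_cost :: "expr \<Rightarrow> nat" where
  "expr_cost (Const c) = 1"
| "expr_cost (Read e) = expr_cost e + 1"
| "expr_cost (Add e f) = expr_cost e + expr_cost f + 1"
| "expr_cost (Sub e f) = expr_cost e + expr_cost f + 1"
| "expr_cost (Mul e f) = expr_cost e + expr_cost f + 1"

fun test_val :: "memory \<Rightarrow> test \<Rightarrow> bool" where
  "test_val s (Less e f) \<longleftrightarrow> expr_val s e < expr_val s f"
| "test_val s (Equal e f) \<longleftrightarrow> expr_val s e = expr_val s f"
| "test_val s (Neg b) \<longleftrightarrow> \<not> test_val s b"
| "test_val s (Conj b c) \<longleftrightarrow> test_val s b \<and> test_val s c"

fun test_ok :: "int \<Rightarrow> memory \<Rightarrow> test \<Rightarrow> bool" where
  "test_ok B s (Less e f) \<longleftrightarrow> expr_ok B s e \<and> expr_ok B s f"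
| "test_ok B s (Equal e f) \<longleftrightarrow> expr_ok B s e \<and> expr_ok B s f"
| "test_ok B s (Neg b) \<longleftrightarrow> test_ok B s b"
| "test_ok B s (Conj b c) \<longleftrightarrow> test_ok B s b \<and> test_ok B s c"

fun test_cost :: "test \<Rightarrow> nat" where
  "test_cost (Less e f) = expr_cost e + expr_cost f + 1"
| "test_cost (Equal e f) = expr_cost e + expr_cost f + 1"
| "test_cost (Neg b) = test_cost b + 1"
| "test_cost (Conj b c) = test_cost b + test_cost c + 1"

text \<open>
  \<open>exec B p s t s'\<close>: with word bound \<open>B\<close>, program \<open>p\<close> started in memory \<open>s\<close> halts after
  \<open>t\<close> steps in memory \<open>s'\<close>.
\<close>
inductive exec :: "int \<Rightarrow> prog \<Rightarrow> memory \<Rightarrow> nat \<Rightarrow> memory \<Rightarrow> bool" for B :: int where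
  exec_Skip: "exec B Skip s 1 s"
| exec_Write: "exec B (Write a e) s (expr_cost a + expr_cost e + 1)
                 (s(nat (expr_val s a) := expr_val s e))"
    if "expr_ok B s a" and "0 \<le> expr_val s a" and "expr_ok B s e"
| exec_Seq: "exec B (Seq p q) s (t1 + t2) s''"
    if "exec B p s t1 s'" and "exec B q s' t2 s''"
| exec_Cond_True: "exec B (Cond b p q) s (test_cost b + t) s'"
    if "test_ok B s b" and "test_val s b" and "exec B p s t s'"
| exec_Cond_False: "exec B (Cond b p q) s (test_cost b + t) s'"
    if "test_ok B s b" and "\<not> test_val s b" and "exec B q s t s'"
| exec_While_False: "exec B (While b p) s (test_cost b) s"
    if "test_ok B s b" and "\<not> test_val s b"
| exec_While_True: "exec B (While b p) s (test_cost b + t1 + t2) s''"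
    if "test_ok B s b" and "test_val s b"
      and "exec B p s t1 s'" and "exec B (While b p) s' t2 s''"

lemma exec_deterministic:
  "exec B p s t s' \<Longrightarrow> exec B p s u r \<Longrightarrow> t = u \<and> s' = r"
proof (induction arbitrary: u r rule: exec.induct)
  case (exec_Skip s)
  then show ?case by (auto elim: exec.cases)
next
  case (exec_Write s a e)
  from exec_Write(4) show ?case by cases auto
next
  case (exec_Seq p s t1 s' q t2 s'')
  from exec_Seq.prems show ?case by cases (use exec_Seq.IH in blast)
next
  case (exec_Cond_True s b p t s' q)
  from exec_Cond_True.prems show ?case
    by cases (use exec_Cond_True in blast)+
next
  case (exec_Cond_False s b q t s' p)
  from exec_Cond_False.prems show ?case
    by cases (use exec_Cond_False in blast)+
next
  case (exec_While_False s b p)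
  from exec_While_False.prems show ?case
    by cases (use exec_While_False in blast)+
next
  case (exec_While_True s b p t1 s' t2 s'')
  from exec_While_True.prems show ?case
    by cases (use exec_While_True in blast)+
qed

text \<open>
  Input layout for a graph with vertices \<open>0, \<dots>, n - 1\<close> and an integer \<open>h\<close>: the number of
  vertices, \<open>h\<close>, then the adjacency matrix row by row; all remaining cells are zero.
\<close>
definition input_memory :: "nat graph \<Rightarrow> int \<Rightarrow> memory" where
  "input_memory G h = (\<lambda>a. let n = card (verts G) in
     if a = 0 then int n
     else if a = 1 then h
     else if a < 2 + n * n \<and> {(a - 2) div n, (a - 2) mod n} \<in> edges G then 1
     else 0)"

text \<open>
  One program handles all inputs from the class \<open>C\<close>. The running time is bounded in the number
  \<open>n\<close> of vertices alone, and the word length is logarithmic in \<open>n + \<bar>h\<bar>\<close>: values are at most a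
  fixed power of \<open>n + \<bar>h\<bar> + 2\<close>. The answer is left in cell \<open>0\<close>.
\<close>
definition solvable_in_time ::
    "(nat graph \<Rightarrow> int \<Rightarrow> bool) \<Rightarrow> (nat graph \<Rightarrow> bool) \<Rightarrow> (nat \<Rightarrow> nat) \<Rightarrow> bool" where
  "solvable_in_time Q C T \<longleftrightarrow>
     (\<exists>p k. \<forall>G h n. simple_graph G \<longrightarrow> verts G = {..<n} \<longrightarrow> C G \<longrightarrow>
        (\<exists>t s. exec ((int n + \<bar>h\<bar> + 2) ^ k) p (input_memory G h) t s \<and> t \<le> T n \<and>
               s 0 = (if Q G h then 1 else 0)))"

definition hadwiger_number_problem :: "nat graph \<Rightarrow> int \<Rightarrow> bool" where
  "hadwiger_number_problem G h \<longleftrightarrow> int (hadwiger_number G) \<ge> h"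

end

theory Submission
  imports Defs
begin

text \<open>
  \<open>G\<close> has a \<open>K\<^sub>h\<close> minor iff it has \<open>h\<close> disjoint, connected, pairwise adjacent branch sets. Let
  \<open>F\<^sub>U(a)\<close> be the largest number of branch sets inside \<open>U\<close> that leave at least \<open>a\<close> vertices of
  \<open>U\<close> unused. If \<open>A\<close> and \<open>B\<close> are not joined by edges, all branch sets lie on one side, so
  \<open>F\<close> of the union is the maximum of \<open>F\<^sub>A(a)\<close> and \<open>F\<^sub>B(b)\<close> over \<open>a + b = c\<close>. If they are completely
  joined, a branch set meeting both sides may be shrunk to one edge across, since such an edge
  dominates everything; with \<open>j\<close> such edges one gets \<open>F\<^sub>A(a + j) + F\<^sub>B(b + j) + j\<close>, and the maximum
  \<open>P(a, b)\<close> over \<open>j\<close> satisfies \<open>P(a, b) = max (F\<^sub>A(a) + F\<^sub>B(b)) (P(a + 1, b + 1) + 1)\<close>, so that one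
  merge costs \<open>O(n\<^sup>2)\<close>.

  A \<open>P\<^sub>4\<close>-free graph with at least two vertices splits into two parts with all or no edges between
  them, hence contains twins. The algorithm keeps one representative for each of a family of modules,
  and for each pair of representatives the number of representatives that tell them apart. A pair
  that nothing tells apart is found and merged in \<open>O(n\<^sup>2)\<close> time, and there are fewer than \<open>n\<close> merges.
\<close>

section \<open>Minors and branch sets\<close>

text \<open>The reserve \<open>a\<close> is what makes the recursion close: in a join, the number of
  cross edges that can serve as branch sets depends on how many vertices the two sides leave free,
  so the largest models of the sides do not determine the largest model of the union. Maximising
  over \<open>j\<close> separately for each \<open>(a, b)\<close> would need a third loop inside
  every merge; the recurrence along the diagonal avoids it. No decomposition tree is built. The
  representatives induce a subgraph of the input, again \<open>P_4\<close>-free, so twins exist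
  among them while two remain. A merge drops one representative and leaves the adjacency of the
  others alone, so each difference count changes by at most one: three nested loops compute the
  counts once, two nested loops repair them. The time bound is syntactic. Every loop of the source
  language runs exactly \<open>n + c\<close> times with a constant \<open>c\<close>, so the cost is
  bounded by a polynomial whose degree is the nesting depth, here 3, and correctness is proved
  without counting steps. The number \<open>h\<close> is read only in the last comparison, so the
  bound depends on \<open>n\<close> alone.\<close>

definition adj :: "'a graph \<Rightarrow> 'a \<Rightarrow> 'a \<Rightarrow> bool" where
  "adj G x y \<longleftrightarrow> {x, y} \<in> edges G"

text \<open>Connectivity by cuts instead of paths: a contraction then only has to carry one crossing
  edge from one graph to the other. The empty set is excluded, so branch sets are automatically
  nonempty.\<close>

definition conn :: "('a \<Rightarrow> 'a \<Rightarrow> bool) \<Rightarrow> 'a set \<Rightarrow> bool" where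
  "conn E S \<longleftrightarrow> S \<noteq> {} \<and> (\<forall>X. X \<subset> S \<longrightarrow> X \<noteq> {} \<longrightarrow> (\<exists>x\<in>X. \<exists>y\<in>S - X. E x y))"

definition touch :: "('a \<Rightarrow> 'a \<Rightarrow> bool) \<Rightarrow> 'a set \<Rightarrow> 'a set \<Rightarrow> bool" where
  "touch E S T \<longleftrightarrow> (\<exists>x\<in>S. \<exists>y\<in>T. E x y)"

definition clique_model :: "('a \<Rightarrow> 'a \<Rightarrow> bool) \<Rightarrow> 'a set \<Rightarrow> 'a set set \<Rightarrow> bool" where
  "clique_model E U M \<longleftrightarrow> \<Union>M \<subseteq> U \<and> (\<forall>S\<in>M. conn E S) \<and>
     (\<forall>S\<in>M. \<forall>T\<in>M. S \<noteq> T \<longrightarrow> S \<inter> T = {} \<and> touch E S T)"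

text \<open>The parameter \<open>a\<close> is the number of vertices of \<open>U\<close> that have to stay outside all branch sets.\<close>

definition model_number :: "('a \<Rightarrow> 'a \<Rightarrow> bool) \<Rightarrow> 'a set \<Rightarrow> nat \<Rightarrow> nat" where
  "model_number E U a = Max {card M |M. clique_model E U M \<and> card (\<Union>M) + a \<le> card U}"

section \<open>Edge contraction\<close>

lemma adj_commute: "adj G x y = adj G y x"
  by (simp add: adj_def insert_commute)

lemma simple_graph_edgeE:
  assumes "simple_graph G" "e \<in> edges G"
  obtains x y where "e = {x, y}" "x \<noteq> y" "x \<in> verts G" "y \<in> verts G"
proof -
  have "card e = 2" "e \<subseteq> verts G" using assms by (auto simp: simple_graph_def)
  then show ?thesis using that by (auto simp: card_2_iff)
qed

text \<open>An edge of a simple graph has two distinct ends, so its image is a singleton only if the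
  edge is \<open>{u, v}\<close>, and that singleton is \<open>{u}\<close>. Discarding
  \<open>{u}\<close> therefore amounts to requiring distinct ends.\<close>

lemma adj_contract:
  assumes "simple_graph G" "u \<noteq> v" "v \<in> verts G"
  shows "adj (contract_edge G u v) x y \<longleftrightarrow>
    x \<noteq> y \<and> (\<exists>a b. adj G a b \<and> (id(v := u)) a = x \<and> (id(v := u)) b = y)"
proof -
  let ?f = "id(v := u)"
  have "{x, y} \<in> (`) ?f ` edges G - {{u}} \<longleftrightarrow>
    x \<noteq> y \<and> (\<exists>a b. {a, b} \<in> edges G \<and> ?f a = x \<and> ?f b = y)" (is "?l \<longleftrightarrow> ?r")
  proof
    assume ?l
    then obtain e where e: "e \<in> edges G" "{x, y} = ?f ` e" "{x, y} \<noteq> {u}" by auto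
    obtain a b where ab: "e = {a, b}" "a \<noteq> b" by (rule simple_graph_edgeE[OF assms(1) e(1)])
    have im: "{x, y} = {?f a, ?f b}" using e(2) ab by simp
    have ne: "x \<noteq> y"
    proof
      assume "x = y"
      then have "?f a = ?f b" "?f a = x" using im by (auto simp: doubleton_eq_iff)
      then have "x = u" using ab(2) by (auto split: if_splits)
      then show False using e(3) \<open>x = y\<close> by simp
    qed
    from im have "?f a = x \<and> ?f b = y \<or> ?f b = x \<and> ?f a = y" by (auto simp: doubleton_eq_iff)
    then show ?r
    proof
      assume "?f a = x \<and> ?f b = y" then show ?r using ne e(1) ab(1) by blast
    next
      assume "?f b = x \<and> ?f a = y"
      moreover have "{b, a} \<in> edges G" using e(1) ab(1) by (simp add: insert_commute)
      ultimately show ?r using ne by blast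
    qed
  next
    assume ?r
    then obtain a b where ab: "{a, b} \<in> edges G" "?f a = x" "?f b = y" "x \<noteq> y" by blast
    have "{x, y} = {?f a, ?f b}" using ab(2,3) by simp
    then have "{x, y} = ?f ` {a, b}" by (simp only: image_insert image_empty)
    moreover have "{x, y} \<noteq> {u}" using ab(4) by auto
    ultimately show ?l using ab(1) by blast
  qed
  then show ?thesis by (simp add: adj_def contract_edge_def)
qed

lemma simple_graph_contract:
  assumes "simple_graph G" "{u, v} \<in> edges G" "u \<noteq> v"
  shows "simple_graph (contract_edge G u v)"
proof -
  have uv: "u \<in> verts G" "v \<in> verts G" using assms by (auto simp: simple_graph_def)
  have fin: "finite (verts G)" using assms by (simp add: simple_graph_def)
  have "e' \<subseteq> verts G - {v} \<and> card e' = 2" if e': "e' \<in> (`) (id(v := u)) ` edges G - {{u}}" for e'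
  proof -
    from e' obtain e where e: "e \<in> edges G" "e' = (id(v := u)) ` e" "e' \<noteq> {u}" by auto
    obtain a b where ab: "e = {a, b}" "a \<noteq> b" "a \<in> verts G" "b \<in> verts G"
      by (rule simple_graph_edgeE[OF assms(1) e(1)])
    let ?f = "id(v := u)"
    have "e' = {?f a, ?f b}" using e(2) ab(1) by simp
    moreover have "?f a \<noteq> ?f b"
    proof
      assume eq: "?f a = ?f b"
      then have "?f a = u" using ab(2) by (auto split: if_splits)
      then show False using \<open>e' = {?f a, ?f b}\<close> eq e(3) by simp
    qed
    moreover have "?f a \<in> verts G - {v}" "?f b \<in> verts G - {v}" using ab uv assms(3) by auto
    ultimately show ?thesis by simp
  qed
  then show ?thesis using fin by (auto simp: simple_graph_def contract_edge_def)
qed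

lemma simple_graph_minor_step:
  assumes "minor_step G G'" "simple_graph G"
  shows "simple_graph G'"
  using assms
proof cases
  case (1 v)
  then show ?thesis using assms(2) by (auto simp: simple_graph_def delete_vertex_def)
next
  case (2 e)
  then show ?thesis using assms(2) by (auto simp: simple_graph_def delete_edge_def)
next
  case (3 u v)
  then show ?thesis using assms(2) by (simp add: simple_graph_contract)
qed

section \<open>Branch sets under minor operations\<close>

lemma conn_mono:
  assumes "conn E S" "\<And>x y. x \<in> S \<Longrightarrow> y \<in> S \<Longrightarrow> E x y \<Longrightarrow> E' x y"
  shows "conn E' S"
proof -
  have "\<exists>x\<in>X. \<exists>y\<in>S - X. E' x y" if "X \<subset> S" "X \<noteq> {}" for X
  proof -
    obtain x y where "x \<in> X" "y \<in> S - X" "E x y"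
      using assms(1) \<open>X \<subset> S\<close> \<open>X \<noteq> {}\<close> unfolding conn_def by blast
    then show ?thesis using assms(2) \<open>X \<subset> S\<close> by blast
  qed
  then show ?thesis using assms(1) unfolding conn_def by blast
qed

lemma clique_model_mono:
  assumes "clique_model E U M" "U \<subseteq> U'" "\<And>x y. x \<in> U \<Longrightarrow> y \<in> U \<Longrightarrow> E x y \<Longrightarrow> E' x y"
  shows "clique_model E' U' M"
proof -
  have sub: "\<Union>M \<subseteq> U" using assms(1) by (simp add: clique_model_def)
  have "conn E' S" if "S \<in> M" for S
  proof (rule conn_mono)
    show "conn E S" using that assms(1) by (simp add: clique_model_def)
    show "E' x y" if "x \<in> S" "y \<in> S" "E x y" for x y
      using that sub \<open>S \<in> M\<close> by (intro assms(3)) auto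
  qed
  moreover have "touch E' S T" if "S \<in> M" "T \<in> M" "S \<noteq> T" for S T
  proof -
    have "touch E S T" using that assms(1) by (simp add: clique_model_def)
    then show ?thesis using that sub assms(3) unfolding touch_def by blast
  qed
  moreover have "S \<inter> T = {}" if "S \<in> M" "T \<in> M" "S \<noteq> T" for S T
    using that assms(1) by (simp add: clique_model_def)
  ultimately show ?thesis using sub assms(2) by (simp add: clique_model_def)
qed

text \<open>Undoing a contraction gives \<open>v\<close> to the branch set that contains
  \<open>u\<close>. Every edge of the contracted graph comes from an edge of \<open>G\<close>, and
  the edge \<open>{u, v}\<close> keeps the enlarged set connected. No branch set contained
  \<open>v\<close> before, so no two of them become equal.\<close>

lemma clique_model_uncontract:
  assumes G: "simple_graph G" and uv: "{u, v} \<in> edges G" "u \<noteq> v"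
    and M: "clique_model (adj (contract_edge G u v)) (verts G - {v}) M"
  defines "g \<equiv> \<lambda>S. if u \<in> S then insert v S else S"
  shows "clique_model (adj G) (verts G) (g ` M)" "inj_on g M"
proof -
  let ?E' = "adj (contract_edge G u v)"
  have V: "u \<in> verts G" "v \<in> verts G" using G uv by (auto simp: simple_graph_def)
  have auv: "adj G u v" "adj G v u" using uv by (auto simp: adj_def insert_commute)
  have E': "?E' x y \<Longrightarrow> \<exists>a b. adj G a b \<and> (id(v := u)) a = x \<and> (id(v := u)) b = y" for x y
    using adj_contract[OF G uv(2) V(2)] by blast
  have vM: "v \<notin> S" if "S \<in> M" for S using M that by (auto simp: clique_model_def)
  show inj: "inj_on g M"
    using vM unfolding inj_on_def g_def by (metis insert_ident insertI1)
  have lift: "\<exists>a\<in>g S. \<exists>b\<in>g T. adj G a b" if xy: "x \<in> S" "y \<in> T" "?E' x y" for x y S T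
  proof -
    obtain a b where "adj G a b" "(id(v := u)) a = x" "(id(v := u)) b = y" using E' xy(3) by blast
    then show ?thesis using xy unfolding g_def by (intro bexI[of _ a] bexI[of _ b]) (auto split: if_splits)
  qed
  have "conn (adj G) (g S)" if S: "S \<in> M" for S
  proof -
    have cS: "conn ?E' S" using M S by (simp add: clique_model_def)
    have "\<exists>x\<in>X. \<exists>y\<in>g S - X. adj G x y" if X: "X \<subset> g S" "X \<noteq> {}" for X
    \<comment> \<open>If the cut separates \<open>u\<close> from \<open>v\<close>, their edge
      crosses it. Otherwise dropping \<open>v\<close> gives a cut of \<open>S\<close>, and the edge
      crossing that one pulls back to an edge crossing \<open>X\<close>.\<close>
    proof (cases "u \<in> S \<and> (u \<in> X \<longleftrightarrow> v \<notin> X)")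
      case True
      then have "u \<in> g S" "v \<in> g S" by (auto simp: g_def)
      then show ?thesis using True auv by blast
    next
      case False
      let ?X = "X - {v}"
      have "?X \<noteq> {}" using False X vM[OF S] by (auto simp: g_def split: if_splits)
      moreover have "?X \<subset> S" using False X vM[OF S] by (auto simp: g_def split: if_splits)
      ultimately obtain x y where xy: "x \<in> ?X" "y \<in> S - ?X" "?E' x y"
        using cS unfolding conn_def by meson
      obtain a b where "adj G a b" "(id(v := u)) a = x" "(id(v := u)) b = y" using E' xy by blast
      then show ?thesis using xy False vM[OF S] X(1) unfolding g_def
        by (intro bexI[of _ a] bexI[of _ b]) (auto split: if_splits)
    qed
    moreover have "g S \<noteq> {}" using cS by (auto simp: conn_def g_def)
    ultimately show ?thesis by (simp add: conn_def)
  qed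
  moreover have "g S \<inter> g T = {} \<and> touch (adj G) (g S) (g T)" if "S \<in> M" "T \<in> M" "S \<noteq> T" for S T
  proof -
    have "S \<inter> T = {}" "touch ?E' S T" using M that by (auto simp: clique_model_def)
    then have "touch (adj G) (g S) (g T)" using lift unfolding touch_def by blast
    moreover have "g S \<inter> g T = {}" using \<open>S \<inter> T = {}\<close> vM that by (auto simp: g_def)
    ultimately show ?thesis by blast
  qed
  moreover have "\<Union>(g ` M) \<subseteq> verts G"
    using M V by (auto simp: clique_model_def g_def split: if_splits)
  ultimately show "clique_model (adj G) (verts G) (g ` M)"
    unfolding clique_model_def by blast
qed

text \<open>The contracted edge lies inside \<open>S0\<close>, the only branch set containing
  \<open>u\<close> or \<open>v\<close>. It keeps \<open>u\<close>, so no set becomes empty and no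
  two become equal.\<close>

lemma clique_model_contract:
  assumes G: "simple_graph G" and uv: "{u, v} \<in> edges G" "u \<noteq> v"
    and M: "clique_model (adj G) (verts G) M" and S0: "S0 \<in> M" "u \<in> S0" "v \<in> S0"
  defines "g \<equiv> \<lambda>S. S - {v}"
  shows "clique_model (adj (contract_edge G u v)) (verts G - {v}) (g ` M)" "inj_on g M"
proof -
  let ?E' = "adj (contract_edge G u v)"
  have V: "u \<in> verts G" "v \<in> verts G" using G uv by (auto simp: simple_graph_def)
  have E': "?E' x y" if "adj G a b" "(id(v := u)) a = x" "(id(v := u)) b = y" "x \<noteq> y" for x y a b
    using adj_contract[OF G uv(2) V(2)] that by blast
  have only: "S = S0" if "S \<in> M" "v \<in> S \<or> u \<in> S" for S
    using M that S0 unfolding clique_model_def by blast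
  show inj: "inj_on g M"
  proof (rule inj_onI)
    fix S T assume ST: "S \<in> M" "T \<in> M" "g S = g T"
    show "S = T"
    proof (cases "v \<in> S \<or> v \<in> T")
      case True
      then have "u \<in> g S" using only[OF ST(1)] only[OF ST(2)] S0 uv(2) ST(3) by (auto simp: g_def)
      then have "u \<in> S" "u \<in> T" using ST(3) by (auto simp: g_def)
      then show ?thesis using only ST by blast
    next
      case False
      then show ?thesis using ST(3) by (auto simp: g_def)
    qed
  qed
  have vS: "v \<in> S \<longleftrightarrow> u \<in> S" if "S \<in> M" for S using only[OF that] S0 by blast
  have mem: "(id(v := u)) a \<in> g S" if "a \<in> S" "S \<in> M" for a S
    using that vS[OF that(2)] uv(2) unfolding g_def by auto
  have "conn ?E' (g S)" if S: "S \<in> M" for S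
  proof -
    have cS: "conn (adj G) S" using M S by (simp add: clique_model_def)
    have "\<exists>x\<in>X. \<exists>y\<in>g S - X. ?E' x y" if X: "X \<subset> g S" "X \<noteq> {}" for X
    proof -
      \<comment> \<open>The cut is enlarged so that it does not separate \<open>u\<close> from
        \<open>v\<close>; an edge of \<open>G\<close> crossing it still has its ends on different
        sides after \<open>v\<close> is renamed to \<open>u\<close>.\<close>
      let ?X = "if u \<in> X then insert v X else X"
      have "?X \<noteq> {}" using X by auto
      moreover have "?X \<subset> S" using X vS[OF S] by (auto simp: g_def split: if_splits)
      ultimately obtain a b where ab: "a \<in> ?X" "b \<in> S - ?X" "adj G a b"
        using cS unfolding conn_def by blast
      have "(id(v := u)) a \<in> X" using ab(1) X by (auto simp: g_def split: if_splits)
      moreover have "(id(v := u)) b \<in> g S - X"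
        using ab(2) mem[OF _ S, of b] vS[OF S] by (auto split: if_splits)
      ultimately show ?thesis
        by (intro bexI[of _ "(id(v := u)) a"] bexI[of _ "(id(v := u)) b"] E'[OF ab(3) refl refl]) auto
    qed
    moreover have "g S \<noteq> {}" using cS vS[OF S] uv(2) unfolding conn_def g_def by blast
    ultimately show ?thesis by (simp add: conn_def)
  qed
  moreover have "g S \<inter> g T = {} \<and> touch ?E' (g S) (g T)" if ST: "S \<in> M" "T \<in> M" "S \<noteq> T" for S T
  proof -
    have d: "S \<inter> T = {}" and "touch (adj G) S T" using M ST by (auto simp: clique_model_def)
    then obtain a b where ab: "a \<in> S" "b \<in> T" "adj G a b" by (auto simp: touch_def)
    have d': "g S \<inter> g T = {}" using d by (auto simp: g_def)
    have "?E' ((id(v := u)) a) ((id(v := u)) b)"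
      by (rule E'[OF ab(3) refl refl]) (use mem[OF ab(1) ST(1)] mem[OF ab(2) ST(2)] d' in auto)
    then show ?thesis using d' mem[OF ab(1) ST(1)] mem[OF ab(2) ST(2)] unfolding touch_def by blast
  qed
  moreover have "\<Union>(g ` M) \<subseteq> verts G - {v}"
    using M by (auto simp: clique_model_def g_def)
  ultimately show "clique_model ?E' (verts G - {v}) (g ` M)"
    unfolding clique_model_def by blast
qed

lemma minor_step_model:
  assumes "minor_step G G'" "simple_graph G" "clique_model (adj G') (verts G') M"
  shows "\<exists>M'. clique_model (adj G) (verts G) M' \<and> card M' = card M"
  using assms(1)
proof cases
  case (1 v)
  have "clique_model (adj G) (verts G) M"
    by (rule clique_model_mono[OF assms(3)]) (auto simp: 1 delete_vertex_def adj_def)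
  then show ?thesis by blast
next
  case (2 e)
  have "clique_model (adj G) (verts G) M"
    by (rule clique_model_mono[OF assms(3)]) (auto simp: 2 delete_edge_def adj_def)
  then show ?thesis by blast
next
  case (3 u v)
  have "clique_model (adj (contract_edge G u v)) (verts G - {v}) M"
    using assms(3) 3(1) by (simp add: contract_edge_def)
  from clique_model_uncontract[OF assms(2) 3(2,3) this] show ?thesis
    using card_image by blast
qed

lemma minor_steps_model:
  assumes "minor_step\<^sup>*\<^sup>* G G'" "simple_graph G" "clique_model (adj G') (verts G') M"
  shows "\<exists>M'. clique_model (adj G) (verts G) M' \<and> card M' = card M"
  using assms
proof (induction rule: converse_rtranclp_induct)
  case base
  then show ?case by blast
next
  case (step G G1)
  then obtain M1 where "clique_model (adj G1) (verts G1) M1" "card M1 = card M"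
    using simple_graph_minor_step by blast
  then show ?case using minor_step_model[OF step(1) step(4)] by metis
qed

lemma conn_singleton: "conn E {x}"
  unfolding conn_def by blast

text \<open>In a complete graph the singletons form a model, and every minor step can be undone on
  models without changing their number of branch sets.\<close>

lemma complete_minor_model:
  assumes "simple_graph G" "is_minor (complete_graph h) G"
  shows "\<exists>M. clique_model (adj G) (verts G) M \<and> card M = h"
proof -
  obtain G' f where G': "minor_step\<^sup>*\<^sup>* G G'" "bij_betw f {..<h} (verts G')"
    "edges G' = (`) f ` {{i, j} | i j. i < h \<and> j < h \<and> i \<noteq> j}"
    using assms(2) by (auto simp: is_minor_def graph_iso_def complete_graph_def)
  let ?M = "(\<lambda>x. {x}) ` verts G'"
  have "adj G' x y" if xy: "x \<in> verts G'" "y \<in> verts G'" "x \<noteq> y" for x y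
  proof -
    have im: "verts G' = f ` {..<h}" using G'(2) by (simp add: bij_betw_def)
    obtain i j where ij: "i < h" "j < h" "x = f i" "y = f j" using xy(1,2) im by auto
    then have "i \<noteq> j" using xy(3) by blast
    then have "{i, j} \<in> {{i, j} | i j. i < h \<and> j < h \<and> i \<noteq> j}" using ij by blast
    then have "f ` {i, j} \<in> edges G'" using G'(3) by blast
    then show ?thesis using ij by (simp add: adj_def)
  qed
  then have "clique_model (adj G') (verts G') ?M"
    unfolding clique_model_def touch_def using conn_singleton by auto
  moreover have "card ?M = h"
    using bij_betw_same_card[OF G'(2)] by (simp add: card_image)
  ultimately show ?thesis using minor_steps_model[OF G'(1) assms(1)] by metis
qed

lemma finite_clique_model: "finite U \<Longrightarrow> clique_model E U M \<Longrightarrow> finite M"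
  unfolding clique_model_def by (meson finite_UnionD finite_subset)

text \<open>Induction on the number of vertices. A vertex outside all branch sets can be deleted,
  and an edge inside a branch set can be contracted. Once neither is possible, the branch sets are
  exactly the singletons of all vertices, and as they touch pairwise the graph is complete.\<close>

lemma model_complete_minor:
  assumes "simple_graph G" "clique_model (adj G) (verts G) M"
  shows "is_minor (complete_graph (card M)) G"
  using assms
proof (induction "card (verts G)" arbitrary: G M rule: less_induct)
  case less
  have fin: "finite (verts G)" using less.prems(1) by (simp add: simple_graph_def)
  have step: "is_minor H G" if "minor_step G G'" "is_minor H G'" for H :: "nat graph" and G'
    using that unfolding is_minor_def by (meson converse_rtranclp_into_rtranclp)
  consider (spare) v where "v \<in> verts G" "v \<notin> \<Union>M"
    | (big) S u v where "S \<in> M" "u \<in> S" "v \<in> S" "u \<noteq> v"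
    | (full) "\<Union>M = verts G" "\<And>S u v. S \<in> M \<Longrightarrow> u \<in> S \<Longrightarrow> v \<in> S \<Longrightarrow> u = v"
  proof -
    have "\<Union>M \<subseteq> verts G" using less.prems(2) by (simp add: clique_model_def)
    then show thesis using that by blast
  qed
  then show ?case
  proof cases
    case spare
    let ?G = "delete_vertex G v"
    have st: "minor_step G ?G" using spare by (intro minor_step.intros)
    have "clique_model (adj G) (verts G - {v}) M"
      using less.prems(2) spare unfolding clique_model_def by blast
    then have "clique_model (adj ?G) (verts ?G) M"
      by (rule clique_model_mono) (auto simp: delete_vertex_def adj_def)
    moreover have "card (verts ?G) < card (verts G)"
      using spare fin by (simp add: delete_vertex_def card_Diff1_less del: card_Diff_insert)
    ultimately have "is_minor (complete_graph (card M)) ?G"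
      using less.hyps simple_graph_minor_step[OF st less.prems(1)] by blast
    then show ?thesis using step st by blast
  next
    case big
    have "conn (adj G) S" using less.prems(2) big by (simp add: clique_model_def)
    moreover have "{u} \<subset> S" using big by blast
    ultimately obtain w where w: "w \<in> S" "w \<noteq> u" "adj G u w" unfolding conn_def by blast
    let ?G = "contract_edge G u w"
    have e: "{u, w} \<in> edges G" "u \<noteq> w" using w by (auto simp: adj_def)
    have st: "minor_step G ?G" using e by (intro minor_step.intros)
    note c = clique_model_contract[OF less.prems(1) e less.prems(2) big(1) big(2) w(1)]
    have V: "w \<in> verts G" using e less.prems(1) by (auto simp: simple_graph_def)
    have "card (verts ?G) < card (verts G)"
      using V fin by (simp add: contract_edge_def card_Diff1_less del: card_Diff_insert)
    then have "is_minor (complete_graph (card ((\<lambda>S. S - {w}) ` M))) ?G"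
      by (rule less.hyps) (use simple_graph_minor_step[OF st less.prems(1)] c(1) in \<open>auto simp: contract_edge_def\<close>)
    then show ?thesis using step[OF st] c(2) by (simp add: card_image)
  next
    case full
    have sing: "\<exists>x\<in>verts G. S = {x}" if "S \<in> M" for S
    proof -
      have "S \<noteq> {}" using less.prems(2) that by (simp add: clique_model_def conn_def)
      then obtain x where "x \<in> S" by blast
      moreover have "S = {x}" using full(2)[OF that] \<open>x \<in> S\<close> by blast
      ultimately show ?thesis using full(1) that by blast
    qed
    have M: "M = (\<lambda>x. {x}) ` verts G"
    proof
      show "M \<subseteq> (\<lambda>x. {x}) ` verts G" using sing by blast
      show "(\<lambda>x. {x}) ` verts G \<subseteq> M"
      proof
        fix S assume "S \<in> (\<lambda>x. {x}) ` verts G"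
        then obtain x where x: "S = {x}" "x \<in> verts G" by blast
        then obtain T where "T \<in> M" "x \<in> T" using full(1) by blast
        then show "S \<in> M" using sing[of T] x by auto
      qed
    qed
    then have card: "card M = card (verts G)" by (simp add: card_image)
    obtain f where f: "bij_betw f {..<card (verts G)} (verts G)"
      using fin by (metis atLeast0LessThan ex_bij_betw_nat_finite)
    have adjc: "{x, y} \<in> edges G" if xy: "x \<in> verts G" "y \<in> verts G" "x \<noteq> y" for x y
    proof -
      have "{x} \<in> M" "{y} \<in> M" using M xy by auto
      then have "touch (adj G) {x} {y}" using less.prems(2) xy(3) by (simp add: clique_model_def)
      then show ?thesis by (simp add: touch_def adj_def)
    qed
    have "edges G = (`) f ` {{i, j} | i j. i < card (verts G) \<and> j < card (verts G) \<and> i \<noteq> j}"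
      (is "_ = ?R")
    proof (intro equalityI subsetI)
      fix e assume e: "e \<in> edges G"
      obtain x y where xy: "e = {x, y}" "x \<noteq> y" "x \<in> verts G" "y \<in> verts G"
        by (rule simple_graph_edgeE[OF less.prems(1) e])
      have "x \<in> f ` {..<card (verts G)}" "y \<in> f ` {..<card (verts G)}"
        using xy(3,4) bij_betw_imp_surj_on[OF f] by simp_all
      then obtain i j where "i < card (verts G)" "j < card (verts G)" "x = f i" "y = f j"
        by blast
      then show "e \<in> ?R" using xy by (intro image_eqI[of _ _ "{i, j}"]) auto
    next
      fix e assume "e \<in> ?R"
      then obtain i j where ij: "e = {f i, f j}" "i < card (verts G)" "j < card (verts G)" "i \<noteq> j"
        by auto
      then have "f i \<noteq> f j" "f i \<in> verts G" "f j \<in> verts G"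
        using f by (auto simp: bij_betw_def inj_on_def)
      then show "e \<in> edges G" using adjc ij by blast
    qed
    then have "graph_iso (complete_graph (card M)) G"
      using f card by (auto simp: graph_iso_def complete_graph_def)
    then show ?thesis unfolding is_minor_def by blast
  qed
qed

section \<open>The functions \<open>F_U\<close>\<close>

lemma card_le_model_number:
  assumes "finite U" "clique_model E U M" "card (\<Union>M) + a \<le> card U"
  shows "card M \<le> model_number E U a"
proof -
  have "{card M |M. clique_model E U M \<and> card (\<Union>M) + a \<le> card U} \<subseteq> card ` Pow (Pow U)"
    by (auto simp: clique_model_def)
  then have "finite {card M |M. clique_model E U M \<and> card (\<Union>M) + a \<le> card U}"
    using assms(1) by (meson finite_Pow_iff finite_imageI finite_subset)
  then show ?thesis unfolding model_number_def using assms by (intro Max_ge) auto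
qed

lemma model_numberE:
  assumes "finite U" "a \<le> card U"
  obtains M where "clique_model E U M" "card (\<Union>M) + a \<le> card U" "card M = model_number E U a"
proof -
  let ?A = "{card M |M. clique_model E U M \<and> card (\<Union>M) + a \<le> card U}"
  have "?A \<subseteq> card ` Pow (Pow U)"
    by (auto simp: clique_model_def)
  then have "finite ?A" using assms(1) by (meson finite_Pow_iff finite_imageI finite_subset)
  moreover have "card {} \<in> ?A" using assms(2)
    by (intro CollectI exI[of _ "{}"]) (simp add: clique_model_def)
  ultimately have "model_number E U a \<in> ?A" unfolding model_number_def by (intro Max_in) auto
  then show ?thesis using that by auto
qed

lemma card_clique_model_le:
  assumes "finite U" "clique_model E U M"
  shows "card M \<le> card (\<Union>M)"
proof -
  have fin: "finite M" "finite (\<Union>M)" using assms finite_clique_model finite_subset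
    by (auto simp: clique_model_def)
  have "card (\<Union>M) = (\<Sum>S\<in>M. card S)"
    by (rule card_Union_disjoint)
      (use assms fin in \<open>auto simp: clique_model_def pairwise_def disjnt_def intro: finite_subset\<close>)
  also have "\<dots> \<ge> (\<Sum>S\<in>M. 1)"
    by (rule sum_mono)
      (use assms fin in \<open>auto simp: clique_model_def conn_def Suc_le_eq card_gt_0_iff intro: finite_subset\<close>)
  finally show ?thesis by simp
qed

lemma model_number_le:
  assumes "finite U" "a \<le> card U"
  shows "model_number E U a + a \<le> card U"
  using model_numberE[OF assms, of E] card_clique_model_le[OF assms(1)]
  by (metis add.commute add_le_mono1 le_trans nat_add_left_cancel_le)

lemma hadwiger_number_eq:
  assumes "simple_graph G"
  shows "hadwiger_number G = model_number (adj G) (verts G) 0"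
proof -
  have fin: "finite (verts G)" using assms by (simp add: simple_graph_def)
  have "is_minor (complete_graph (model_number (adj G) (verts G) 0)) G"
    using model_numberE[OF fin, of 0 "adj G"] model_complete_minor[OF assms] by (metis zero_le)
  moreover have "h \<le> model_number (adj G) (verts G) 0" if hm: "is_minor (complete_graph h) G" for h
  proof -
    obtain M where M: "clique_model (adj G) (verts G) M" "card M = h"
      using complete_minor_model[OF assms hm] by blast
    have "card (\<Union>M) \<le> card (verts G)"
      using M(1) fin by (auto simp: clique_model_def intro: card_mono)
    then show ?thesis using card_le_model_number[OF fin M(1), of 0] M(2) by simp
  qed
  ultimately show ?thesis unfolding hadwiger_number_def by (intro Greatest_equality) auto
qed

lemma clique_model_nonempty: "clique_model E U M \<Longrightarrow> S \<in> M \<Longrightarrow> S \<noteq> {}"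
  by (simp add: clique_model_def conn_def)

lemma clique_model_subset: "clique_model E U M \<Longrightarrow> M' \<subseteq> M \<Longrightarrow> \<Union>M' \<subseteq> U' \<Longrightarrow> clique_model E U' M'"
  unfolding clique_model_def by (meson subsetD)

lemma clique_model_disjoint:
  "clique_model E U M \<Longrightarrow> S \<in> M \<Longrightarrow> T \<in> M \<Longrightarrow> x \<in> S \<Longrightarrow> x \<in> T \<Longrightarrow> S = T"
  unfolding clique_model_def by (meson disjoint_iff)

section \<open>Disjoint unions and joins\<close>

text \<open>The vertices of \<open>U\<close> outside \<open>A\<close> lie in no branch set of a
  model inside \<open>A\<close>, so they can supply \<open>b\<close> additional reserved
  vertices.\<close>

lemma model_number_mono:
  assumes "finite U" "A \<subseteq> U" "a \<le> card A" "a + b \<le> card U" "b \<le> card U - card A"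
  shows "model_number E A a \<le> model_number E U (a + b)"
proof -
  have fin: "finite A" using assms finite_subset by blast
  obtain M where M: "clique_model E A M" "card (\<Union>M) + a \<le> card A" "card M = model_number E A a"
    using model_numberE[OF fin assms(3)] .
  have "card A \<le> card U" using assms by (simp add: card_mono)
  then have "card (\<Union>M) + (a + b) \<le> card U" using M(2) assms(5) by simp
  then show ?thesis
    using card_le_model_number[OF assms(1) clique_model_mono[OF M(1) assms(2)], of E] M(3) by simp
qed

text \<open>The side without branch sets is entirely free and takes as much of the reserve
  \<open>c\<close> as it has vertices. Only the rest burdens the other side, which is what the
  truncated subtractions \<open>c - card B\<close> and \<open>c - card A\<close> express.\<close>

lemma model_number_union_le:
  assumes fin: "finite A" "finite B" and disj: "A \<inter> B = {}"
    and E: "\<And>x y. x \<in> A \<Longrightarrow> y \<in> B \<Longrightarrow> \<not> E x y \<and> \<not> E y x"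
    and c: "c \<le> card A + card B"
  shows "\<exists>a\<le>card A. \<exists>b\<le>card B. a + b = c \<and>
    model_number E (A \<union> B) c \<le> max (model_number E A a) (model_number E B b)"
proof -
  have cU: "card (A \<union> B) = card A + card B" using fin disj by (simp add: card_Un_disjoint)
  obtain M where M: "clique_model E (A \<union> B) M" "card (\<Union>M) + c \<le> card A + card B"
    "card M = model_number E (A \<union> B) c"
    using model_numberE[of "A \<union> B" c E] fin c cU by (metis finite_Un)
  have side: "S \<subseteq> A \<or> S \<subseteq> B" if S: "S \<in> M" for S
  proof (rule ccontr)
    assume not: "\<not> (S \<subseteq> A \<or> S \<subseteq> B)"
    have sub: "S \<subseteq> A \<union> B" using M(1) S by (auto simp: clique_model_def)
    have "S \<inter> A \<subset> S" "S \<inter> A \<noteq> {}" using not sub by blast+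
    then obtain x y where "x \<in> S \<inter> A" "y \<in> S - S \<inter> A" "E x y"
      using M(1) S unfolding clique_model_def conn_def by meson
    then show False using E sub by blast
  qed
  have all: "\<Union>M \<subseteq> A \<or> \<Union>M \<subseteq> B"
  proof (rule ccontr)
    assume not: "\<not> (\<Union>M \<subseteq> A \<or> \<Union>M \<subseteq> B)"
    then obtain S T where ST: "S \<in> M" "T \<in> M" "\<not> S \<subseteq> A" "\<not> T \<subseteq> B" by blast
    then have sub: "S \<subseteq> B" "T \<subseteq> A" using side by blast+
    then have "S \<noteq> T" using ST disj clique_model_nonempty[OF M(1) ST(1)] by blast
    then have "touch E S T" using M(1) ST by (simp add: clique_model_def)
    then show False using sub E unfolding touch_def by blast
  qed
  have "\<exists>a\<le>card A. \<exists>b\<le>card B. a + b = c \<and>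
    (card M \<le> model_number E A a \<or> card M \<le> model_number E B b)"
    using all
  proof
    assume sub: "\<Union>M \<subseteq> A"
    let ?a = "c - card B"
    have "card (\<Union>M) \<le> card A" using sub fin by (simp add: card_mono)
    then have "card M \<le> model_number E A ?a"
      using card_le_model_number[OF fin(1) clique_model_subset[OF M(1) subset_refl sub]] M(2) by simp
    then show ?thesis using c by (intro exI[of _ ?a] exI[of _ "c - ?a"] conjI) auto
  next
    assume sub: "\<Union>M \<subseteq> B"
    let ?b = "c - card A"
    have "card (\<Union>M) \<le> card B" using sub fin by (simp add: card_mono)
    then have "card M \<le> model_number E B ?b"
      using card_le_model_number[OF fin(2) clique_model_subset[OF M(1) subset_refl sub]] M(2) by simp
    then show ?thesis using c by (intro exI[of _ "c - ?b"] exI[of _ ?b] conjI) auto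
  qed
  then show ?thesis using M(3) by (metis le_max_iff_disj)
qed

text \<open>
  \<open>j\<close> counts the branch sets that meet both sides; each of them uses up a vertex on either side.
\<close>

definition join_number :: "('a \<Rightarrow> 'a \<Rightarrow> bool) \<Rightarrow> 'a set \<Rightarrow> 'a set \<Rightarrow> nat \<Rightarrow> nat \<Rightarrow> nat" where
  "join_number E A B a b = Max {model_number E A (a + j) + model_number E B (b + j) + j |j.
     a + j \<le> card A \<and> b + j \<le> card B}"

text \<open>Splitting off \<open>j = 0\<close> and shifting the remaining \<open>j\<close> by one
  turns the maximum for \<open>(a, b)\<close> into that for \<open>(Suc a, Suc b)\<close>, so each
  value is obtained from an earlier one in constant time.\<close>

lemma join_number_rec:
  assumes "a \<le> card A" "b \<le> card B"
  shows "join_number E A B a b =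
    (if a < card A \<and> b < card B
     then max (model_number E A a + model_number E B b) (Suc (join_number E A B (Suc a) (Suc b)))
     else model_number E A a + model_number E B b)"
proof -
  define S where "S = (\<lambda>a b. {model_number E A (a + j) + model_number E B (b + j) + j |j.
     a + j \<le> card A \<and> b + j \<le> card B})"
  have J: "join_number E A B a b = Max (S a b)" for a b by (simp add: join_number_def S_def)
  have fin: "finite (S a b)" for a b
  proof -
    have "S a b \<subseteq> (\<lambda>j. model_number E A (a + j) + model_number E B (b + j) + j) ` {..card A}"
      by (auto simp: S_def)
    then show ?thesis by (meson finite_atMost finite_imageI finite_subset)
  qed
  have ins: "S a b = insert (model_number E A a + model_number E B b) (Suc ` S (Suc a) (Suc b))"
    (is "_ = ?R")
  proof (intro equalityI subsetI)
    fix x assume "x \<in> S a b"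
    then obtain j where j: "x = model_number E A (a + j) + model_number E B (b + j) + j"
      "a + j \<le> card A" "b + j \<le> card B" by (auto simp: S_def)
    show "x \<in> ?R"
    proof (cases j)
      case 0
      then show ?thesis using j by simp
    next
      case (Suc i)
      then have "x = Suc (model_number E A (Suc a + i) + model_number E B (Suc b + i) + i)"
        using j by simp
      moreover have "model_number E A (Suc a + i) + model_number E B (Suc b + i) + i \<in> S (Suc a) (Suc b)"
        unfolding S_def using j Suc by (intro CollectI exI[of _ i]) simp
      ultimately show ?thesis by blast
    qed
  next
    fix x assume "x \<in> ?R"
    then consider "x = model_number E A a + model_number E B b"
      | i where "x = Suc (model_number E A (Suc a + i) + model_number E B (Suc b + i) + i)"
          "Suc a + i \<le> card A" "Suc b + i \<le> card B"
      by (auto simp: S_def)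
    then show "x \<in> S a b"
    proof cases
      case 1
      then show ?thesis unfolding S_def using assms by (intro CollectI exI[of _ 0]) simp
    next
      case 2
      then show ?thesis unfolding S_def by (intro CollectI exI[of _ "Suc i"]) simp
    qed
  qed
  show ?thesis
  proof (cases "a < card A \<and> b < card B")
    case True
    then have ne: "S (Suc a) (Suc b) \<noteq> {}"
      unfolding S_def by (auto intro!: exI[of _ 0])
    have "Max (Suc ` S (Suc a) (Suc b)) = Suc (Max (S (Suc a) (Suc b)))"
      using mono_Max_commute[OF mono_Suc fin ne] by simp
    then show ?thesis using True ne fin by (simp add: J ins)
  next
    case False
    \<comment> \<open>On the border the shifted set is empty and its \<open>Max\<close> carries no
      information, which forces the case distinction in the statement.\<close>
    then have "S (Suc a) (Suc b) = {}" by (auto simp: S_def)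
    then have "Max (S a b) = model_number E A a + model_number E B b" by (simp add: ins)
    then show ?thesis using False by (simp only: J if_False)
  qed
qed

lemma le_join_number:
  assumes "a + j \<le> card A" "b + j \<le> card B"
  shows "model_number E A (a + j) + model_number E B (b + j) + j \<le> join_number E A B a b"
proof -
  have "{model_number E A (a + j) + model_number E B (b + j) + j |j. a + j \<le> card A \<and> b + j \<le> card B}
    \<subseteq> (\<lambda>j. model_number E A (a + j) + model_number E B (b + j) + j) ` {..card A}" by auto
  then have "finite {model_number E A (a + j) + model_number E B (b + j) + j |j. a + j \<le> card A \<and> b + j \<le> card B}"
    by (meson finite_atMost finite_imageI finite_subset)
  then show ?thesis unfolding join_number_def using assms by (intro Max_ge CollectI exI[of _ j]) simp_all
qed

lemma join_numberE:
  assumes "a \<le> card A" "b \<le> card B"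
  obtains j where "a + j \<le> card A" "b + j \<le> card B"
    "join_number E A B a b = model_number E A (a + j) + model_number E B (b + j) + j"
proof -
  let ?S = "{model_number E A (a + j) + model_number E B (b + j) + j |j. a + j \<le> card A \<and> b + j \<le> card B}"
  have "?S \<subseteq> (\<lambda>j. model_number E A (a + j) + model_number E B (b + j) + j) ` {..card A}" by auto
  then have "finite ?S" by (meson finite_atMost finite_imageI finite_subset)
  moreover have "?S \<noteq> {}" using assms by (auto intro!: exI[of _ 0])
  ultimately have "Max ?S \<in> ?S" by (rule Max_in)
  then show ?thesis using that by (auto simp: join_number_def)
qed

lemma conn_pair: "E x y \<Longrightarrow> E y x \<Longrightarrow> conn E {x, y}"
proof -
  assume E: "E x y" "E y x"
  have "\<exists>a\<in>X. \<exists>b\<in>{x, y} - X. E a b" if "X \<subset> {x, y}" "X \<noteq> {}" for X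
  proof -
    have "X = {x} \<and> x \<noteq> y \<or> X = {y} \<and> x \<noteq> y" using that by blast
    then show ?thesis using E by auto
  qed
  then show ?thesis by (simp add: conn_def)
qed

text \<open>Take optimal models that leave \<open>a + j\<close> and \<open>b + j\<close> vertices
  free, and match \<open>j\<close> free vertices of \<open>A\<close> with \<open>j\<close> free
  vertices of \<open>B\<close>. Each matched pair is an edge that touches every nonempty subset of
  the union, and \<open>a + b\<close> vertices stay free.\<close>

lemma join_number_le_model_number:
  assumes fin: "finite A" "finite B" and disj: "A \<inter> B = {}"
    and E: "\<And>x y. x \<in> A \<Longrightarrow> y \<in> B \<Longrightarrow> E x y \<and> E y x"
    and ab: "a \<le> card A" "b \<le> card B"
  shows "join_number E A B a b \<le> model_number E (A \<union> B) (a + b)"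
proof -
  obtain j where j: "a + j \<le> card A" "b + j \<le> card B"
    "join_number E A B a b = model_number E A (a + j) + model_number E B (b + j) + j"
    using join_numberE[OF ab] .
  obtain MA where MA: "clique_model E A MA" "card (\<Union>MA) + (a + j) \<le> card A"
    "card MA = model_number E A (a + j)" using model_numberE[OF fin(1) j(1)] .
  obtain MB where MB: "clique_model E B MB" "card (\<Union>MB) + (b + j) \<le> card B"
    "card MB = model_number E B (b + j)" using model_numberE[OF fin(2) j(2)] .
  have sub: "\<Union>MA \<subseteq> A" "\<Union>MB \<subseteq> B" using MA MB by (auto simp: clique_model_def)
  have "j \<le> card (A - \<Union>MA)" "j \<le> card (B - \<Union>MB)"
    using MA(2) MB(2) sub fin by (auto simp: card_Diff_subset finite_subset)
  then obtain X Y where X: "X \<subseteq> A - \<Union>MA" "card X = j" and Y: "Y \<subseteq> B - \<Union>MB" "card Y = j"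
    by (meson obtain_subset_with_card_n)
  have finXY: "finite X" "finite Y" using X Y fin by (auto intro: finite_subset)
  obtain f where f: "bij_betw f X Y" using finite_same_card_bij[OF finXY] X Y by auto
  define P where "P = (\<lambda>x. {x, f x}) ` X"
  have fX: "f x \<in> Y" if "x \<in> X" for x using f that by (auto simp: bij_betw_def)
  have UP: "\<Union>P = X \<union> Y" using f by (auto simp: P_def bij_betw_def)
  have AB: "\<exists>x\<in>A. \<exists>y\<in>B. S = {x, y}" if "S \<in> P" for S
    using that X Y fX unfolding P_def by blast
  have cP: "card P = j"
  proof -
    have "inj_on (\<lambda>x. {x, f x}) X"
    proof (rule inj_onI)
      fix x y assume xy: "x \<in> X" "y \<in> X" "{x, f x} = {y, f y}"
      then have "f x \<noteq> y" using X(1) Y(1) fX[OF xy(1)] disj by blast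
      then show "x = y" using xy(3) by (auto simp: doubleton_eq_iff)
    qed
    then show ?thesis using X by (simp add: P_def card_image)
  qed
  have PM: "S \<inter> T = {}" if "S \<in> P" "T \<in> MA \<union> MB" for S T
  proof -
    have "S \<subseteq> X \<union> Y" using UP that by blast
    then show ?thesis using that X Y sub disj by blast
  qed
  have PP: "S \<inter> T = {}" if ST: "S \<in> P" "T \<in> P" "S \<noteq> T" for S T
  proof -
    obtain x y where xy: "S = {x, f x}" "T = {y, f y}" "x \<in> X" "y \<in> X"
      using ST(1,2) by (auto simp: P_def)
    then have "x \<noteq> y" using ST(3) by blast
    then have "f x \<noteq> f y" using f xy by (auto simp: bij_betw_def inj_on_def)
    then show ?thesis using xy \<open>x \<noteq> y\<close> fX[OF xy(3)] fX[OF xy(4)] X Y disj by blast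
  qed
  let ?M = "MA \<union> MB \<union> P"
  have neA: "S \<noteq> {} \<and> S \<subseteq> A" if "S \<in> MA" for S
    using clique_model_nonempty[OF MA(1) that] sub that by blast
  have neB: "S \<noteq> {} \<and> S \<subseteq> B" if "S \<in> MB" for S
    using clique_model_nonempty[OF MB(1) that] sub that by blast
  have touchP: "touch E S T \<and> touch E T S" if ST: "S \<in> P" "T \<in> ?M" for S T
  proof -
    obtain x y where xy: "x \<in> A" "y \<in> B" "S = {x, y}" using AB[OF ST(1)] by blast
    have "T \<noteq> {} \<and> T \<subseteq> A \<union> B" using ST(2) neA[of T] neB[of T] AB[of T] by blast
    then obtain z where "z \<in> T" "z \<in> A \<union> B" by blast
    then show ?thesis using E xy unfolding touch_def by blast
  qed
  have touchAB: "touch E S T \<and> touch E T S" if "S \<in> MA" "T \<in> MB" for S T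
    using neA[OF that(1)] neB[OF that(2)] E unfolding touch_def by blast
  have disjAB: "S \<inter> T = {}" if "S \<in> MA" "T \<in> MB" for S T
    using neA[OF that(1)] neB[OF that(2)] disj by blast
  have conn: "conn E S" if "S \<in> ?M" for S
  proof -
    consider "S \<in> MA" | "S \<in> MB" | "S \<in> P" using \<open>S \<in> ?M\<close> by blast
    then show ?thesis
    proof cases
      case 3
      then show ?thesis using AB E conn_pair by metis
    qed (use MA MB in \<open>auto simp: clique_model_def\<close>)
  qed
  have pair: "S \<inter> T = {} \<and> touch E S T" if ST: "S \<in> ?M" "T \<in> ?M" "S \<noteq> T" for S T
  proof -
    consider "S \<in> P" | "T \<in> P" "S \<notin> P" | "S \<in> MA" "T \<in> MA" | "S \<in> MB" "T \<in> MB"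
      | "S \<in> MA" "T \<in> MB" | "S \<in> MB" "T \<in> MA" using ST by blast
    then show ?thesis
    proof cases
      case 1
      then show ?thesis using touchP[OF 1 ST(2)] PM[OF 1, of T] PP[OF 1, of T] ST by blast
    next
      case 2
      then show ?thesis using touchP[OF 2(1) ST(1)] PM[OF 2(1), of S] ST by blast
    next
      case 3
      then show ?thesis using MA(1) ST(3) by (simp add: clique_model_def)
    next
      case 4
      then show ?thesis using MB(1) ST(3) by (simp add: clique_model_def)
    next
      case 5
      then show ?thesis using touchAB disjAB by blast
    next
      case 6
      then show ?thesis using touchAB[of T S] disjAB[of T S] by blast
    qed
  qed
  have UM: "\<Union>?M = \<Union>MA \<union> \<Union>MB \<union> (X \<union> Y)" using UP by blast
  have "\<Union>?M \<subseteq> A \<union> B" using UM sub X Y by blast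
  then have "clique_model E (A \<union> B) ?M" using conn pair by (simp add: clique_model_def)
  moreover have "card (\<Union>?M) + (a + b) \<le> card (A \<union> B)"
  proof -
    have "card (\<Union>?M) \<le> card (\<Union>MA) + card (\<Union>MB) + (card X + card Y)"
      unfolding UM by (meson add_le_mono card_Un_le le_trans)
    then show ?thesis using MA(2) MB(2) X(2) Y(2) fin disj by (simp add: card_Un_disjoint)
  qed
  ultimately have "card ?M \<le> model_number E (A \<union> B) (a + b)"
    using fin by (intro card_le_model_number) auto
  moreover have "card ?M = card MA + card MB + card P"
  proof -
    \<comment> \<open>Disjointness alone would let the empty set belong to two families; since
      branch sets are nonempty, the three families have no common member and their cardinalities
      add.\<close>
    have "S \<notin> MB" if "S \<in> MA" for S
      using disjAB[OF that, of S] neA[OF that] by (metis Int_absorb)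
    then have "MA \<inter> MB = {}" by (auto simp: disjoint_iff)
    moreover have "(MA \<union> MB) \<inter> P = {}"
    proof -
      have "S \<noteq> {}" if "S \<in> P" for S using AB[OF that] by blast
      then show ?thesis using PM by (metis Int_absorb disjoint_iff)
    qed
    moreover have "finite MA" "finite MB" "finite P"
      using finite_clique_model fin MA(1) MB(1) finXY by (auto simp: P_def)
    ultimately show ?thesis by (simp add: card_Un_disjoint)
  qed
  ultimately show ?thesis using j(3) MA(3) MB(3) cP by simp
qed

text \<open>Each branch set that meets both sides owns a vertex on either side. When these sets are
  dropped, the models left on \<open>A\<close> and \<open>B\<close> gain \<open>card X\<close> free
  vertices each, and this number takes the place of \<open>j\<close>.\<close>

lemma model_number_join_le:
  assumes fin: "finite A" "finite B" and disj: "A \<inter> B = {}"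
    and c: "c \<le> card A + card B"
  shows "\<exists>a\<le>card A. \<exists>b\<le>card B. a + b = c \<and> model_number E (A \<union> B) c \<le> join_number E A B a b"
proof -
  have cU: "card (A \<union> B) = card A + card B" using fin disj by (simp add: card_Un_disjoint)
  obtain M where M: "clique_model E (A \<union> B) M" "card (\<Union>M) + c \<le> card A + card B"
    "card M = model_number E (A \<union> B) c"
    using model_numberE[of "A \<union> B" c E] fin c cU by (metis finite_Un)
  have finM: "finite M" using finite_clique_model M(1) fin by blast
  have UM: "\<Union>M \<subseteq> A \<union> B" using M by (simp add: clique_model_def)
  define X where "X = {S \<in> M. \<not> S \<subseteq> A \<and> \<not> S \<subseteq> B}"
  \<comment> \<open>One vertex of \<open>C\<close> is chosen from every mixed branch set; these
    vertices are distinct and avoid all branch sets inside \<open>C\<close>.\<close>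
  have bound: "card (\<Union>{S \<in> M. S \<subseteq> C}) + card X \<le> card (\<Union>M \<inter> C)"
    if C: "finite C" "\<And>S. S \<in> X \<Longrightarrow> S \<inter> C \<noteq> {} \<and> \<not> S \<subseteq> C" for C
  proof -
    define s where "s = (\<lambda>S. SOME x. x \<in> S \<inter> C)"
    have s: "s S \<in> S \<inter> C" if "S \<in> X" for S
      unfolding s_def using C(2)[OF that] by (meson all_not_in_conv someI_ex)
    have inj: "inj_on s X"
    proof (rule inj_onI)
      fix S T assume ST: "S \<in> X" "T \<in> X" "s S = s T"
      then have "s S \<in> S" "s S \<in> T" using s[OF ST(1)] s[OF ST(2)] by auto
      then show "S = T" using clique_model_disjoint[OF M(1)] ST unfolding X_def by blast
    qed
    have "\<Union>{S \<in> M. S \<subseteq> C} \<inter> s ` X = {}"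
    proof -
      have False if "T \<in> M" "T \<subseteq> C" "S \<in> X" "s S \<in> T" for S T
        using clique_model_disjoint[OF M(1), of S T "s S"] that s[OF that(3)] C(2)[OF that(3)]
        by (auto simp: X_def)
      then show ?thesis by blast
    qed
    moreover have "finite (\<Union>{S \<in> M. S \<subseteq> C})" by (rule finite_subset[OF _ C(1)]) blast
    moreover have "finite (s ` X)" using finM by (simp add: X_def)
    ultimately have "card (\<Union>{S \<in> M. S \<subseteq> C} \<union> s ` X) = card (\<Union>{S \<in> M. S \<subseteq> C}) + card X"
      using inj by (simp add: card_Un_disjoint card_image)
    moreover have "card (\<Union>{S \<in> M. S \<subseteq> C} \<union> s ` X) \<le> card (\<Union>M \<inter> C)"
      by (rule card_mono) (use C(1) s in \<open>auto simp: X_def\<close>)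
    ultimately show ?thesis by simp
  qed
  have XC: "S \<inter> A \<noteq> {} \<and> S \<inter> B \<noteq> {}" if "S \<in> X" for S
    using that UM unfolding X_def by blast
  define MA where "MA = {S \<in> M. S \<subseteq> A}"
  define MB where "MB = {S \<in> M. S \<subseteq> B}"
  have bA: "card (\<Union>MA) + card X \<le> card (\<Union>M \<inter> A)"
    unfolding MA_def by (rule bound) (use fin XC in \<open>auto simp: X_def\<close>)
  have bB: "card (\<Union>MB) + card X \<le> card (\<Union>M \<inter> B)"
    unfolding MB_def by (rule bound) (use fin XC in \<open>auto simp: X_def\<close>)
  have "card (\<Union>M) = card ((\<Union>M \<inter> A) \<union> (\<Union>M \<inter> B))"
    using UM by (intro arg_cong[where f = card]) blast
  also have "\<dots> = card (\<Union>M \<inter> A) + card (\<Union>M \<inter> B)"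
    by (rule card_Un_disjoint) (use fin disj in auto)
  finally have sum: "card (\<Union>M \<inter> A) + card (\<Union>M \<inter> B) + c \<le> card A + card B" using M(2) by simp
  have le: "card (\<Union>M \<inter> A) \<le> card A" "card (\<Union>M \<inter> B) \<le> card B" using fin by (auto intro: card_mono)
  \<comment> \<open>The reserve is placed greedily: \<open>A\<close> takes what it has free, and
    \<open>sum\<close> guarantees that the remainder fits into \<open>B\<close>.\<close>
  define a where "a = min c (card A - card (\<Union>M \<inter> A))"
  define b where "b = c - a"
  have ab: "a + b = c" "a + card (\<Union>M \<inter> A) \<le> card A" "b + card (\<Union>M \<inter> B) \<le> card B"
    using sum le by (auto simp: a_def b_def min_def)
  have "card MA \<le> model_number E A (a + card X)"
    by (rule card_le_model_number[OF fin(1) clique_model_subset[OF M(1)]])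
      (use bA ab in \<open>auto simp: MA_def\<close>)
  moreover have "card MB \<le> model_number E B (b + card X)"
    by (rule card_le_model_number[OF fin(2) clique_model_subset[OF M(1)]])
      (use bB ab in \<open>auto simp: MB_def\<close>)
  moreover have "card M \<le> card MA + card MB + card X"
  proof -
    have "M = MA \<union> MB \<union> X" by (auto simp: MA_def MB_def X_def)
    then show ?thesis using card_Un_le[of "MA \<union> MB" X] card_Un_le[of MA MB] by simp
  qed
  moreover have "model_number E A (a + card X) + model_number E B (b + card X) + card X
      \<le> join_number E A B a b"
    by (rule le_join_number) (use ab bA bB in auto)
  ultimately have "model_number E (A \<union> B) c \<le> join_number E A B a b" using M(3) by simp
  then show ?thesis using ab by (intro exI[of _ a] exI[of _ b] conjI) auto
qed

section \<open>Twins in cographs\<close>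

text \<open>Stated for a relation so that it also applies to the complement. Only distinct vertices
  are compared, so it does no harm that the complement of an irreflexive relation holds on the
  diagonal.\<close>

definition P4_free :: "('a \<Rightarrow> 'a \<Rightarrow> bool) \<Rightarrow> 'a set \<Rightarrow> bool" where
  "P4_free E U \<longleftrightarrow> \<not> (\<exists>a\<in>U. \<exists>b\<in>U. \<exists>c\<in>U. \<exists>d\<in>U. distinct [a, b, c, d] \<and>
     E a b \<and> E b c \<and> E c d \<and> \<not> E a c \<and> \<not> E b d \<and> \<not> E a d)"

lemma P4_free_subset: "P4_free E U \<Longrightarrow> V \<subseteq> U \<Longrightarrow> P4_free E V"
  unfolding P4_free_def by blast

lemma P4_freeD:
  "P4_free E U \<Longrightarrow> a \<in> U \<Longrightarrow> b \<in> U \<Longrightarrow> c \<in> U \<Longrightarrow> d \<in> U \<Longrightarrow> distinct [a, b, c, d] \<Longrightarrow>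
    E a b \<Longrightarrow> E b c \<Longrightarrow> E c d \<Longrightarrow> \<not> E a c \<Longrightarrow> \<not> E b d \<Longrightarrow> \<not> E a d \<Longrightarrow> False"
  unfolding P4_free_def by blast

text \<open>The path on four vertices is self-complementary: if \<open>a, b, c, d\<close> is an
  induced path in the complement, then \<open>b, d, a, c\<close> is one in the original
  relation.\<close>

lemma P4_free_complement:
  assumes "symp E" "P4_free E U"
  shows "P4_free (\<lambda>x y. \<not> E x y) U"
  unfolding P4_free_def
proof (intro notI, elim bexE conjE)
  fix a b c d
  assume "a \<in> U" "b \<in> U" "c \<in> U" "d \<in> U" "distinct [a, b, c, d]" "\<not> E a b" "\<not> E b c"
    "\<not> E c d" "\<not> \<not> E a c" "\<not> \<not> E b d" "\<not> \<not> E a d"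
  then show False
    using P4_freeD[OF assms(2), of b d a c] assms(1) by (auto dest: sympD)
qed

text \<open>The new vertex \<open>v\<close> either sees everything and splits off alone, or misses
  some vertex on one side, say in \<open>A\<close>. If it has no neighbour in \<open>B\<close>, it
  joins \<open>A\<close>. Otherwise its non-neighbours in \<open>A\<close> are cut off from all the
  rest.\<close>

lemma homogeneous_split_insert:
  assumes sym: "symp E" and P4: "P4_free E (insert v (A \<union> B))" and v: "v \<notin> A \<union> B"
    and ne: "A \<noteq> {}" "B \<noteq> {}" "A \<inter> B = {}" and no: "\<forall>x\<in>A. \<forall>y\<in>B. \<not> E x y"
  shows "\<exists>A' B'. A' \<noteq> {} \<and> B' \<noteq> {} \<and> A' \<inter> B' = {} \<and> A' \<union> B' = insert v (A \<union> B) \<and>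
    ((\<forall>x\<in>A'. \<forall>y\<in>B'. E x y) \<or> (\<forall>x\<in>A'. \<forall>y\<in>B'. \<not> E x y))"
proof -
  have main: "\<exists>A' B'. A' \<noteq> {} \<and> B' \<noteq> {} \<and> A' \<inter> B' = {} \<and> A' \<union> B' = insert v (A \<union> B) \<and>
      (\<forall>x\<in>A'. \<forall>y\<in>B'. \<not> E x y)"
    if AB: "A \<inter> B = {}" "\<forall>x\<in>A. \<forall>y\<in>B. \<not> E x y" "B \<noteq> {}"
      and v: "v \<notin> A \<union> B" and y0: "y0 \<in> A" "\<not> E v y0" and P4: "P4_free E (insert v (A \<union> B))" for A B y0
  proof -
    define Y where "Y = {y \<in> A. \<not> E v y}"
    show ?thesis
    proof (cases "\<exists>w\<in>B. E v w")
      case False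
      then show ?thesis
        using AB v y0 sym by (intro exI[of _ "insert v A"] exI[of _ B]) (auto dest: sympD)
    next
      case True
      then obtain w where w: "w \<in> B" "E v w" by blast
      \<comment> \<open>An edge from a non-neighbour \<open>y\<close> to a neighbour
        \<open>x\<close> of \<open>v\<close> in \<open>A\<close> would continue through
        \<open>v\<close> to \<open>w\<close> in \<open>B\<close>, giving the induced path
        \<open>y, x, v, w\<close>.\<close>
      have "\<not> E y x" if "y \<in> Y" "x \<in> A - Y" for x y
      proof
        assume "E y x"
        have vx: "E x v" using that sym by (auto simp: Y_def dest: sympD)
        have "\<not> E y v" "\<not> E y w" "\<not> E x w" using that AB w sym by (auto simp: Y_def dest: sympD)
        moreover have "distinct [y, x, v, w]" using that AB w v by (auto simp: Y_def)
        ultimately show False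
          using P4_freeD[OF P4, of y x v w] \<open>E y x\<close> vx w that by (auto simp: Y_def)
      qed
      moreover have "\<not> E y v" if "y \<in> Y" for y using that sym by (auto simp: Y_def dest: sympD)
      moreover have "\<not> E y z" if "y \<in> Y" "z \<in> B" for y z using that AB by (auto simp: Y_def)
      ultimately have "\<forall>y\<in>Y. \<forall>z\<in>insert v ((A - Y) \<union> B). \<not> E y z" by blast
      moreover have "Y \<noteq> {}" "Y \<inter> insert v ((A - Y) \<union> B) = {}"
        "Y \<union> insert v ((A - Y) \<union> B) = insert v (A \<union> B)"
        using y0 AB(1) v by (auto simp: Y_def)
      ultimately show ?thesis
        by (intro exI[of _ Y] exI[of _ "insert v ((A - Y) \<union> B)"]) simp
    qed
  qed
  show ?thesis
  proof (cases "\<forall>x\<in>A \<union> B. E v x")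
    case True
    then show ?thesis using ne v by (intro exI[of _ "{v}"] exI[of _ "A \<union> B"]) auto
  next
    case False
    then consider y where "y \<in> A" "\<not> E v y" | y where "y \<in> B" "\<not> E v y" by blast
    then show ?thesis
    proof cases
      case 1
      from main[OF ne(3) no ne(2) v 1 P4] show ?thesis by blast
    next
      case 2
      have "B \<inter> A = {}" "\<forall>x\<in>B. \<forall>y\<in>A. \<not> E x y" using ne no sym by (auto dest: sympD)
      from main[OF this ne(1) _ 2] v P4 show ?thesis by (simp add: Un_commute) blast
    qed
  qed
qed

text \<open>Seinsche's theorem: a \<open>P_4\<close>-free graph on at least two vertices is
  disconnected or has a disconnected complement. Vertices are added one at a time, and a split with
  all edges present is treated as a split without edges in the complement.\<close>

lemma homogeneous_split:
  assumes "finite U" "symp E" "P4_free E U" "2 \<le> card U"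
  shows "\<exists>A B. A \<noteq> {} \<and> B \<noteq> {} \<and> A \<inter> B = {} \<and> A \<union> B = U \<and>
    ((\<forall>x\<in>A. \<forall>y\<in>B. E x y) \<or> (\<forall>x\<in>A. \<forall>y\<in>B. \<not> E x y))"
  using assms
proof (induction U rule: finite_induct)
  case empty
  then show ?case by simp
next
  case (insert v U)
  show ?case
  proof (cases "2 \<le> card U")
    case False
    then have "card U = 1" using insert by simp
    then obtain u where "U = {u}" by (auto simp: card_1_singleton_iff)
    then show ?thesis using insert.hyps by (intro exI[of _ "{v}"] exI[of _ "{u}"]) auto
  next
    case True
    have "P4_free E U" using P4_free_subset insert.prems(2) by blast
    then obtain A B where AB: "A \<noteq> {}" "B \<noteq> {}" "A \<inter> B = {}" "A \<union> B = U"
      "(\<forall>x\<in>A. \<forall>y\<in>B. E x y) \<or> (\<forall>x\<in>A. \<forall>y\<in>B. \<not> E x y)"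
      using insert.IH insert.prems True by auto
    from AB(5) show ?thesis
    proof
      assume "\<forall>x\<in>A. \<forall>y\<in>B. \<not> E x y"
      then show ?thesis
        using homogeneous_split_insert[of E v A B] AB insert by auto
    next
      assume all: "\<forall>x\<in>A. \<forall>y\<in>B. E x y"
      have "symp (\<lambda>x y. \<not> E x y)" using insert.prems(1) by (auto simp: symp_def)
      then have "\<exists>A' B'. A' \<noteq> {} \<and> B' \<noteq> {} \<and> A' \<inter> B' = {} \<and> A' \<union> B' = insert v (A \<union> B) \<and>
        ((\<forall>x\<in>A'. \<forall>y\<in>B'. \<not> E x y) \<or> (\<forall>x\<in>A'. \<forall>y\<in>B'. \<not> \<not> E x y))"
        using homogeneous_split_insert[of "\<lambda>x y. \<not> E x y" v A B] AB insert all
          P4_free_complement[OF insert.prems(1,2)] by auto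
      then show ?thesis unfolding AB(4) not_not by blast
    qed
  qed
qed

text \<open>A side with at least two vertices has twins by induction, and they stay twins in
  \<open>U\<close> because every vertex of the other side is adjacent to all or to none of the
  first. If both sides are singletons, no third vertex is left to tell the two apart.\<close>

lemma twins_exist:
  assumes "finite U" "symp E" "P4_free E U" "2 \<le> card U"
  shows "\<exists>u\<in>U. \<exists>v\<in>U. u \<noteq> v \<and> (\<forall>w\<in>U - {u, v}. E u w \<longleftrightarrow> E v w)"
  using assms
proof (induction "card U" arbitrary: U rule: less_induct)
  case less
  obtain A B where AB: "A \<noteq> {}" "B \<noteq> {}" "A \<inter> B = {}" "A \<union> B = U"
    "(\<forall>x\<in>A. \<forall>y\<in>B. E x y) \<or> (\<forall>x\<in>A. \<forall>y\<in>B. \<not> E x y)"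
    using homogeneous_split[OF less.prems] by blast
  have twins: "\<exists>u\<in>U. \<exists>v\<in>U. u \<noteq> v \<and> (\<forall>w\<in>U - {u, v}. E u w \<longleftrightarrow> E v w)"
    if C: "C \<union> D = U" "C \<inter> D = {}" "D \<noteq> {}" "2 \<le> card C"
      "(\<forall>x\<in>C. \<forall>y\<in>D. E x y) \<or> (\<forall>x\<in>C. \<forall>y\<in>D. \<not> E x y)" for C D
  proof -
    have "C \<subset> U" using C by blast
    then have "card C < card U" "finite C" "P4_free E C"
      using less.prems(1) P4_free_subset[OF less.prems(3)] finite_subset
      by (auto simp: psubset_card_mono)
    then obtain u v where uv: "u \<in> C" "v \<in> C" "u \<noteq> v" "\<forall>w\<in>C - {u, v}. E u w \<longleftrightarrow> E v w"
      using less.hyps[of C] less.prems(2) C(4) by blast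
    have "E u w \<longleftrightarrow> E v w" if "w \<in> U - {u, v}" for w
      using that uv C by (cases "w \<in> C") auto
    then show ?thesis using uv C(1) by blast
  qed
  have finAB: "finite A" "finite B" using less.prems(1) AB by auto
  show ?case
  proof (cases "2 \<le> card A \<or> 2 \<le> card B")
    case True
    have "(\<forall>x\<in>B. \<forall>y\<in>A. E x y) \<or> (\<forall>x\<in>B. \<forall>y\<in>A. \<not> E x y)"
      using AB(5) less.prems(2) by (auto dest: sympD)
    moreover have "B \<union> A = U" "B \<inter> A = {}" using AB by auto
    ultimately show ?thesis using True twins[OF AB(4,3,2) _ AB(5)] twins[of B A] AB(1) by argo
  next
    case False
    have "card A \<noteq> 0" "card B \<noteq> 0" using AB finAB by auto
    then have "card A = 1" "card B = 1" using False by auto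
    then obtain a b where "A = {a}" "B = {b}" by (auto simp: card_1_singleton_iff)
    then have "U = {a, b}" "a \<noteq> b" using AB by auto
    then show ?thesis by blast
  qed
qed

lemma symp_adj: "symp (adj G)"
  by (simp add: symp_def adj_commute)

lemma cograph_P4_free:
  assumes "cograph G"
  shows "P4_free (adj G) (verts G)"
proof -
  have simple: "simple_graph G" using assms by (simp add: cograph_def)
  have False if V: "a \<in> verts G" "b \<in> verts G" "c \<in> verts G" "d \<in> verts G"
    and dist: "distinct [a, b, c, d]" and e: "adj G a b" "adj G b c" "adj G c d"
    and ne: "\<not> adj G a c" "\<not> adj G b d" "\<not> adj G a d" for a b c d
  proof -
    let ?U = "{a, b, c, d}"
    define f where "f = (\<lambda>i::nat. if i = 0 then a else if i = 1 then b else if i = 2 then c else d)"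
    have four: "{..<4::nat} = {0, 1, 2, 3}" by auto
    have "bij_betw f {..<4} ?U"
      unfolding bij_betw_def four using dist by (auto simp: f_def inj_on_def)
    moreover have "edges (induced_subgraph G ?U) = (`) f ` edges (path_graph 4)"
    proof -
      have "edges (path_graph 4) = {{0, 1}, {1, 2}, {2, 3}}"
      proof -
        have "{i. Suc i < 4} = {0, 1, 2}" by auto
        moreover have "edges (path_graph 4) = (\<lambda>i. {i, Suc i}) ` {i. Suc i < 4}"
          unfolding path_graph_def by force
        ultimately show ?thesis by (simp add: numeral_2_eq_2 numeral_3_eq_3)
      qed
      then have "(`) f ` edges (path_graph 4) = {{a, b}, {b, c}, {c, d}}"
        by (simp add: f_def insert_commute)
      moreover have "{e \<in> edges G. e \<subseteq> ?U} = {{a, b}, {b, c}, {c, d}}"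
      proof (intro equalityI subsetI)
        fix s assume s: "s \<in> {e \<in> edges G. e \<subseteq> ?U}"
        then have "s \<in> edges G" by simp
        then obtain x y where xy: "s = {x, y}" "x \<noteq> y" by (rule simple_graph_edgeE[OF simple])
        have "adj G x y" using s xy(1) by (simp add: adj_def)
        have "x \<in> ?U" "y \<in> ?U" using s xy(1) by simp_all
        show "s \<in> {{a, b}, {b, c}, {c, d}}"
        proof -
          have ne': "\<not> adj G c a" "\<not> adj G d b" "\<not> adj G d a"
            using ne by (simp_all add: adj_commute)
          have "x = a \<and> y = b \<or> x = b \<and> y = a \<or> x = b \<and> y = c \<or> x = c \<and> y = b \<or>
            x = c \<and> y = d \<or> x = d \<and> y = c"
            using \<open>adj G x y\<close> \<open>x \<in> ?U\<close> \<open>y \<in> ?U\<close> \<open>x \<noteq> y\<close> ne ne'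
            unfolding insert_iff empty_iff by metis
          then show ?thesis using xy(1) by (auto simp: insert_commute)
        qed
      qed (use e in \<open>auto simp: adj_def\<close>)
      ultimately show ?thesis by (simp add: induced_subgraph_def)
    qed
    ultimately have "graph_iso (path_graph 4) (induced_subgraph G ?U)"
      unfolding graph_iso_def by (intro exI[of _ f]) (simp add: path_graph_def induced_subgraph_def)
    moreover have "?U \<subseteq> verts G" using V by simp
    ultimately show False using assms unfolding cograph_def by blast
  qed
  then show ?thesis unfolding P4_free_def by blast
qed

section \<open>A loop language on top of the random access machine\<close>

text \<open>A family of two-dimensional arrays, addressed by array number, row and column. Vectors
  occupy column 0, and scalars the single entry \<open>(0, 0)\<close>.\<close>

type_synonym store = "nat \<Rightarrow> nat \<Rightarrow> nat \<Rightarrow> int"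

datatype aexp =
  Num int | Size | Edge aexp aexp | Arr nat aexp aexp | Plus aexp aexp | Minus aexp aexp

datatype bexp =
  Lt aexp aexp | Eq aexp aexp | Not bexp | And bexp bexp

text \<open>The only loop is \<open>For\<close>, whose number of iterations \<open>n + c\<close> is
  fixed in advance, so that the running time can be bounded from the syntax. Multiplication is left
  to the compiler, which needs it for addresses.\<close>

datatype com =
  Nop | Set nat aexp aexp aexp | Then com com (infixr ";;" 60) | If bexp com com | For nat nat com

definition upd :: "store \<Rightarrow> nat \<Rightarrow> nat \<Rightarrow> nat \<Rightarrow> int \<Rightarrow> store" where
  "upd \<sigma> r i j v = \<sigma>(r := (\<sigma> r)(i := (\<sigma> r i)(j := v)))"

primrec aval :: "nat \<Rightarrow> (nat \<Rightarrow> nat \<Rightarrow> bool) \<Rightarrow> store \<Rightarrow> aexp \<Rightarrow> int" where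
  "aval n E \<sigma> (Num c) = c"
| "aval n E \<sigma> Size = int n"
| "aval n E \<sigma> (Edge e f) = of_bool (E (nat (aval n E \<sigma> e)) (nat (aval n E \<sigma> f)))"
| "aval n E \<sigma> (Arr r e f) = \<sigma> r (nat (aval n E \<sigma> e)) (nat (aval n E \<sigma> f))"
| "aval n E \<sigma> (Plus e f) = aval n E \<sigma> e + aval n E \<sigma> f"
| "aval n E \<sigma> (Minus e f) = aval n E \<sigma> e - aval n E \<sigma> f"

text \<open>Matrix indices stay below \<open>n\<close>, while arrays have two spare rows and
  columns: index \<open>n\<close> occurs because sizes and reserves range up to \<open>n\<close>,
  and index \<open>n + 1\<close> leaves room for the sentinel behind the last entry of
  \<open>row\<close>.\<close>

primrec aok :: "nat \<Rightarrow> (nat \<Rightarrow> nat \<Rightarrow> bool) \<Rightarrow> store \<Rightarrow> aexp \<Rightarrow> bool" where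
  "aok n E \<sigma> (Num c) \<longleftrightarrow> \<bar>c\<bar> \<le> 32"
| "aok n E \<sigma> Size \<longleftrightarrow> True"
| "aok n E \<sigma> (Edge e f) \<longleftrightarrow> aok n E \<sigma> e \<and> aok n E \<sigma> f \<and>
     0 \<le> aval n E \<sigma> e \<and> aval n E \<sigma> e < int n \<and> 0 \<le> aval n E \<sigma> f \<and> aval n E \<sigma> f < int n"
| "aok n E \<sigma> (Arr r e f) \<longleftrightarrow> 1 \<le> r \<and> r \<le> 32 \<and> aok n E \<sigma> e \<and> aok n E \<sigma> f \<and>
     0 \<le> aval n E \<sigma> e \<and> aval n E \<sigma> e < int n + 2 \<and> 0 \<le> aval n E \<sigma> f \<and> aval n E \<sigma> f < int n + 2"
| "aok n E \<sigma> (Plus e f) \<longleftrightarrow> aok n E \<sigma> e \<and> aok n E \<sigma> f"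
| "aok n E \<sigma> (Minus e f) \<longleftrightarrow> aok n E \<sigma> e \<and> aok n E \<sigma> f"

primrec bval :: "nat \<Rightarrow> (nat \<Rightarrow> nat \<Rightarrow> bool) \<Rightarrow> store \<Rightarrow> bexp \<Rightarrow> bool" where
  "bval n E \<sigma> (Lt e f) \<longleftrightarrow> aval n E \<sigma> e < aval n E \<sigma> f"
| "bval n E \<sigma> (Eq e f) \<longleftrightarrow> aval n E \<sigma> e = aval n E \<sigma> f"
| "bval n E \<sigma> (Not b) \<longleftrightarrow> \<not> bval n E \<sigma> b"
| "bval n E \<sigma> (And b c) \<longleftrightarrow> bval n E \<sigma> b \<and> bval n E \<sigma> c"

primrec bok :: "nat \<Rightarrow> (nat \<Rightarrow> nat \<Rightarrow> bool) \<Rightarrow> store \<Rightarrow> bexp \<Rightarrow> bool" where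
  "bok n E \<sigma> (Lt e f) \<longleftrightarrow> aok n E \<sigma> e \<and> aok n E \<sigma> f"
| "bok n E \<sigma> (Eq e f) \<longleftrightarrow> aok n E \<sigma> e \<and> aok n E \<sigma> f"
| "bok n E \<sigma> (Not b) \<longleftrightarrow> bok n E \<sigma> b"
| "bok n E \<sigma> (And b c) \<longleftrightarrow> bok n E \<sigma> b \<and> bok n E \<sigma> c"

primrec written :: "com \<Rightarrow> nat set" where
  "written Nop = {}"
| "written (Set r e f a) = {r}"
| "written (p ;; q) = written p \<union> written q"
| "written (If b p q) = written p \<union> written q"
| "written (For k c p) = insert k (written p)"

text \<open>
  Assigned values are confined to \<open>[-1, n + 2]\<close>: together with the constant size of the expressions
  this keeps all intermediate results below a fixed power of the input size.
\<close>

primrec wp :: "nat \<Rightarrow> (nat \<Rightarrow> nat \<Rightarrow> bool) \<Rightarrow> com \<Rightarrow> (store \<Rightarrow> bool) \<Rightarrow> store \<Rightarrow> bool" where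
  "wp n E Nop Q \<sigma> \<longleftrightarrow> Q \<sigma>"
| "wp n E (Set r e f a) Q \<sigma> \<longleftrightarrow> aok n E \<sigma> (Arr r e f) \<and> aok n E \<sigma> a \<and>
     -1 \<le> aval n E \<sigma> a \<and> aval n E \<sigma> a \<le> int n + 2 \<and>
     Q (upd \<sigma> r (nat (aval n E \<sigma> e)) (nat (aval n E \<sigma> f)) (aval n E \<sigma> a))"
| "wp n E (p ;; q) Q \<sigma> \<longleftrightarrow> wp n E p (wp n E q Q) \<sigma>"
| "wp n E (If b p q) Q \<sigma> \<longleftrightarrow> bok n E \<sigma> b \<and>
     (if bval n E \<sigma> b then wp n E p Q \<sigma> else wp n E q Q \<sigma>)"
| "wp n E (For k c p) Q \<sigma> \<longleftrightarrow> 1 \<le> k \<and> k \<le> 32 \<and> c \<le> 2 \<and> k \<notin> written p \<and>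
     (\<exists>I. I 0 \<sigma> \<and> (\<forall>i<n + c. \<forall>\<tau>. I i \<tau> \<longrightarrow> wp n E p (I (Suc i)) (upd \<tau> k 0 0 (int i))) \<and>
       (\<forall>\<tau>. I (n + c) \<tau> \<longrightarrow> Q (upd \<tau> k 0 0 (int (n + c)))))"

section \<open>Verification rules for the loop language\<close>

lemma wp_mono:
  "wp n E p Q \<sigma> \<Longrightarrow> (\<And>\<tau>. Q \<tau> \<Longrightarrow> Q' \<tau>) \<Longrightarrow> wp n E p Q' \<sigma>"
proof (induction p arbitrary: Q Q' \<sigma>)
  case (Then p q)
  have "wp n E p (wp n E q Q) \<sigma>" using Then.prems by simp
  then have "wp n E p (wp n E q Q') \<sigma>"
    by (rule Then.IH(1)) (use Then.IH(2) Then.prems in blast)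
  then show ?case by simp
next
  case (If b p q)
  then show ?case by (auto split: if_splits)
next
  case (For k c p)
  then obtain I where "I 0 \<sigma>" "\<forall>i<n + c. \<forall>\<tau>. I i \<tau> \<longrightarrow> wp n E p (I (Suc i)) (upd \<tau> k 0 0 (int i))"
    "\<forall>\<tau>. I (n + c) \<tau> \<longrightarrow> Q (upd \<tau> k 0 0 (int (n + c)))"
    unfolding wp.simps by (elim conjE exE)
  then have "I 0 \<sigma>" "\<forall>i<n + c. \<forall>\<tau>. I i \<tau> \<longrightarrow> wp n E p (I (Suc i)) (upd \<tau> k 0 0 (int i))"
    "\<forall>\<tau>. I (n + c) \<tau> \<longrightarrow> Q' (upd \<tau> k 0 0 (int (n + c)))" using For.prems(2) by simp_all
  then show ?case using For.prems(1) unfolding wp.simps by blast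
qed auto

definition same_outside :: "nat set \<Rightarrow> store \<Rightarrow> store \<Rightarrow> bool" where
  "same_outside W \<sigma> \<tau> \<longleftrightarrow> (\<forall>r. r \<notin> W \<longrightarrow> \<tau> r = \<sigma> r)"

lemma same_outside_refl: "same_outside W \<sigma> \<sigma>"
  by (simp add: same_outside_def)

lemma same_outside_trans:
  "same_outside W \<sigma> \<tau> \<Longrightarrow> same_outside W' \<tau> \<upsilon> \<Longrightarrow> same_outside (W \<union> W') \<sigma> \<upsilon>"
  by (simp add: same_outside_def)

lemma same_outside_mono:
  "same_outside W \<sigma> \<tau> \<Longrightarrow> W \<subseteq> W' \<Longrightarrow> same_outside W' \<sigma> \<tau>"
  unfolding same_outside_def by blast

lemma same_outside_upd: "r \<in> W \<Longrightarrow> same_outside W \<sigma> (upd \<tau> r i j v) = same_outside W \<sigma> \<tau>"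
  by (auto simp: same_outside_def upd_def)

lemma same_outside_upd_left: "r \<in> W \<Longrightarrow> same_outside W (upd \<sigma> r i j v) \<tau> = same_outside W \<sigma> \<tau>"
  unfolding same_outside_def upd_def by (metis fun_upd_other)

text \<open>An array that the program text never assigns keeps its contents; for a loop, this is
  added to the invariant. It spares the later specifications from listing what does not
  change.\<close>

lemma wp_frame:
  "wp n E p Q \<sigma> \<Longrightarrow> wp n E p (\<lambda>\<tau>. Q \<tau> \<and> same_outside (written p) \<sigma> \<tau>) \<sigma>"
proof (induction p arbitrary: Q \<sigma>)
  case Nop
  then show ?case by (simp add: same_outside_refl)
next
  case (Set r e f a)
  then show ?case by (simp add: same_outside_upd same_outside_refl)
next
  case (Then p q)
  have "wp n E p (\<lambda>\<tau>. wp n E q Q \<tau> \<and> same_outside (written p) \<sigma> \<tau>) \<sigma>"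
    using Then.IH(1) Then.prems by simp
  then show ?case unfolding wp.simps written.simps
  proof (rule wp_mono)
    fix \<tau> assume a: "wp n E q Q \<tau> \<and> same_outside (written p) \<sigma> \<tau>"
    show "wp n E q (\<lambda>\<tau>. Q \<tau> \<and> same_outside (written p \<union> written q) \<sigma> \<tau>) \<tau>"
      using Then.IH(2)[OF conjunct1[OF a]]
      by (rule wp_mono) (use same_outside_trans[OF conjunct2[OF a]] in blast)
  qed
next
  case (If b p q)
  have "wp n E p (\<lambda>\<tau>. Q \<tau> \<and> same_outside (written p \<union> written q) \<sigma> \<tau>) \<sigma>" if "wp n E p Q \<sigma>"
    using If.IH(1)[OF that] by (rule wp_mono) (auto elim: same_outside_mono)
  moreover have "wp n E q (\<lambda>\<tau>. Q \<tau> \<and> same_outside (written p \<union> written q) \<sigma> \<tau>) \<sigma>" if "wp n E q Q \<sigma>"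
    using If.IH(2)[OF that] by (rule wp_mono) (auto elim: same_outside_mono)
  ultimately show ?case using If.prems by (auto split: if_splits)
next
  case (For k c p)
  let ?W = "insert k (written p)"
  obtain I where I: "I 0 \<sigma>"
    "\<And>i \<tau>. i < n + c \<Longrightarrow> I i \<tau> \<Longrightarrow> wp n E p (I (Suc i)) (upd \<tau> k 0 0 (int i))"
    "\<And>\<tau>. I (n + c) \<tau> \<Longrightarrow> Q (upd \<tau> k 0 0 (int (n + c)))"
    using For.prems unfolding wp.simps by (elim conjE exE) simp
  define J where "J = (\<lambda>i \<tau>. I i \<tau> \<and> same_outside ?W \<sigma> \<tau>)"
  have "J 0 \<sigma>" using I(1) by (simp add: J_def same_outside_refl)
  moreover have "wp n E p (J (Suc i)) (upd \<tau> k 0 0 (int i))" if "i < n + c" "J i \<tau>" for i \<tau>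
  proof -
    have J: "I i \<tau>" "same_outside ?W \<sigma> \<tau>" using that(2) by (auto simp: J_def)
    show ?thesis
      using For.IH[OF I(2)[OF that(1) J(1)]]
    proof (rule wp_mono)
      fix \<upsilon> assume a: "I (Suc i) \<upsilon> \<and> same_outside (written p) (upd \<tau> k 0 0 (int i)) \<upsilon>"
      have "same_outside ?W \<tau> \<upsilon>"
        using same_outside_mono[OF conjunct2[OF a], of ?W] by (simp add: same_outside_upd_left subset_insertI)
      then have "same_outside ?W \<sigma> \<upsilon>" using same_outside_trans[OF J(2), of ?W \<upsilon>] by simp
      then show "J (Suc i) \<upsilon>" using a by (simp add: J_def)
    qed
  qed
  moreover have "Q (upd \<tau> k 0 0 (int (n + c))) \<and> same_outside ?W \<sigma> (upd \<tau> k 0 0 (int (n + c)))"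
    if "J (n + c) \<tau>" for \<tau>
    using that I(3) by (simp add: J_def same_outside_upd)
  moreover have "1 \<le> k \<and> k \<le> 32 \<and> c \<le> 2 \<and> k \<notin> written p"
    using For.prems unfolding wp.simps by (elim conjE) simp
  ultimately show ?case unfolding wp.simps written.simps
    by (intro conjI exI[of _ J] allI impI) simp_all
qed

lemma wp_conseq:
  assumes "wp n E p Q \<sigma>" "\<And>\<tau>. Q \<tau> \<Longrightarrow> same_outside (written p) \<sigma> \<tau> \<Longrightarrow> Q' \<tau>"
  shows "wp n E p Q' \<sigma>"
  using wp_frame[OF assms(1)] by (rule wp_mono) (use assms(2) in blast)

text \<open>The invariant \<open>I i\<close> describes the store before the counter is set to
  \<open>i\<close>, and the loop leaves the counter at \<open>n + c\<close>. Both proof obligations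
  may use that only the written arrays have changed since the loop began.\<close>

lemma wp_For:
  assumes "1 \<le> k" "k \<le> 32" "c \<le> 2" "k \<notin> written p"
    and "I 0 \<sigma>"
    and step: "\<And>i \<tau>. i < n + c \<Longrightarrow> I i \<tau> \<Longrightarrow> same_outside (insert k (written p)) \<sigma> \<tau> \<Longrightarrow>
      wp n E p (I (Suc i)) (upd \<tau> k 0 0 (int i))"
    and fin: "\<And>\<tau>. I (n + c) \<tau> \<Longrightarrow> same_outside (insert k (written p)) \<sigma> \<tau> \<Longrightarrow>
      Q (upd \<tau> k 0 0 (int (n + c)))"
  shows "wp n E (For k c p) Q \<sigma>"
proof -
  let ?W = "insert k (written p)"
  define J where "J = (\<lambda>i \<tau>. I i \<tau> \<and> same_outside ?W \<sigma> \<tau>)"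
  have "wp n E p (J (Suc i)) (upd \<tau> k 0 0 (int i))" if "i < n + c" "J i \<tau>" for i \<tau>
  proof -
    have J: "I i \<tau>" "same_outside ?W \<sigma> \<tau>" using that(2) by (auto simp: J_def)
    show ?thesis
      using step[OF that(1) J]
    proof (rule wp_conseq)
      fix \<upsilon> assume a: "I (Suc i) \<upsilon>" "same_outside (written p) (upd \<tau> k 0 0 (int i)) \<upsilon>"
      have "same_outside ?W \<tau> \<upsilon>"
        using same_outside_mono[OF a(2), of ?W] by (simp add: same_outside_upd_left subset_insertI)
      then have "same_outside ?W \<sigma> \<upsilon>" using same_outside_trans[OF J(2), of ?W \<upsilon>] by simp
      then show "J (Suc i) \<upsilon>" using a by (simp add: J_def)
    qed
  qed
  moreover have "J 0 \<sigma>" using assms(5) by (simp add: J_def same_outside_refl)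
  moreover have "\<forall>\<tau>. J (n + c) \<tau> \<longrightarrow> Q (upd \<tau> k 0 0 (int (n + c)))" using fin by (simp add: J_def)
  ultimately show ?thesis using assms(1-4) unfolding wp.simps
    by (intro conjI exI[of _ J] allI impI) simp_all
qed

section \<open>Compilation and its cost\<close>

abbreviation "width \<equiv> Add (Read (Const 0)) (Const 2)"

abbreviation cell_expr :: "nat \<Rightarrow> expr \<Rightarrow> expr \<Rightarrow> expr" where
  "cell_expr r e f \<equiv> Add (Add (Mul (Const (int r)) (Mul width width)) (Mul e width)) f"

primrec compile_aexp :: "aexp \<Rightarrow> expr" where
  "compile_aexp (Num c) = Const c"
| "compile_aexp Size = Read (Const 0)"
| "compile_aexp (Edge e f) =
     Read (Add (Const 2) (Add (Mul (compile_aexp e) (Read (Const 0))) (compile_aexp f)))"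
| "compile_aexp (Arr r e f) = Read (cell_expr r (compile_aexp e) (compile_aexp f))"
| "compile_aexp (Plus e f) = Add (compile_aexp e) (compile_aexp f)"
| "compile_aexp (Minus e f) = Sub (compile_aexp e) (compile_aexp f)"

primrec compile_bexp :: "bexp \<Rightarrow> test" where
  "compile_bexp (Lt e f) = Less (compile_aexp e) (compile_aexp f)"
| "compile_bexp (Eq e f) = Equal (compile_aexp e) (compile_aexp f)"
| "compile_bexp (Not b) = Neg (compile_bexp b)"
| "compile_bexp (And b c) = Conj (compile_bexp b) (compile_bexp c)"

abbreviation var_addr :: "nat \<Rightarrow> expr" where
  "var_addr k \<equiv> cell_expr k (Const 0) (Const 0)"

abbreviation loop_test :: "nat \<Rightarrow> nat \<Rightarrow> test" where
  "loop_test k c \<equiv> Less (Read (var_addr k)) (Add (Read (Const 0)) (Const (int c)))"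

abbreviation loop_init :: "nat \<Rightarrow> prog" where
  "loop_init k \<equiv> Write (var_addr k) (Const 0)"

abbreviation loop_step :: "nat \<Rightarrow> prog" where
  "loop_step k \<equiv> Write (var_addr k) (Add (Read (var_addr k)) (Const 1))"

primrec compile :: "com \<Rightarrow> prog" where
  "compile Nop = Skip"
| "compile (Set r e f a) = Write (cell_expr r (compile_aexp e) (compile_aexp f)) (compile_aexp a)"
| "compile (p ;; q) = Seq (compile p) (compile q)"
| "compile (If b p q) = Cond (compile_bexp b) (compile p) (compile q)"
| "compile (For k c p) = Seq (loop_init k) (While (loop_test k c) (Seq (compile p) (loop_step k)))"

text \<open>The constant 100 generously covers initialising, testing and incrementing a loop counter.\<close>

primrec cost :: "nat \<Rightarrow> com \<Rightarrow> nat" where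
  "cost n Nop = 1"
| "cost n (Set r e f a) =
     expr_cost (cell_expr r (compile_aexp e) (compile_aexp f)) + expr_cost (compile_aexp a) + 1"
| "cost n (p ;; q) = cost n p + cost n q"
| "cost n (If b p q) = test_cost (compile_bexp b) + cost n p + cost n q"
| "cost n (For k c p) = 100 + (n + c + 1) * (100 + cost n p)"

primrec depth :: "com \<Rightarrow> nat" where
  "depth Nop = 0"
| "depth (Set r e f a) = 0"
| "depth (p ;; q) = max (depth p) (depth q)"
| "depth (If b p q) = max (depth p) (depth q)"
| "depth (For k c p) = Suc (depth p)"

text \<open>A loop multiplies the cost by \<open>n + c + 1\<close>, which is at most
  \<open>c + 1\<close> times \<open>n + 1\<close>, so each level of nesting contributes one factor
  \<open>n + 1\<close>. Using \<open>n + 1\<close> instead of \<open>n\<close> keeps the bound valid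
  for \<open>n = 0\<close>.\<close>

lemma cost_bound: "\<exists>C. \<forall>n. cost n p \<le> C * (n + 1) ^ depth p"
proof (induction p)
  case (Then p q)
  then obtain C D where CD: "\<And>n. cost n p \<le> C * (n + 1) ^ depth p" "\<And>n. cost n q \<le> D * (n + 1) ^ depth q"
    by blast
  have "cost n (p ;; q) \<le> (C + D) * (n + 1) ^ depth (p ;; q)" for n
  proof -
    have "C * (n + 1) ^ depth p \<le> C * (n + 1) ^ depth (p ;; q)"
      "D * (n + 1) ^ depth q \<le> D * (n + 1) ^ depth (p ;; q)"
      by (intro mult_le_mono2 power_increasing; simp)+
    then show ?thesis using CD[of n] by (simp only: cost.simps add_mult_distrib)
  qed
  then show ?case by blast
next
  case (If b p q)
  then obtain C D where CD: "\<And>n. cost n p \<le> C * (n + 1) ^ depth p" "\<And>n. cost n q \<le> D * (n + 1) ^ depth q"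
    by blast
  let ?t = "test_cost (compile_bexp b)"
  have "cost n (If b p q) \<le> (?t + C + D) * (n + 1) ^ depth (If b p q)" for n
  proof -
    have "C * (n + 1) ^ depth p \<le> C * (n + 1) ^ depth (If b p q)"
      "D * (n + 1) ^ depth q \<le> D * (n + 1) ^ depth (If b p q)"
      by (intro mult_le_mono2 power_increasing; simp)+
    moreover have "?t \<le> ?t * (n + 1) ^ depth (If b p q)" by simp
    ultimately show ?thesis using CD[of n] by (simp only: cost.simps add_mult_distrib)
  qed
  then show ?case by blast
next
  case (For k c p)
  then obtain C where C: "\<And>n. cost n p \<le> C * (n + 1) ^ depth p" by blast
  let ?K = "100 + (c + 1) * (100 + C)"
  have "cost n (For k c p) \<le> ?K * (n + 1) ^ depth (For k c p)" for n
  proof -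
    let ?P = "(n + 1) ^ depth p"
    have P: "1 \<le> ?P" by simp
    have "100 + cost n p \<le> 100 * ?P + C * ?P" using C[of n] P by linarith
    then have 1: "100 + cost n p \<le> (100 + C) * ?P" by (simp add: add_mult_distrib)
    have 2: "n + c + 1 \<le> (c + 1) * (n + 1)" by simp
    have "(n + c + 1) * (100 + cost n p) \<le> ((c + 1) * (n + 1)) * ((100 + C) * ?P)"
      by (rule mult_le_mono[OF 2 1])
    moreover have "1 * 1 \<le> (n + 1) * ?P" by (intro mult_le_mono P) simp
    ultimately show ?thesis by (simp add: algebra_simps)
  qed
  then show ?case by blast
qed (auto intro: exI[of _ 1])

text \<open>Array \<open>r\<close> occupies the block of cells that starts at \<open>r (n + 2)\<^sup>2\<close>; block 0 is left to the input.\<close>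

definition cell :: "nat \<Rightarrow> nat \<Rightarrow> nat \<Rightarrow> nat \<Rightarrow> nat" where
  "cell n r i j = r * ((n + 2) * (n + 2)) + i * (n + 2) + j"

text \<open>The adjacency matrix is kept intact throughout. The bound on all cells is the source of
  the word length; it involves \<open>h\<close> because cell 1 holds \<open>h\<close>.\<close>

definition rep :: "nat \<Rightarrow> (nat \<Rightarrow> nat \<Rightarrow> bool) \<Rightarrow> int \<Rightarrow> store \<Rightarrow> memory \<Rightarrow> bool" where
  "rep n E h \<sigma> s \<longleftrightarrow> s 0 = int n \<and> s 1 = h \<and>
     (\<forall>i<n. \<forall>j<n. s (2 + (i * n + j)) = of_bool (E i j)) \<and>
     (\<forall>r\<ge>1. \<forall>i<n + 2. \<forall>j<n + 2. s (cell n r i j) = \<sigma> r i j) \<and>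
     (\<forall>a. \<bar>s a\<bar> \<le> int n + \<bar>h\<bar> + 2)"

lemma mult_add_inject:
  fixes w :: nat
  assumes "j < w" "j' < w" "i * w + j = i' * w + j'"
  shows "i = i' \<and> j = j'"
proof -
  have "(i * w + j) div w = i" "(i' * w + j') div w = i'" using assms(1,2) by simp_all
  then have "i = i'" using assms(3) by simp
  then show ?thesis using assms(3) by simp
qed

text \<open>The address is the numeral with digits \<open>r\<close>, \<open>i\<close>,
  \<open>j\<close> in base \<open>n + 2\<close>; the leading digit may be arbitrarily large.\<close>

lemma cell_inject:
  assumes "i < n + 2" "j < n + 2" "i' < n + 2" "j' < n + 2"
  shows "cell n r i j = cell n r' i' j' \<longleftrightarrow> r = r' \<and> i = i' \<and> j = j'"
proof
  assume eq: "cell n r i j = cell n r' i' j'"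
  have "cell n r i j = (r * (n + 2) + i) * (n + 2) + j" for r i j
    by (simp add: cell_def algebra_simps)
  then have "r * (n + 2) + i = r' * (n + 2) + i' \<and> j = j'"
    using mult_add_inject[OF assms(2,4)] eq by metis
  then show "r = r' \<and> i = i' \<and> j = j'" using mult_add_inject[OF assms(1,3)] by blast
qed simp

lemma cell_large:
  assumes "1 \<le> r"
  shows "n * n + 2 \<le> cell n r i j"
proof -
  have "1 * ((n + 2) * (n + 2)) \<le> r * ((n + 2) * (n + 2))" using assms by (rule mult_le_mono1)
  then show ?thesis by (simp add: cell_def)
qed

lemma input_cell_less:
  assumes "i < n" "j < n"
  shows "2 + (i * n + j) < n * n + (2::nat)"
proof -
  have "Suc i * n \<le> n * n" using assms by (intro mult_le_mono1) simp
  then show ?thesis using assms by simp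
qed

lemma rep_upd:
  assumes "rep n E h \<sigma> s" "1 \<le> r" "i < n + 2" "j < n + 2" "-1 \<le> v" "v \<le> int n + 2"
  shows "rep n E h (upd \<sigma> r i j v) (s(cell n r i j := v))"
proof -
  let ?s = "s(cell n r i j := v)"
  have large: "n * n + 2 \<le> cell n r i j" by (rule cell_large[OF assms(2)])
  have "?s (2 + (i' * n + j')) = of_bool (E i' j')" if "i' < n" "j' < n" for i' j'
    using large input_cell_less[OF that] that assms(1) by (simp add: rep_def)
  moreover have "?s 0 = int n" "?s 1 = h" using large assms(1) by (auto simp: rep_def)
  moreover have "?s (cell n r' i' j') = upd \<sigma> r i j v r' i' j'"
    if "1 \<le> r'" "i' < n + 2" "j' < n + 2" for r' i' j'
    using assms(1) that cell_inject[OF that(2,3) assms(3,4), of r' r] by (auto simp: rep_def upd_def)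
  moreover have "\<bar>?s a\<bar> \<le> int n + \<bar>h\<bar> + 2" for a
    using assms(1,5,6) by (auto simp: rep_def)
  ultimately show ?thesis by (simp add: rep_def)
qed

text \<open>Together with \<open>consts_le\<close> this is the part of \<open>expr_ok\<close> that
  does not involve the size of intermediate results; their size follows from the cost of the
  expression.\<close>

primrec reads_ok :: "memory \<Rightarrow> expr \<Rightarrow> bool" where
  "reads_ok s (Const c) \<longleftrightarrow> True"
| "reads_ok s (Read e) \<longleftrightarrow> reads_ok s e \<and> 0 \<le> expr_val s e"
| "reads_ok s (Add e f) \<longleftrightarrow> reads_ok s e \<and> reads_ok s f"
| "reads_ok s (Sub e f) \<longleftrightarrow> reads_ok s e \<and> reads_ok s f"
| "reads_ok s (Mul e f) \<longleftrightarrow> reads_ok s e \<and> reads_ok s f"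

primrec consts_le :: "int \<Rightarrow> expr \<Rightarrow> bool" where
  "consts_le K (Const c) \<longleftrightarrow> \<bar>c\<bar> \<le> K"
| "consts_le K (Read e) \<longleftrightarrow> consts_le K e"
| "consts_le K (Add e f) \<longleftrightarrow> consts_le K e \<and> consts_le K f"
| "consts_le K (Sub e f) \<longleftrightarrow> consts_le K e \<and> consts_le K f"
| "consts_le K (Mul e f) \<longleftrightarrow> consts_le K e \<and> consts_le K f"

lemma power_add_bound:
  assumes "2 \<le> (K::int)"
  shows "K ^ a + K ^ b \<le> K ^ (a + b + 1)"
proof -
  have "K ^ a \<le> K ^ (a + b)" "K ^ b \<le> K ^ (a + b)" using assms by (intro power_increasing; simp)+
  moreover have "2 * K ^ (a + b) \<le> K * K ^ (a + b)" using assms by (intro mult_right_mono) auto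
  ultimately show ?thesis by simp
qed

text \<open>A value is at most \<open>K\<close> to the power of the cost of its expression: a
  product adds the exponents, and a sum of two powers fits because \<open>2 \<le> K\<close> pays for
  the additional factor.\<close>

lemma expr_ok_power:
  assumes K: "2 \<le> K" and mem: "\<And>a. \<bar>s a\<bar> \<le> K"
  shows "reads_ok s e \<Longrightarrow> consts_le K e \<Longrightarrow> expr_cost e \<le> m \<Longrightarrow>
    expr_ok (K ^ m) s e \<and> \<bar>expr_val s e\<bar> \<le> K ^ expr_cost e"
proof (induction e)
  case (Const c)
  have "K ^ 1 \<le> K ^ m" using K Const by (intro power_increasing) auto
  then show ?case using Const by simp
next
  case (Read e)
  have "K ^ 1 \<le> K ^ m" "K ^ 1 \<le> K ^ expr_cost (Read e)" using K Read by (intro power_increasing; auto)+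
  then have "\<bar>s (nat (expr_val s e))\<bar> \<le> K ^ m" "\<bar>s (nat (expr_val s e))\<bar> \<le> K ^ expr_cost (Read e)"
    using mem[of "nat (expr_val s e)"] by (simp_all only: power_one_right)
  then show ?case using Read by auto
next
  case (Add e f)
  then have IH: "expr_ok (K ^ m) s e" "\<bar>expr_val s e\<bar> \<le> K ^ expr_cost e"
    "expr_ok (K ^ m) s f" "\<bar>expr_val s f\<bar> \<le> K ^ expr_cost f" by auto
  have "\<bar>expr_val s e + expr_val s f\<bar> \<le> K ^ expr_cost (Add e f)"
    using power_add_bound[OF K, of "expr_cost e" "expr_cost f"] IH by simp
  moreover have "K ^ expr_cost (Add e f) \<le> K ^ m" using K Add.prems by (intro power_increasing) auto
  ultimately show ?case using IH by auto
next
  case (Sub e f)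
  then have IH: "expr_ok (K ^ m) s e" "\<bar>expr_val s e\<bar> \<le> K ^ expr_cost e"
    "expr_ok (K ^ m) s f" "\<bar>expr_val s f\<bar> \<le> K ^ expr_cost f" by auto
  have "\<bar>expr_val s e - expr_val s f\<bar> \<le> K ^ expr_cost (Sub e f)"
    using power_add_bound[OF K, of "expr_cost e" "expr_cost f"] IH by simp
  moreover have "K ^ expr_cost (Sub e f) \<le> K ^ m" using K Sub.prems by (intro power_increasing) auto
  ultimately show ?case using IH by auto
next
  case (Mul e f)
  then have IH: "expr_ok (K ^ m) s e" "\<bar>expr_val s e\<bar> \<le> K ^ expr_cost e"
    "expr_ok (K ^ m) s f" "\<bar>expr_val s f\<bar> \<le> K ^ expr_cost f" by auto
  have "\<bar>expr_val s e * expr_val s f\<bar> \<le> K ^ expr_cost e * K ^ expr_cost f"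
    unfolding abs_mult using IH K by (intro mult_mono) auto
  also have "\<dots> \<le> K ^ expr_cost (Mul e f)"
    unfolding power_add[symmetric] using K by (intro power_increasing) auto
  finally have "\<bar>expr_val s e * expr_val s f\<bar> \<le> K ^ expr_cost (Mul e f)" .
  moreover have "K ^ expr_cost (Mul e f) \<le> K ^ m" using K Mul.prems by (intro power_increasing) auto
  ultimately show ?case using IH by auto
qed

lemma consts_le_mono: "consts_le K e \<Longrightarrow> K \<le> K' \<Longrightarrow> consts_le K' e"
  by (induction e) auto

definition word_bound :: "nat \<Rightarrow> int \<Rightarrow> nat \<Rightarrow> int" where
  "word_bound n h m = (int n + \<bar>h\<bar> + 2) ^ (5 * m)"

lemma expr_ok_word_bound:
  assumes "rep n E h \<sigma> s" "reads_ok s e" "consts_le 32 e" "expr_cost e \<le> m"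
  shows "expr_ok (word_bound n h m) s e"
proof -
  let ?K = "int n + \<bar>h\<bar> + 2"
  have "(2::int) ^ 5 \<le> ?K ^ 5" by (rule power_mono) auto
  then have 32: "32 \<le> ?K ^ 5" by simp
  have "?K ^ 1 \<le> ?K ^ 5" by (rule power_increasing) auto
  then have "\<bar>s a\<bar> \<le> ?K ^ 5" for a using assms(1) by (auto simp: rep_def intro: order_trans)
  moreover have "consts_le (?K ^ 5) e" using consts_le_mono[OF assms(3) 32] .
  ultimately have "expr_ok ((?K ^ 5) ^ m) s e"
    using expr_ok_power[of "?K ^ 5" s e m] assms(2,4) 32 by auto
  then show ?thesis by (simp add: word_bound_def power_mult)
qed

definition tame :: "memory \<Rightarrow> expr \<Rightarrow> int \<Rightarrow> bool" where
  "tame s e v \<longleftrightarrow> expr_val s e = v \<and> reads_ok s e \<and> consts_le 32 e"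

lemma tame_simple:
  "\<bar>c\<bar> \<le> 32 \<Longrightarrow> tame s (Const c) c"
  "tame s e u \<Longrightarrow> tame s f v \<Longrightarrow> tame s (Add e f) (u + v)"
  "tame s e u \<Longrightarrow> tame s f v \<Longrightarrow> tame s (Sub e f) (u - v)"
  "tame s e u \<Longrightarrow> tame s f v \<Longrightarrow> tame s (Mul e f) (u * v)"
  "tame s e u \<Longrightarrow> 0 \<le> u \<Longrightarrow> tame s (Read e) (s (nat u))"
  by (auto simp: tame_def)

lemma tame_size: "rep n E h \<sigma> s \<Longrightarrow> tame s (Read (Const 0)) (int n)"
  by (simp add: tame_def rep_def)

lemma tame_cell_expr:
  assumes "rep n E h \<sigma> s" "tame s e (int i)" "tame s f (int j)" "r \<le> 32"
  shows "tame s (cell_expr r e f) (int (cell n r i j))"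
proof -
  have w: "tame s width (int n + 2)" by (intro tame_simple(1,2) tame_size[OF assms(1)]) simp
  have "tame s (cell_expr r e f) (int r * ((int n + 2) * (int n + 2)) + int i * (int n + 2) + int j)"
    by (intro tame_simple(2,4) w assms(2,3) tame_simple(1)) (use assms(4) in simp)
  then show ?thesis by (simp add: cell_def algebra_simps)
qed

lemma tame_cell:
  assumes "rep n E h \<sigma> s" "tame s e (int i)" "tame s f (int j)" "1 \<le> r" "r \<le> 32"
    "i < n + 2" "j < n + 2"
  shows "tame s (Read (cell_expr r e f)) (\<sigma> r i j)"
proof -
  have "tame s (Read (cell_expr r e f)) (s (nat (int (cell n r i j))))"
    by (rule tame_simple(5)[OF tame_cell_expr[OF assms(1-3,5)]]) simp
  then show ?thesis using assms(1,4,6,7) by (simp add: rep_def)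
qed

lemma tame_compile:
  assumes rep: "rep n E h \<sigma> s"
  shows "aok n E \<sigma> e \<Longrightarrow> tame s (compile_aexp e) (aval n E \<sigma> e)"
proof (induction e)
  case (Edge e f)
  define i j where ij: "i = nat (aval n E \<sigma> e)" "j = nat (aval n E \<sigma> f)"
  have lt: "i < n" "j < n" using Edge.prems by (auto simp: ij)
  have v: "tame s (compile_aexp e) (int i)" "tame s (compile_aexp f) (int j)"
    using Edge by (auto simp: ij)
  have "tame s (compile_aexp (Edge e f)) (s (nat (2 + (int i * int n + int j))))"
    unfolding compile_aexp.simps by (intro tame_simple v tame_size[OF rep]) simp_all
  also have "nat (2 + (int i * int n + int j)) = 2 + (i * n + j)" by (simp add: nat_add_distrib nat_mult_distrib)
  finally show ?case using rep lt by (simp add: rep_def ij)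
next
  case (Arr r e f)
  define i j where ij: "i = nat (aval n E \<sigma> e)" "j = nat (aval n E \<sigma> f)"
  have lt: "i < n + 2" "j < n + 2" using Arr.prems by (auto simp: ij)
  have v: "tame s (compile_aexp e) (int i)" "tame s (compile_aexp f) (int j)"
    using Arr by (auto simp: ij)
  show ?case unfolding compile_aexp.simps aval.simps ij[symmetric]
    by (rule tame_cell[OF rep v _ _ lt]) (use Arr.prems in auto)
qed (auto intro!: tame_simple tame_size[OF rep])

lemma tame_expr_ok:
  "rep n E h \<sigma> s \<Longrightarrow> tame s e v \<Longrightarrow> expr_cost e \<le> m \<Longrightarrow> expr_ok (word_bound n h m) s e"
  by (rule expr_ok_word_bound) (auto simp: tame_def)

lemma compile_bexp_correct:
  assumes rep: "rep n E h \<sigma> s"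
  shows "bok n E \<sigma> b \<Longrightarrow> test_cost (compile_bexp b) \<le> m \<Longrightarrow>
    test_ok (word_bound n h m) s (compile_bexp b) \<and> test_val s (compile_bexp b) = bval n E \<sigma> b"
proof (induction b)
  case (Lt e f)
  then show ?case using tame_compile[OF rep] tame_expr_ok[OF rep] by (auto simp: tame_def)
next
  case (Eq e f)
  then show ?case using tame_compile[OF rep] tame_expr_ok[OF rep] by (auto simp: tame_def)
qed auto

lemma exec_Write_cell:
  assumes rep: "rep n E h \<sigma> s" and e: "tame s e (int i)" "tame s f (int j)" and a: "tame s a v"
    and r: "1 \<le> r" "r \<le> 32" "i < n + 2" "j < n + 2" "-1 \<le> v" "v \<le> int n + 2"
    and cost: "expr_cost (cell_expr r e f) + expr_cost a + 1 \<le> m"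
  shows "\<exists>s'. exec (word_bound n h m) (Write (cell_expr r e f) a) s
      (expr_cost (cell_expr r e f) + expr_cost a + 1) s' \<and> rep n E h (upd \<sigma> r i j v) s'"
proof -
  let ?c = "cell_expr r e f"
  have c: "tame s ?c (int (cell n r i j))" by (rule tame_cell_expr[OF rep e r(2)])
  have "expr_cost ?c \<le> m" "expr_cost a \<le> m" using cost by linarith+
  then have "expr_ok (word_bound n h m) s ?c" "expr_ok (word_bound n h m) s a"
    using tame_expr_ok[OF rep c] tame_expr_ok[OF rep a] by blast+
  moreover have v: "expr_val s ?c = int (cell n r i j)" "expr_val s a = v"
    using c a by (simp_all only: tame_def)
  ultimately have "exec (word_bound n h m) (Write ?c a) s (expr_cost ?c + expr_cost a + 1)
      (s(nat (expr_val s ?c) := expr_val s a))"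
    by (intro exec_Write) (simp_all only: of_nat_0_le_iff)
  then show ?thesis using rep_upd[OF rep r(1,3,4,5,6)] unfolding v nat_int by blast
qed

lemma loop_test_correct:
  assumes k: "1 \<le> k" "k \<le> 32" "c \<le> 2" and m: "100 \<le> m" and rep: "rep n E h (upd \<tau> k 0 0 (int i)) s"
  shows "test_ok (word_bound n h m) s (loop_test k c)" "test_val s (loop_test k c) = (i < n + c)"
proof -
  have "tame s (Const 0) (int 0)" by (simp add: tame_def)
  from tame_cell[OF rep this this k(1,2)]
  have 1: "tame s (Read (var_addr k)) (int i)" by (simp add: upd_def)
  have 2: "tame s (Add (Read (Const 0)) (Const (int c))) (int n + int c)"
    using k(3) by (intro tame_simple(1,2) tame_size[OF rep]) simp
  have "expr_ok (word_bound n h m) s (Read (var_addr k))"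
    by (rule tame_expr_ok[OF rep 1]) (use m in simp)
  moreover have "expr_ok (word_bound n h m) s (Add (Read (Const 0)) (Const (int c)))"
    by (rule tame_expr_ok[OF rep 2]) (use m in simp)
  ultimately show "test_ok (word_bound n h m) s (loop_test k c)" by (simp only: test_ok.simps)
  have "expr_val s (Read (var_addr k)) = int i"
    "expr_val s (Add (Read (Const 0)) (Const (int c))) = int n + int c"
    using 1 2 by (simp_all only: tame_def)
  then show "test_val s (loop_test k c) = (i < n + c)" by (simp only: test_val.simps) linarith
qed

text \<open>Induction on the number \<open>d\<close> of iterations still to come. The factor
  \<open>d + 1\<close> accounts for the final failing test; the 26 steps of a test and the 44 steps
  of an increment stay below 100.\<close>

lemma exec_For_body:
  assumes k: "1 \<le> k" "k \<le> 32" "c \<le> 2" and m: "100 \<le> m"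
    and body: "\<And>i \<tau> s. i < n + c \<Longrightarrow> I i \<tau> \<Longrightarrow> rep n E h (upd \<tau> k 0 0 (int i)) s \<Longrightarrow>
      \<exists>t s' \<tau>'. exec (word_bound n h m) (compile p) s t s' \<and> t \<le> cost n p \<and> rep n E h \<tau>' s' \<and>
        I (Suc i) \<tau>' \<and> \<tau>' k 0 0 = int i"
  shows "i + d = n + c \<Longrightarrow> I i \<tau> \<Longrightarrow> rep n E h (upd \<tau> k 0 0 (int i)) s \<Longrightarrow>
    \<exists>t s' \<tau>'. exec (word_bound n h m) (While (loop_test k c) (Seq (compile p) (loop_step k))) s t s' \<and>
      t \<le> (d + 1) * (100 + cost n p) \<and> rep n E h (upd \<tau>' k 0 0 (int (n + c))) s' \<and> I (n + c) \<tau>'"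
proof (induction d arbitrary: i \<tau> s)
  case 0
  then have "\<not> test_val s (loop_test k c)" "test_ok (word_bound n h m) s (loop_test k c)"
    using loop_test_correct[OF k m 0(3)] by auto
  then have "exec (word_bound n h m) (While (loop_test k c) (Seq (compile p) (loop_step k))) s
    (test_cost (loop_test k c)) s" by (intro exec_While_False)
  moreover have "test_cost (loop_test k c) \<le> (0 + 1) * (100 + cost n p)" by simp
  ultimately show ?case using 0 by (metis add_0_right)
next
  case (Suc d)
  let ?w = "While (loop_test k c) (Seq (compile p) (loop_step k))"
  have i: "i < n + c" using Suc.prems by simp
  then have t: "test_val s (loop_test k c)" "test_ok (word_bound n h m) s (loop_test k c)"
    using loop_test_correct[OF k m Suc.prems(3)] by auto
  obtain t1 s1 \<tau>1 where 1: "exec (word_bound n h m) (compile p) s t1 s1" "t1 \<le> cost n p"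
    "rep n E h \<tau>1 s1" "I (Suc i) \<tau>1" "\<tau>1 k 0 0 = int i"
    using body[OF i Suc.prems(2,3)] by blast
  have z: "tame s1 (Const 0) (int 0)" by (simp add: tame_def)
  have "tame s1 (Read (var_addr k)) (int i)" using tame_cell[OF 1(3) z z k(1,2)] 1(5) by simp
  then have a: "tame s1 (Add (Read (var_addr k)) (Const 1)) (int i + 1)" by (intro tame_simple) simp_all
  have c44: "expr_cost (var_addr k) + expr_cost (Add (Read (var_addr k)) (Const 1)) + 1 = 44" by simp
  have "\<exists>s2. exec (word_bound n h m) (loop_step k) s1
      (expr_cost (var_addr k) + expr_cost (Add (Read (var_addr k)) (Const 1)) + 1) s2 \<and>
      rep n E h (upd \<tau>1 k 0 0 (int i + 1)) s2"
    by (rule exec_Write_cell[OF 1(3) z z a k(1,2)]) (use i k(3) m in simp_all)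
  then obtain s2 where 2: "exec (word_bound n h m) (loop_step k) s1 44 s2"
    "rep n E h (upd \<tau>1 k 0 0 (int (Suc i))) s2"
    unfolding c44 of_nat_Suc add.commute[of 1] by blast
  obtain t3 s3 \<tau>3 where 3: "exec (word_bound n h m) ?w s2 t3 s3" "t3 \<le> (d + 1) * (100 + cost n p)"
    "rep n E h (upd \<tau>3 k 0 0 (int (n + c))) s3" "I (n + c) \<tau>3"
    using Suc.IH[OF _ 1(4) 2(2)] Suc.prems(1) by auto
  have "exec (word_bound n h m) ?w s (test_cost (loop_test k c) + (t1 + 44) + t3) s3"
    using t exec_Seq[OF 1(1) 2(1)] 3(1) by (intro exec_While_True)
  moreover have "test_cost (loop_test k c) + (t1 + 44) + t3 \<le> (Suc d + 1) * (100 + cost n p)"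
    using 1(2) 3(2) by simp
  ultimately show ?case using 3(3,4) by blast
qed

text \<open>\<open>cost 0 p\<close> doubles as a measure of the program text: it is at least the
  cost of every single expression evaluated by the compiled program, and it does not depend on
  \<open>n\<close>. Hence one exponent serves all inputs.\<close>

theorem compile_sound:
  "wp n E p Q \<sigma> \<Longrightarrow> rep n E h \<sigma> s \<Longrightarrow> cost 0 p \<le> m \<Longrightarrow>
    \<exists>t s' \<sigma>'. exec (word_bound n h m) (compile p) s t s' \<and> t \<le> cost n p \<and> rep n E h \<sigma>' s' \<and> Q \<sigma>'"
proof (induction p arbitrary: Q \<sigma> s)
  case Nop
  have "exec (word_bound n h m) (compile Nop) s 1 s" unfolding compile.simps by (rule exec_Skip)
  moreover have "Q \<sigma>" using Nop.prems(1) by simp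
  ultimately show ?case using Nop.prems(2) by (metis cost.simps(1) le_refl)
next
  case (Set r e f a)
  define i j where ij: "i = nat (aval n E \<sigma> e)" "j = nat (aval n E \<sigma> f)"
  have ok: "aok n E \<sigma> e" "aok n E \<sigma> f" "aok n E \<sigma> a" using Set.prems(1) by auto
  have v: "tame s (compile_aexp e) (int i)" "tame s (compile_aexp f) (int j)"
    using tame_compile[OF Set.prems(2) ok(1)] tame_compile[OF Set.prems(2) ok(2)] Set.prems(1)
    by (simp_all add: ij)
  have "\<exists>s'. exec (word_bound n h m) (compile (Set r e f a)) s (cost n (Set r e f a)) s' \<and>
      rep n E h (upd \<sigma> r i j (aval n E \<sigma> a)) s'"
    unfolding compile.simps cost.simps
    by (rule exec_Write_cell[OF Set.prems(2) v tame_compile[OF Set.prems(2) ok(3)]])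
      (use Set.prems(1,3) in \<open>auto simp: ij\<close>)
  then show ?case using Set.prems(1) by (auto simp: ij)
next
  case (Then p q)
  obtain t s' \<sigma>' where 1: "exec (word_bound n h m) (compile p) s t s'" "t \<le> cost n p"
    "rep n E h \<sigma>' s'" "wp n E q Q \<sigma>'"
    using Then.IH(1)[of "wp n E q Q" \<sigma> s] Then.prems by auto
  obtain u s'' \<sigma>'' where 2: "exec (word_bound n h m) (compile q) s' u s''" "u \<le> cost n q"
    "rep n E h \<sigma>'' s''" "Q \<sigma>''"
    using Then.IH(2)[OF 1(4,3)] Then.prems by auto
  show ?case using exec_Seq[OF 1(1) 2(1)] 1(2) 2 by (auto intro!: exI add_mono)
next
  case (If b p q)
  have b: "test_ok (word_bound n h m) s (compile_bexp b)" "test_val s (compile_bexp b) = bval n E \<sigma> b"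
    using compile_bexp_correct[OF If.prems(2)] If.prems(1,3) by auto
  show ?case
  proof (cases "bval n E \<sigma> b")
    case True
    then obtain t s' \<sigma>' where 1: "exec (word_bound n h m) (compile p) s t s'" "t \<le> cost n p"
      "rep n E h \<sigma>' s'" "Q \<sigma>'"
      using If.IH(1)[of Q \<sigma> s] If.prems by auto
    have "exec (word_bound n h m) (compile (If b p q)) s (test_cost (compile_bexp b) + t) s'"
      unfolding compile.simps using b True 1(1) by (intro exec_Cond_True) auto
    moreover have "test_cost (compile_bexp b) + t \<le> cost n (If b p q)" using 1(2) by simp
    ultimately show ?thesis using 1(3,4) by blast
  next
    case False
    then obtain t s' \<sigma>' where 1: "exec (word_bound n h m) (compile q) s t s'" "t \<le> cost n q"
      "rep n E h \<sigma>' s'" "Q \<sigma>'"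
      using If.IH(2)[of Q \<sigma> s] If.prems by auto
    have "exec (word_bound n h m) (compile (If b p q)) s (test_cost (compile_bexp b) + t) s'"
      unfolding compile.simps using b False 1(1) by (intro exec_Cond_False) auto
    moreover have "test_cost (compile_bexp b) + t \<le> cost n (If b p q)" using 1(2) by simp
    ultimately show ?thesis using 1(3,4) by blast
  qed
next
  case (For k c p)
  obtain I where I: "I 0 \<sigma>"
    "\<And>i \<tau>. i < n + c \<Longrightarrow> I i \<tau> \<Longrightarrow> wp n E p (I (Suc i)) (upd \<tau> k 0 0 (int i))"
    "\<And>\<tau>. I (n + c) \<tau> \<Longrightarrow> Q (upd \<tau> k 0 0 (int (n + c)))"
    using For.prems(1) unfolding wp.simps by (elim conjE exE) simp
  have k: "1 \<le> k" "k \<le> 32" "c \<le> 2" "k \<notin> written p"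
    using conjunct1[OF For.prems(1)[unfolded wp.simps]] conjunct2[OF For.prems(1)[unfolded wp.simps]]
    by simp_all
  have m: "100 \<le> m" "cost 0 p \<le> m" using For.prems(3) by auto
  have z: "tame s (Const 0) (int 0)" by (simp add: tame_def)
  have z': "tame s (Const 0) 0" by (simp add: tame_def)
  have "\<exists>s'. exec (word_bound n h m) (loop_init k) s (expr_cost (var_addr k) + expr_cost (Const 0) + 1) s' \<and>
      rep n E h (upd \<sigma> k 0 0 0) s'"
    by (rule exec_Write_cell[OF For.prems(2) z z z' k(1,2)]) (use m in simp_all)
  moreover have "expr_cost (var_addr k) + expr_cost (Const 0) + 1 = 22" by simp
  ultimately obtain s1 where 1: "exec (word_bound n h m) (loop_init k) s 22 s1"
    "rep n E h (upd \<sigma> k 0 0 (int 0)) s1"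
    unfolding of_nat_0 by metis
  have body: "\<exists>t s' \<tau>'. exec (word_bound n h m) (compile p) s t s' \<and> t \<le> cost n p \<and> rep n E h \<tau>' s' \<and>
        I (Suc i) \<tau>' \<and> \<tau>' k 0 0 = int i"
    if "i < n + c" "I i \<tau>" "rep n E h (upd \<tau> k 0 0 (int i)) s" for i \<tau> s
  proof -
    \<comment> \<open>The frame rule shows that the body leaves the counter alone, so the increment
      that follows starts from \<open>i\<close>.\<close>
    have "wp n E p (\<lambda>\<tau>'. I (Suc i) \<tau>' \<and> \<tau>' k 0 0 = int i) (upd \<tau> k 0 0 (int i))"
      using I(2)[OF that(1,2)] by (rule wp_conseq) (use k(4) in \<open>simp add: same_outside_def upd_def\<close>)
    from For.IH[OF this that(3) m(2)] show ?thesis by blast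
  qed
  have "\<exists>t s' \<tau>'. exec (word_bound n h m) (While (loop_test k c) (Seq (compile p) (loop_step k))) s1 t s' \<and>
      t \<le> (n + c + 1) * (100 + cost n p) \<and> rep n E h (upd \<tau>' k 0 0 (int (n + c))) s' \<and> I (n + c) \<tau>'"
    by (rule exec_For_body[where I = I and i = 0 and \<tau> = \<sigma>, OF k(1-3) m(1) _ _ I(1) 1(2)])
      (erule (2) body, simp)
  then obtain t2 s2 \<tau> where 2: "exec (word_bound n h m) (While (loop_test k c) (Seq (compile p) (loop_step k))) s1 t2 s2"
    "t2 \<le> (n + c + 1) * (100 + cost n p)" "rep n E h (upd \<tau> k 0 0 (int (n + c))) s2" "I (n + c) \<tau>"
    by blast
  have "exec (word_bound n h m) (compile (For k c p)) s (22 + t2) s2"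
    unfolding compile.simps by (rule exec_Seq[OF 1(1) 2(1)])
  moreover have "22 + t2 \<le> cost n (For k c p)" using 2(2) by simp
  ultimately show ?case using 2(3) I(3)[OF 2(4)] by blast
qed

section \<open>The algorithm\<close>

text \<open>Array numbers. Row \<open>u\<close> of \<open>table\<close> holds \<open>F\<close> of
  the module of \<open>u\<close>; \<open>row\<close> is the current row of candidate values,
  \<open>best\<close> the table under construction, and \<open>diff\<close> counts the
  distinguishing representatives. The counters \<open>vb\<close> and \<open>vc\<close> run over the
  two reserves.\<close>

abbreviation (input) "vx \<equiv> 2 :: nat"
abbreviation (input) "vy \<equiv> 3 :: nat"
abbreviation (input) "vz \<equiv> 4 :: nat"
abbreviation (input) "vt \<equiv> 5 :: nat"
abbreviation (input) "vb \<equiv> 6 :: nat"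
abbreviation (input) "vc \<equiv> 7 :: nat"
abbreviation (input) "va \<equiv> 8 :: nat"
abbreviation (input) "vfound \<equiv> 9 :: nat"
abbreviation (input) "vu \<equiv> 10 :: nat"
abbreviation (input) "vv \<equiv> 11 :: nat"
abbreviation (input) "vres \<equiv> 12 :: nat"
abbreviation (input) "alive \<equiv> 13 :: nat"
abbreviation (input) "size_of \<equiv> 14 :: nat"
abbreviation (input) "table \<equiv> 15 :: nat"
abbreviation (input) "row \<equiv> 16 :: nat"
abbreviation (input) "best \<equiv> 17 :: nat"
abbreviation (input) "diff \<equiv> 18 :: nat"

abbreviation (input) Var :: "nat \<Rightarrow> aexp" where "Var k \<equiv> Arr k (Num 0) (Num 0)"
abbreviation (input) Vec :: "nat \<Rightarrow> aexp \<Rightarrow> aexp" where "Vec r e \<equiv> Arr r e (Num 0)"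
abbreviation (input) Set_Var :: "nat \<Rightarrow> aexp \<Rightarrow> com" where "Set_Var k a \<equiv> Set k (Num 0) (Num 0) a"
abbreviation (input) Set_Vec :: "nat \<Rightarrow> aexp \<Rightarrow> aexp \<Rightarrow> com" where "Set_Vec r e a \<equiv> Set r e (Num 0) a"

lemma upd_apply: "upd \<sigma> r i j v r' i' j' = (if r' = r \<and> i' = i \<and> j' = j then v else \<sigma> r' i' j')"
  by (simp add: upd_def)

text \<open>For a single vertex, \<open>F(0) = 1\<close> and \<open>F(1) = 0\<close>; the second
  entry is already zero in the initial memory and is not written.\<close>

definition init_vertices :: com where
  "init_vertices = For vx 0 (Set_Vec alive (Var vx) (Num 1) ;; Set_Vec size_of (Var vx) (Num 1) ;;
     Set_Vec table (Var vx) (Num 1))"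

lemma wp_init_vertices:
  assumes "\<And>x. \<sigma> table x 1 = 0"
  shows "wp n E init_vertices (\<lambda>\<tau>. \<forall>x<n. \<tau> alive x 0 = 1 \<and> \<tau> size_of x 0 = 1 \<and>
    \<tau> table x 0 = 1 \<and> \<tau> table x 1 = 0) \<sigma>"
  unfolding init_vertices_def
proof (rule wp_For[where I = "\<lambda>i \<tau>. (\<forall>x<i. \<tau> alive x 0 = 1 \<and> \<tau> size_of x 0 = 1 \<and>
    \<tau> table x 0 = 1) \<and> (\<forall>x. \<tau> table x 1 = 0)"])
qed (use assms in \<open>auto simp: upd_apply less_Suc_eq\<close>)

definition diff_count :: "(nat \<Rightarrow> nat \<Rightarrow> bool) \<Rightarrow> nat set \<Rightarrow> nat \<Rightarrow> nat \<Rightarrow> nat" where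
  "diff_count E L x y = card {w \<in> L. w \<noteq> x \<and> w \<noteq> y \<and> E x w \<noteq> E y w}"

definition count_diff :: com where
  "count_diff = For vz 0 (If (And (Not (Eq (Var vz) (Var vx))) (And (Not (Eq (Var vz) (Var vy)))
     (Not (Eq (Edge (Var vx) (Var vz)) (Edge (Var vy) (Var vz))))))
     (Set diff (Var vx) (Var vy) (Plus (Arr diff (Var vx) (Var vy)) (Num 1))) Nop)"

lemma diff_count_Suc:
  "diff_count E {..<Suc i} x y =
    diff_count E {..<i} x y + of_bool (i \<noteq> x \<and> i \<noteq> y \<and> E x i \<noteq> E y i)"
proof -
  have "{w \<in> {..<Suc i}. w \<noteq> x \<and> w \<noteq> y \<and> E x w \<noteq> E y w} =
    (if i \<noteq> x \<and> i \<noteq> y \<and> E x i \<noteq> E y i then insert i else id)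
      {w \<in> {..<i}. w \<noteq> x \<and> w \<noteq> y \<and> E x w \<noteq> E y w}"
    by (auto simp: less_Suc_eq)
  then show ?thesis by (simp add: diff_count_def)
qed

lemma diff_count_le: "finite L \<Longrightarrow> diff_count E L x y \<le> card L"
  unfolding diff_count_def by (rule card_mono) auto

lemma wp_count_diff:
  assumes "\<sigma> vx 0 0 = int x" "\<sigma> vy 0 0 = int y" "x < n" "y < n" "\<sigma> diff x y = 0"
  shows "wp n E count_diff (\<lambda>\<tau>. \<tau> diff x y = int (diff_count E {..<n} x y) \<and>
    (\<forall>i j. (i, j) \<noteq> (x, y) \<longrightarrow> \<tau> diff i j = \<sigma> diff i j)) \<sigma>"
  unfolding count_diff_def
proof (rule wp_For[where I = "\<lambda>i \<tau>. \<tau> diff x y = int (diff_count E {..<i} x y) \<and>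
    (\<forall>i j. (i, j) \<noteq> (x, y) \<longrightarrow> \<tau> diff i j = \<sigma> diff i j)"], goal_cases)
  case (6 i \<tau>)
  have "\<tau> vx = \<sigma> vx" "\<tau> vy = \<sigma> vy" using 6(3) by (simp_all add: same_outside_def)
  moreover have "int (diff_count E {..<i} x y) \<le> int i" using diff_count_le[of "{..<i}"] by simp
  ultimately show ?case using assms 6(1,2) by (simp add: upd_apply diff_count_Suc)
qed (use assms in \<open>simp_all add: upd_apply diff_count_def\<close>)

text \<open>A loop nest of depth three is affordable here because it runs only once, outside the
  main loop.\<close>

definition init_diffs :: com where
  "init_diffs = For vx 0 (For vy 0 count_diff)"

lemma wp_init_diffs:
  assumes "\<And>x y. \<sigma> diff x y = 0"
  shows "wp n E init_diffs (\<lambda>\<tau>. \<forall>x<n. \<forall>y<n. \<tau> diff x y = int (diff_count E {..<n} x y)) \<sigma>"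
  unfolding init_diffs_def
proof (rule wp_For[where I = "\<lambda>i \<tau>. (\<forall>x<i. \<forall>y<n. \<tau> diff x y = int (diff_count E {..<n} x y)) \<and>
    (\<forall>x\<ge>i. \<forall>y. \<tau> diff x y = 0)"], goal_cases)
  case (6 x \<tau>)
  show ?case
  proof (rule wp_For[where I = "\<lambda>j \<tau>. (\<forall>x'<x. \<forall>y<n. \<tau> diff x' y = int (diff_count E {..<n} x' y)) \<and>
      (\<forall>x'>x. \<forall>y. \<tau> diff x' y = 0) \<and> (\<forall>y<j. \<tau> diff x y = int (diff_count E {..<n} x y)) \<and>
      (\<forall>y\<ge>j. \<tau> diff x y = 0)"], goal_cases)
    case (6 y \<upsilon>)
    have "\<upsilon> vx 0 0 = int x" using 6(3) by (simp add: same_outside_def count_diff_def upd_apply)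
    then have "wp n E count_diff (\<lambda>\<tau>. \<tau> diff x y = int (diff_count E {..<n} x y) \<and>
      (\<forall>i j. (i, j) \<noteq> (x, y) \<longrightarrow> \<tau> diff i j = upd \<upsilon> vy 0 0 (int y) diff i j)) (upd \<upsilon> vy 0 0 (int y))"
      using 6 \<open>x < n + 0\<close> by (intro wp_count_diff) (auto simp: upd_apply)
    then show ?case
    proof (rule wp_mono)
      fix \<omega> assume a: "\<omega> diff x y = int (diff_count E {..<n} x y) \<and>
        (\<forall>i j. (i, j) \<noteq> (x, y) \<longrightarrow> \<omega> diff i j = upd \<upsilon> vy 0 0 (int y) diff i j)"
      then have "\<omega> diff i j = \<upsilon> diff i j" if "i \<noteq> x \<or> j \<noteq> y" for i j using that by (auto simp: upd_apply)
      then show "(\<forall>x'<x. \<forall>y<n. \<omega> diff x' y = int (diff_count E {..<n} x' y)) \<and>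
        (\<forall>x'>x. \<forall>y. \<omega> diff x' y = 0) \<and> (\<forall>y'<Suc y. \<omega> diff x y' = int (diff_count E {..<n} x y')) \<and>
        (\<forall>y'\<ge>Suc y. \<omega> diff x y' = 0)"
        using a 6(2) by (auto simp: less_Suc_eq)
    qed
  next
    case (7 \<upsilon>)
    then show ?case by (auto simp: less_Suc_eq upd_apply)
  qed (use 6 in \<open>auto simp: upd_apply count_diff_def\<close>)
qed (use assms in \<open>auto simp: upd_apply count_diff_def\<close>)

definition find_twins :: com where
  "find_twins = Set_Var vfound (Num 0) ;; For vx 0 (For vy 0
     (If (And (Eq (Vec alive (Var vx)) (Num 1)) (And (Eq (Vec alive (Var vy)) (Num 1))
       (And (Not (Eq (Var vx) (Var vy))) (Eq (Arr diff (Var vx) (Var vy)) (Num 0)))))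
       (Set_Var vu (Var vx) ;; Set_Var vv (Var vy) ;; Set_Var vfound (Num 1)) Nop))"

lemma wp_find_twins:
  assumes Q: "\<And>\<tau>. \<lbrakk>same_outside {vx, vy, vu, vv, vfound} \<sigma> \<tau>;
      \<tau> vfound 0 0 = 0 \<and> \<not> (\<exists>x<n. \<exists>y<n. good x y) \<or>
      \<tau> vfound 0 0 = 1 \<and> (\<exists>x<n. \<exists>y<n. good x y \<and> \<tau> vu 0 0 = int x \<and> \<tau> vv 0 0 = int y)\<rbrakk> \<Longrightarrow> Q \<tau>"
    and good: "\<And>x y. good x y \<longleftrightarrow> \<sigma> alive x 0 = 1 \<and> \<sigma> alive y 0 = 1 \<and> x \<noteq> y \<and> \<sigma> diff x y = 0"
  shows "wp n E find_twins Q \<sigma>"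
proof -
  \<comment> \<open>\<open>P\<close> stands for the pairs inspected so far. A later pair of twins
    overwrites an earlier one, and any pair will do.\<close>
  define I where "I = (\<lambda>P \<tau> :: store. \<tau> vfound 0 0 = 0 \<and> (\<forall>x y. P x y \<longrightarrow> \<not> good x y) \<or>
      \<tau> vfound 0 0 = 1 \<and> (\<exists>x<n. \<exists>y<n. good x y \<and> \<tau> vu 0 0 = int x \<and> \<tau> vv 0 0 = int y))"
  have "wp n E find_twins (I (\<lambda>x y. x < n \<and> y < n)) \<sigma>"
    unfolding find_twins_def wp.simps(2,3)
  proof (intro conjI)
    let ?\<sigma> = "upd \<sigma> vfound (nat (aval n E \<sigma> (Num 0))) (nat (aval n E \<sigma> (Num 0))) (aval n E \<sigma> (Num 0))"
    show "wp n E (For vx 0 (For vy 0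
     (If (And (Eq (Vec alive (Var vx)) (Num 1)) (And (Eq (Vec alive (Var vy)) (Num 1))
       (And (Not (Eq (Var vx) (Var vy))) (Eq (Arr diff (Var vx) (Var vy)) (Num 0)))))
       (Set_Var vu (Var vx) ;; Set_Var vv (Var vy) ;; Set_Var vfound (Num 1)) Nop)))
       (I (\<lambda>x y. x < n \<and> y < n)) ?\<sigma>"
    proof (rule wp_For[where I = "\<lambda>i. I (\<lambda>x y. x < i \<and> y < n)"], goal_cases)
      case (6 x \<tau>)
      show ?case
      proof (rule wp_For[where I = "\<lambda>j. I (\<lambda>x' y. x' < x \<and> y < n \<or> x' = x \<and> y < j)"], goal_cases)
        case (6 y \<upsilon>)
        have "\<upsilon> alive = \<sigma> alive" "\<upsilon> diff = \<sigma> diff" "\<upsilon> vx 0 0 = int x"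
          using 6(3) \<open>same_outside _ ?\<sigma> \<tau>\<close> by (simp_all add: same_outside_def upd_def)
        then show ?case using 6(1,2) \<open>x < n + 0\<close> good[of x y]
          by (auto simp: upd_apply I_def less_Suc_eq)
      qed (use 6 in \<open>auto simp: upd_apply I_def less_Suc_eq\<close>)
    qed (auto simp: upd_apply I_def)
  qed auto
  then show ?thesis
    by (rule wp_conseq) (intro Q, auto simp: find_twins_def I_def same_outside_def)
qed

section \<open>Combining two tables\<close>

abbreviation "left_size \<equiv> Vec size_of (Var vu)"
text \<open>Loops only count upwards, so \<open>vb\<close> holds \<open>p - a\<close>, where
  \<open>p\<close> is the size of the left module, and \<open>a\<close> is recovered by
  subtraction.\<close>

abbreviation "left_entry \<equiv> Arr table (Var vu) (Minus left_size (Var vb))"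
abbreviation "right_entry \<equiv> Arr table (Var vv) (Var vc)"
abbreviation "next_entry \<equiv> Plus (Vec row (Plus (Var vc) (Num 1))) (Num 1)"
abbreviation "best_index \<equiv> Plus (Minus left_size (Var vb)) (Var vc)"

definition combine_cell :: com where
  "combine_cell =
     If (Eq (Edge (Var vu) (Var vv)) (Num 1))
       (If (Lt next_entry (Plus left_entry right_entry))
         (Set_Vec row (Var vc) (Plus left_entry right_entry)) (Set_Vec row (Var vc) next_entry))
       (If (Lt left_entry right_entry)
         (Set_Vec row (Var vc) right_entry) (Set_Vec row (Var vc) left_entry)) ;;
     If (Lt (Vec best best_index) (Vec row (Var vc))) (Set_Vec best best_index (Vec row (Var vc))) Nop"

text \<open>Every loop runs over its full range, so a guard skips the indices beyond the size of the
  right module.\<close>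

definition combine_row :: com where
  "combine_row = For vc 1 (If (Not (Lt (Vec size_of (Var vv)) (Var vc))) combine_cell Nop)"

text \<open>
  The entry \<open>-1\<close> stands for the missing neighbours of the last row and column: the candidate
  \<open>-1 + 1\<close> never exceeds a sum of table entries. Rows are processed for decreasing \<open>a\<close>, so that
  \<open>row\<close> still holds the values for \<open>a + 1\<close> at the positions not yet overwritten.
\<close>

definition combine :: com where
  "combine = For va 2 (Set_Vec row (Var va) (Num (-1)) ;; Set_Vec best (Var va) (Num 0)) ;;
     For vb 1 (If (Not (Lt left_size (Var vb))) combine_row Nop)"

text \<open>For \<open>c \<le> n\<close>, \<open>R c\<close> is the maximum of \<open>val\<close>
  over the pairs of \<open>D\<close> with sum \<open>c\<close>, or 0 if there is none. A bound and a
  witness replace \<open>Max\<close>, because \<open>D\<close> grows by single pairs and starts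
  empty.\<close>

definition covers :: "nat \<Rightarrow> (nat \<Rightarrow> nat \<Rightarrow> nat) \<Rightarrow> (nat \<times> nat) set \<Rightarrow> (nat \<Rightarrow> int) \<Rightarrow> bool" where
  "covers n val D R \<longleftrightarrow> (\<forall>(a, b)\<in>D. int (val a b) \<le> R (a + b)) \<and>
     (\<forall>c\<le>n. R c = 0 \<or> (\<exists>(a, b)\<in>D. a + b = c \<and> R c = int (val a b)))"

lemma coversD: "covers n val D R \<Longrightarrow> (a, b) \<in> D \<Longrightarrow> int (val a b) \<le> R (a + b)"
  by (auto simp: covers_def)

lemma coversE:
  assumes "covers n val D R" "c \<le> n"
  obtains "R c = 0" | a b where "(a, b) \<in> D" "a + b = c" "R c = int (val a b)"
  using assms by (auto simp: covers_def)

lemma covers_insert: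
  assumes "covers n val D R" "R' (a + b) = max (R (a + b)) (int (val a b))" "\<And>c. c \<noteq> a + b \<Longrightarrow> R' c = R c"
  shows "covers n val (insert (a, b) D) R'"
proof -
  have ge: "R c \<le> R' c" for c using assms(2,3) by (cases "c = a + b") auto
  have "int (val a' b') \<le> R' (a' + b')" if "(a', b') \<in> insert (a, b) D" for a' b'
    using that assms(1,2) ge[of "a' + b'"] by (fastforce simp: covers_def)
  moreover have "R' c = 0 \<or> (\<exists>(a', b')\<in>insert (a, b) D. a' + b' = c \<and> R' c = int (val a' b'))" if "c \<le> n" for c
  proof (cases "c = a + b \<and> R (a + b) < int (val a b)")
    case True
    then show ?thesis using assms(2) by auto
  next
    case False
    then have "R' c = R c" using assms(2,3) by (cases "c = a + b") auto
    then show ?thesis using assms(1) that by (auto simp: covers_def)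
  qed
  ultimately show ?thesis by (auto simp: covers_def)
qed

text \<open>The loops only evaluate a recurrence, so they are verified for arbitrary functions;
  models and modules enter when \<open>f\<close>, \<open>g\<close> and \<open>val\<close> are
  instantiated.\<close>

locale tables =
  fixes n :: nat and E :: "nat \<Rightarrow> nat \<Rightarrow> bool" and u v p q :: nat and f g :: "nat \<Rightarrow> nat"
    and val :: "nat \<Rightarrow> nat \<Rightarrow> nat"
  assumes uv: "u < n" "v < n" and pq: "p + q \<le> n"
    and val_le: "\<And>a b. a \<le> p \<Longrightarrow> b \<le> q \<Longrightarrow> val a b \<le> n"
    and val_join: "\<And>a b. E u v \<Longrightarrow> a \<le> p \<Longrightarrow> b \<le> q \<Longrightarrow> val a b =
      (if a < p \<and> b < q then max (f a + g b) (Suc (val (Suc a) (Suc b))) else f a + g b)"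
    and val_union: "\<And>a b. \<not> E u v \<Longrightarrow> a \<le> p \<Longrightarrow> b \<le> q \<Longrightarrow> val a b = max (f a) (g b)"
begin

definition inputs :: "store \<Rightarrow> bool" where
  "inputs \<sigma> \<longleftrightarrow> \<sigma> vu 0 0 = int u \<and> \<sigma> vv 0 0 = int v \<and> \<sigma> size_of u 0 = int p \<and> \<sigma> size_of v 0 = int q \<and>
     (\<forall>a\<le>p. \<sigma> table u a = int (f a)) \<and> (\<forall>b\<le>q. \<sigma> table v b = int (g b))"

lemma inputs_upd: "inputs \<sigma> \<Longrightarrow> r \<notin> {vu, vv, size_of, table} \<Longrightarrow> inputs (upd \<sigma> r i j x)"
  by (auto simp: inputs_def upd_def)

lemma wp_combine_cell:
  assumes "inputs \<sigma>" "\<sigma> vb 0 0 = int (p - a)" "a \<le> p" "\<sigma> vc 0 0 = int b" "b \<le> q"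
    and step: "E u v \<Longrightarrow> int (val a b) = max (int (f a + g b)) (\<sigma> row (Suc b) 0 + 1)"
    and ge: "-1 \<le> \<sigma> row (Suc b) 0"
    and cov: "covers n val D (\<lambda>c. \<sigma> best c 0)"
  shows "wp n E combine_cell (\<lambda>\<tau>. \<tau> row b 0 = int (val a b) \<and> (\<forall>c. c \<noteq> b \<longrightarrow> \<tau> row c 0 = \<sigma> row c 0) \<and>
    covers n val (insert (a, b) D) (\<lambda>c. \<tau> best c 0)) \<sigma>"
proof -
  have in1: "\<sigma> vu 0 0 = int u" "\<sigma> vv 0 0 = int v" "\<sigma> size_of u 0 = int p" "\<sigma> size_of v 0 = int q"
    "\<sigma> table u a = int (f a)" "\<sigma> table v b = int (g b)"
    using assms(1,3,5) by (auto simp: inputs_def)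
  have sub: "int p - int (p - a) = int a" using assms(3) by simp
  have b1: "nat (int b + 1) = Suc b" by simp
  have ab: "nat (int a + int b) = a + b" by simp
  have bnd: "a + b \<le> n" "int (val a b) \<le> int n" using assms(3,5) pq val_le[OF assms(3,5)] by auto
  have un: "\<not> E u v \<Longrightarrow> int (val a b) = max (int (f a)) (int (g b))" using val_union assms(3,5) by simp
  define P where "P = (\<lambda>\<tau> :: store. same_outside {row} \<sigma> \<tau> \<and> \<tau> row b 0 = int (val a b) \<and>
    (\<forall>c. c \<noteq> b \<longrightarrow> \<tau> row c 0 = \<sigma> row c 0))"
  have 1: "wp n E (If (Eq (Edge (Var vu) (Var vv)) (Num 1))
       (If (Lt next_entry (Plus left_entry right_entry))
         (Set_Vec row (Var vc) (Plus left_entry right_entry)) (Set_Vec row (Var vc) next_entry))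
       (If (Lt left_entry right_entry)
         (Set_Vec row (Var vc) right_entry) (Set_Vec row (Var vc) left_entry))) P \<sigma>"
  proof (cases "E u v")
    case True
    then show ?thesis
      using in1 assms(2-5) uv pq step[OF True] bnd ge
      by (auto simp: sub b1 P_def upd_apply same_outside_upd same_outside_refl)
  next
    case False
    then show ?thesis
      using in1 assms(2-5) uv pq un[OF False] bnd ge
      by (auto simp: sub b1 P_def upd_apply same_outside_upd same_outside_refl)
  qed
  have 2: "wp n E (If (Lt (Vec best best_index) (Vec row (Var vc))) (Set_Vec best best_index (Vec row (Var vc))) Nop)
    (\<lambda>\<tau>. \<tau> row b 0 = int (val a b) \<and> (\<forall>c. c \<noteq> b \<longrightarrow> \<tau> row c 0 = \<sigma> row c 0) \<and>
    covers n val (insert (a, b) D) (\<lambda>c. \<tau> best c 0)) \<tau>" if "P \<tau>" for \<tau>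
  proof -
    have eq: "\<tau> r = \<sigma> r" if "r \<noteq> row" for r using \<open>P \<tau>\<close> that by (simp add: P_def same_outside_def)
    have row: "\<tau> row b 0 = int (val a b)" "\<And>c. c \<noteq> b \<Longrightarrow> \<tau> row c 0 = \<sigma> row c 0"
      using \<open>P \<tau>\<close> by (simp_all add: P_def)
    have "covers n val (insert (a, b) D) (\<lambda>c. upd \<tau> best (a + b) 0 (int (val a b)) best c 0)"
      if "\<sigma> best (a + b) 0 < int (val a b)"
      by (rule covers_insert[OF cov]) (use that eq in \<open>auto simp: upd_apply\<close>)
    moreover have "covers n val (insert (a, b) D) (\<lambda>c. \<sigma> best c 0)"
      if "\<not> \<sigma> best (a + b) 0 < int (val a b)"
      by (rule covers_insert[OF cov]) (use that in auto)
    ultimately show ?thesis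
      using in1 assms(2-5) uv pq bnd row by (simp add: eq sub ab upd_apply)
  qed
  show ?thesis unfolding combine_cell_def wp.simps(3) by (rule wp_mono[OF 1 2])
qed

lemma wp_combine_row:
  assumes "inputs \<sigma>" "\<sigma> vb 0 0 = int (p - a)" "a \<le> p"
    and row: "\<And>b. b \<le> q \<Longrightarrow> \<sigma> row b 0 = (if a = p then -1 else int (val (Suc a) b))" "\<sigma> row (Suc q) 0 = -1"
    and cov: "covers n val {(a', b). a < a' \<and> a' \<le> p \<and> b \<le> q} (\<lambda>c. \<sigma> best c 0)"
  shows "wp n E combine_row (\<lambda>\<tau>. (\<forall>b\<le>q. \<tau> row b 0 = int (val a b)) \<and> \<tau> row (Suc q) 0 = -1 \<and>
    covers n val {(a', b). a \<le> a' \<and> a' \<le> p \<and> b \<le> q} (\<lambda>c. \<tau> best c 0)) \<sigma>"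
proof -
  define D where "D = (\<lambda>i. {(a', b). a < a' \<and> a' \<le> p \<and> b \<le> q} \<union> {(a, b) |b. b < i \<and> b \<le> q})"
  show ?thesis unfolding combine_row_def
  proof (rule wp_For[where I = "\<lambda>i \<tau>. (\<forall>b\<le>q. \<tau> row b 0 = (if b < i then int (val a b) else \<sigma> row b 0)) \<and>
      \<tau> row (Suc q) 0 = -1 \<and> covers n val (D i) (\<lambda>c. \<tau> best c 0)"], goal_cases)
    case (6 b \<tau>)
    let ?\<tau> = "upd \<tau> vc 0 0 (int b)"
    have eq: "\<tau> r = \<sigma> r" if "r \<notin> {vc, row, best}" for r
      using 6(3) that by (simp add: same_outside_def combine_cell_def)
    have inp: "inputs ?\<tau>" using assms(1) eq by (intro inputs_upd) (simp_all add: inputs_def)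
    show ?case
    proof (cases "b \<le> q")
      case True
      have row': "\<tau> row (Suc b) 0 = (if b = q \<or> a = p then -1 else int (val (Suc a) (Suc b)))"
        using 6(2) row True by (cases "b = q") auto
      have DS: "D (Suc b) = insert (a, b) (D b)" using True by (auto simp: D_def less_Suc_eq)
      have "wp n E combine_cell (\<lambda>\<upsilon>. \<upsilon> row b 0 = int (val a b) \<and> (\<forall>c. c \<noteq> b \<longrightarrow> \<upsilon> row c 0 = ?\<tau> row c 0) \<and>
          covers n val (insert (a, b) (D b)) (\<lambda>c. \<upsilon> best c 0)) ?\<tau>"
      proof (rule wp_combine_cell[OF inp _ assms(3) _ True])
        assume "E u v"
        then show "int (val a b) = max (int (f a + g b)) (?\<tau> row (Suc b) 0 + 1)"
          using val_join[of a b] assms(3) True row' by (auto simp: upd_apply)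
      qed (use 6(2) eq assms(2) row' in \<open>simp_all add: upd_apply\<close>)
      then have "wp n E combine_cell (\<lambda>\<upsilon>. (\<forall>b'\<le>q. \<upsilon> row b' 0 = (if b' < Suc b then int (val a b') else \<sigma> row b' 0)) \<and>
          \<upsilon> row (Suc q) 0 = -1 \<and> covers n val (D (Suc b)) (\<lambda>c. \<upsilon> best c 0)) ?\<tau>"
      proof (rule wp_mono)
        fix \<upsilon> assume a: "\<upsilon> row b 0 = int (val a b) \<and> (\<forall>c. c \<noteq> b \<longrightarrow> \<upsilon> row c 0 = ?\<tau> row c 0) \<and>
          covers n val (insert (a, b) (D b)) (\<lambda>c. \<upsilon> best c 0)"
        then have "\<upsilon> row c 0 = \<tau> row c 0" if "c \<noteq> b" for c using that by (simp add: upd_apply)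
        then show "(\<forall>b'\<le>q. \<upsilon> row b' 0 = (if b' < Suc b then int (val a b') else \<sigma> row b' 0)) \<and>
          \<upsilon> row (Suc q) 0 = -1 \<and> covers n val (D (Suc b)) (\<lambda>c. \<upsilon> best c 0)"
          using a 6(2) True DS by (auto simp: less_Suc_eq)
      qed
      then show ?thesis using True inp uv pq by (simp add: inputs_def upd_apply)
    next
      case False
      then have "D (Suc b) = D b" by (auto simp: D_def)
      then show ?thesis using False inp uv pq 6(2) by (simp add: inputs_def upd_apply)
    qed
  next
    case (7 \<tau>)
    have "D (n + 1) = {(a', b). a \<le> a' \<and> a' \<le> p \<and> b \<le> q}"
      using assms(3) pq by (auto simp: D_def)
    then show ?case using 7 pq by (simp add: upd_apply)
  qed (use assms in \<open>auto simp: combine_cell_def D_def\<close>)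
qed

lemma wp_combine:
  assumes "inputs \<sigma>"
  shows "wp n E combine (\<lambda>\<tau>. covers n val ({..p} \<times> {..q}) (\<lambda>c. \<tau> best c 0)) \<sigma>"
proof -
  have 1: "wp n E (For va 2 (Set_Vec row (Var va) (Num (-1)) ;; Set_Vec best (Var va) (Num 0)))
    (\<lambda>\<tau>. same_outside {va, row, best} \<sigma> \<tau> \<and> (\<forall>i<n + 2. \<tau> row i 0 = -1) \<and> (\<forall>i<n + 2. \<tau> best i 0 = 0)) \<sigma>"
    by (rule wp_For[where I = "\<lambda>i \<tau>. same_outside {va, row, best} \<sigma> \<tau> \<and> (\<forall>j<i. \<tau> row j 0 = -1) \<and> (\<forall>j<i. \<tau> best j 0 = 0)"])
      (auto simp: upd_apply less_Suc_eq same_outside_upd same_outside_refl)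
  have 2: "wp n E (For vb 1 (If (Not (Lt left_size (Var vb))) combine_row Nop))
    (\<lambda>\<tau>. covers n val ({..p} \<times> {..q}) (\<lambda>c. \<tau> best c 0)) \<tau>"
    if \<tau>: "same_outside {va, row, best} \<sigma> \<tau> \<and> (\<forall>i<n + 2. \<tau> row i 0 = -1) \<and> (\<forall>i<n + 2. \<tau> best i 0 = 0)" for \<tau>
  \<comment> \<open>After \<open>i\<close> iterations the values of \<open>a\<close> above
    \<open>p - i\<close> are done, written additively to avoid truncated subtraction. The claim
    about \<open>row\<close> is confined to \<open>i \<le> p\<close>, since \<open>p - i\<close>
    truncates beyond that.\<close>
  proof (rule wp_For[where I = "\<lambda>i \<tau>. covers n val {(a, b). a \<le> p \<and> p < a + i \<and> b \<le> q} (\<lambda>c. \<tau> best c 0) \<and>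
      (i \<le> p \<longrightarrow> (\<forall>b\<le>q. \<tau> row b 0 = (if i = 0 then -1 else int (val (Suc (p - i)) b))) \<and> \<tau> row (Suc q) 0 = -1)"], goal_cases)
    case 5
    then show ?case using \<tau> pq by (auto simp: covers_def)
  next
    case (6 i \<upsilon>)
    let ?\<upsilon> = "upd \<upsilon> vb 0 0 (int i)"
    have eq: "\<upsilon> r = \<sigma> r" if "r \<notin> {va, vb, vc, row, best}" for r
      using 6(3) \<tau> that by (simp add: same_outside_def combine_row_def combine_cell_def)
    have inp: "inputs ?\<upsilon>" using assms eq by (intro inputs_upd) (simp_all add: inputs_def)
    show ?case
    proof (cases "i \<le> p")
      case True
      have D: "{(a', b). p - i < a' \<and> a' \<le> p \<and> b \<le> q} = {(a, b). a \<le> p \<and> p < a + i \<and> b \<le> q}"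
        "{(a', b). p - i \<le> a' \<and> a' \<le> p \<and> b \<le> q} = {(a, b). a \<le> p \<and> p < a + Suc i \<and> b \<le> q}"
        using True by auto
      have "wp n E combine_row (\<lambda>\<tau>. (\<forall>b\<le>q. \<tau> row b 0 = int (val (p - i) b)) \<and> \<tau> row (Suc q) 0 = -1 \<and>
        covers n val {(a', b). p - i \<le> a' \<and> a' \<le> p \<and> b \<le> q} (\<lambda>c. \<tau> best c 0)) ?\<upsilon>"
        by (rule wp_combine_row[OF inp]) (use 6(2) True D(1) in \<open>auto simp: upd_apply\<close>)
      then have "wp n E combine_row (\<lambda>\<tau>. covers n val {(a, b). a \<le> p \<and> p < a + Suc i \<and> b \<le> q} (\<lambda>c. \<tau> best c 0) \<and>
        (Suc i \<le> p \<longrightarrow> (\<forall>b\<le>q. \<tau> row b 0 = (if Suc i = 0 then -1 else int (val (Suc (p - Suc i)) b))) \<and>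
        \<tau> row (Suc q) 0 = -1)) ?\<upsilon>"
        by (rule wp_mono) (simp add: D Suc_diff_Suc)
      then show ?thesis using True inp uv by (simp add: inputs_def upd_apply)
    next
      case False
      then have "{(a, b). a \<le> p \<and> p < a + Suc i \<and> b \<le> q} = {(a, b). a \<le> p \<and> p < a + i \<and> b \<le> q}" by auto
      then show ?thesis using False inp uv 6(2) by (simp add: inputs_def upd_apply)
    qed
  next
    case (7 \<upsilon>)
    have "{(a, b). a \<le> p \<and> p < a + (n + 1) \<and> b \<le> q} = {..p} \<times> {..q}" using pq by auto
    then show ?case using 7 by (simp add: upd_apply)
  qed (auto simp: combine_row_def combine_cell_def)
  show ?thesis unfolding combine_def wp.simps(3) by (rule wp_mono[OF 1 2])
qed

end

section \<open>Maintaining the difference counts\<close>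

definition update_diffs :: com where
  "update_diffs = For vx 0 (For vy 0
     (If (And (Eq (Vec alive (Var vx)) (Num 1)) (And (Eq (Vec alive (Var vy)) (Num 1))
       (Not (Eq (Edge (Var vx) (Var vv)) (Edge (Var vy) (Var vv))))))
       (Set diff (Var vx) (Var vy) (Minus (Arr diff (Var vx) (Var vy)) (Num 1))) Nop))"

text \<open>Of the representatives only \<open>v\<close> disappears in a merge, so a pair loses at
  most one distinguishing vertex, and a single test and decrement repairs its count.\<close>

lemma diff_count_remove:
  assumes "finite L" "v \<in> L" "x \<noteq> v" "y \<noteq> v"
  shows "diff_count E L x y = diff_count E (L - {v}) x y + of_bool (E x v \<noteq> E y v)"
proof -
  have "{w \<in> L. w \<noteq> x \<and> w \<noteq> y \<and> E x w \<noteq> E y w} =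
    (if E x v \<noteq> E y v then insert v else id) {w \<in> L - {v}. w \<noteq> x \<and> w \<noteq> y \<and> E x w \<noteq> E y w}"
    using assms(2-4) by auto
  then show ?thesis using assms(1) by (simp add: diff_count_def)
qed

lemma wp_update_diffs:
  assumes v: "\<sigma> vv 0 0 = int v" "v \<in> L" and L: "L \<subseteq> {..<n}"
    and alive: "\<And>x. x < n \<Longrightarrow> \<sigma> alive x 0 = of_bool (x \<in> L - {v})"
    and diff: "\<And>x y. x \<in> L \<Longrightarrow> y \<in> L \<Longrightarrow> \<sigma> diff x y = int (diff_count E L x y)"
  shows "wp n E update_diffs (\<lambda>\<tau>. \<forall>x\<in>L - {v}. \<forall>y\<in>L - {v}. \<tau> diff x y = int (diff_count E (L - {v}) x y)) \<sigma>"
proof -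
  have fin: "finite L" using L finite_subset by blast
  define val where "val = (\<lambda>P x y. int (if P x y then diff_count E (L - {v}) x y else diff_count E L x y))"
  define I where "I = (\<lambda>P \<tau> :: store. \<forall>x\<in>L - {v}. \<forall>y\<in>L - {v}. \<tau> diff x y = val P x y)"
  have le: "int (diff_count E K x y) \<le> int n" if "K \<subseteq> {..<n}" for K x y
    using diff_count_le[of K E x y] card_mono[OF _ that] finite_subset[OF that] by simp
  have "wp n E update_diffs (I (\<lambda>x y. x < n)) \<sigma>" unfolding update_diffs_def
  proof (rule wp_For[where I = "\<lambda>i. I (\<lambda>x y. x < i)"], goal_cases)
    case (6 x \<tau>)
    show ?case
    proof (rule wp_For[where I = "\<lambda>j. I (\<lambda>x' y. x' < x \<or> x' = x \<and> y < j)"], goal_cases)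
      case (6 y \<upsilon>)
      have eq: "\<upsilon> alive = \<sigma> alive" "\<upsilon> vv = \<sigma> vv" "\<upsilon> vx 0 0 = int x"
        using 6(3) \<open>same_outside _ \<sigma> \<tau>\<close> by (simp_all add: same_outside_def upd_def)
      have xy: "x < n" "y < n" using 6(1) \<open>x < n + 0\<close> by simp_all
      have vn: "v < n" using v L by auto
      show ?case
      proof (cases "x \<in> L - {v} \<and> y \<in> L - {v}")
        case True
        have "\<upsilon> diff x y = int (diff_count E L x y)"
          using 6(2) True by (simp add: I_def val_def)
        moreover have "diff_count E L x y = diff_count E (L - {v}) x y + of_bool (E x v \<noteq> E y v)"
          using True v fin by (intro diff_count_remove) auto
        moreover have "int (diff_count E (L - {v}) x y) \<le> int n" using L by (intro le) auto
        ultimately show ?thesis using 6(2) xy vn True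
          by (auto simp: upd_apply eq v alive I_def val_def less_Suc_eq)
      next
        case False
        then show ?thesis using 6(2) xy vn
          by (auto simp: upd_apply eq v alive I_def val_def less_Suc_eq)
      qed
    qed (use 6 L in \<open>auto simp: upd_apply I_def val_def less_Suc_eq\<close>)
  qed (use diff in \<open>auto simp: upd_apply I_def val_def\<close>)
  then show ?thesis by (rule wp_mono) (use L in \<open>auto simp: I_def val_def\<close>)
qed

text \<open>Adjacency between two modules is that of their representatives, so the quotient is the
  subgraph induced by \<open>L\<close>. Being induced, it inherits \<open>P_4\<close>-freeness, and
  twins can be sought in it.\<close>

definition modular :: "nat \<Rightarrow> (nat \<Rightarrow> nat \<Rightarrow> bool) \<Rightarrow> nat set \<Rightarrow> (nat \<Rightarrow> nat set) \<Rightarrow> bool" where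
  "modular n E L M \<longleftrightarrow> L \<subseteq> {..<n} \<and> (\<Union>x\<in>L. M x) = {..<n} \<and> (\<forall>x\<in>L. x \<in> M x) \<and>
     (\<forall>x\<in>L. \<forall>y\<in>L. x \<noteq> y \<longrightarrow> M x \<inter> M y = {} \<and> (\<forall>a\<in>M x. \<forall>b\<in>M y. E a b = E x y))"

text \<open>No other representative tells \<open>u\<close> from \<open>v\<close>, so the members of
  both modules look alike from every other module, and \<open>u\<close> can represent their
  union.\<close>

lemma modular_merge:
  assumes "modular n E L M" "symp E" "u \<in> L" "v \<in> L" "u \<noteq> v"
    and twins: "\<And>w. w \<in> L - {u, v} \<Longrightarrow> E u w = E v w"
  shows "modular n E (L - {v}) (M(u := M u \<union> M v))"
proof -
  let ?M = "M(u := M u \<union> M v)"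
  have L: "L \<subseteq> {..<n}" and cover: "(\<Union>x\<in>L. M x) = {..<n}" and self: "\<And>x. x \<in> L \<Longrightarrow> x \<in> M x"
    and disj: "\<And>x y. x \<in> L \<Longrightarrow> y \<in> L \<Longrightarrow> x \<noteq> y \<Longrightarrow> M x \<inter> M y = {}"
    and hom: "\<And>x y a b. x \<in> L \<Longrightarrow> y \<in> L \<Longrightarrow> x \<noteq> y \<Longrightarrow> a \<in> M x \<Longrightarrow> b \<in> M y \<Longrightarrow> E a b = E x y"
    using assms(1) unfolding modular_def by blast+
  have sym: "E a b = E b a" for a b using assms(2) by (auto simp: symp_def)
  have "(\<Union>x\<in>L - {v}. ?M x) = (\<Union>x\<in>L. M x)"
    using assms(3-5) by (auto split: if_splits)
  moreover have "?M x \<inter> ?M y = {} \<and> (\<forall>a\<in>?M x. \<forall>b\<in>?M y. E a b = E x y)"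
    if xy: "x \<in> L - {v}" "y \<in> L - {v}" "x \<noteq> y" for x y
  proof -
    have key: "M w \<inter> (M u \<union> M v) = {} \<and> (\<forall>a\<in>M u \<union> M v. \<forall>b\<in>M w. E a b = E u w)"
      if w: "w \<in> L - {v}" "w \<noteq> u" for w
    proof -
      have "E v w = E u w" using twins[of w] w by simp
      then show ?thesis
        using disj[of w u] disj[of w v] hom[of u w] hom[of v w] w assms(3,4) by blast
    qed
    show ?thesis
    proof (cases "x = u \<or> y = u")
      case True
      then show ?thesis
      proof
        assume "x = u" then show ?thesis using key[of y] xy by auto
      next
        assume y: "y = u"
        have x: "M x \<inter> (M u \<union> M v) = {}" "\<forall>a\<in>M u \<union> M v. \<forall>b\<in>M x. E a b = E u x"
          using key[of x] xy y by auto
        have "E a b = E x u" if "a \<in> M x" "b \<in> M u \<union> M v" for a b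
          using x(2) that sym[of a b] sym[of x u] by metis
        then show ?thesis using x(1) xy y by simp
      qed
    next
      case False
      then show ?thesis using disj[of x y] hom[of x y] xy by auto
    qed
  qed
  ultimately show ?thesis using L cover self unfolding modular_def by auto
qed

definition state_ok :: "nat \<Rightarrow> (nat \<Rightarrow> nat \<Rightarrow> bool) \<Rightarrow> nat set \<Rightarrow> (nat \<Rightarrow> nat set) \<Rightarrow> store \<Rightarrow> bool" where
  "state_ok n E L M \<sigma> \<longleftrightarrow> modular n E L M \<and> (\<forall>x<n. \<sigma> alive x 0 = of_bool (x \<in> L)) \<and>
     (\<forall>x\<in>L. \<sigma> size_of x 0 = int (card (M x)) \<and>
        (\<forall>a\<le>card (M x). \<sigma> table x a = int (model_number E (M x) a)) \<and>
        (\<forall>y\<in>L. \<sigma> diff x y = int (diff_count E L x y)))"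

definition merge :: com where
  "merge = combine ;; For va 1 (Set table (Var vu) (Var va) (Vec best (Var va))) ;;
     Set_Vec size_of (Var vu) (Plus (Vec size_of (Var vu)) (Vec size_of (Var vv))) ;;
     Set_Vec alive (Var vv) (Num 0) ;; update_diffs"

text \<open>The two claims pin down the table of the union: no candidate exceeds its entry, and some
  candidate with the right total reserve reaches it. So the maximum of \<open>val a b\<close> over
  \<open>a + b = c\<close> is the new entry.\<close>

lemma merge_number:
  assumes sym: "symp E" and fin: "finite A" "finite B" and disj: "A \<inter> B = {}"
    and hom: "\<forall>x\<in>A. \<forall>y\<in>B. E x y = e"
  defines "val \<equiv> \<lambda>a b. if e then join_number E A B a b else max (model_number E A a) (model_number E B b)"
  shows "a \<le> card A \<Longrightarrow> b \<le> card B \<Longrightarrow> val a b \<le> model_number E (A \<union> B) (a + b)"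
    and "c \<le> card A + card B \<Longrightarrow>
      \<exists>a\<le>card A. \<exists>b\<le>card B. a + b = c \<and> model_number E (A \<union> B) c \<le> val a b"
proof -
  have sym: "E a b = E b a" for a b using sym by (auto simp: symp_def)
  have cU: "card (A \<union> B) = card A + card B" using fin disj by (simp add: card_Un_disjoint)
  show "val a b \<le> model_number E (A \<union> B) (a + b)" if "a \<le> card A" "b \<le> card B"
  proof (cases e)
    case True
    then show ?thesis using join_number_le_model_number[OF fin disj _ that, of E] hom sym by (simp add: val_def)
  next
    case False
    have "model_number E A a \<le> model_number E (A \<union> B) (a + b)"
      by (rule model_number_mono) (use fin that cU in auto)
    moreover have "model_number E B b \<le> model_number E (A \<union> B) (b + a)"
      by (rule model_number_mono) (use fin that cU in auto)
    ultimately show ?thesis using False by (simp add: val_def add.commute)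
  qed
  show "\<exists>a\<le>card A. \<exists>b\<le>card B. a + b = c \<and> model_number E (A \<union> B) c \<le> val a b"
    if "c \<le> card A + card B"
  proof (cases e)
    case True
    then show ?thesis using model_number_join_le[OF fin disj that, of E] by (simp add: val_def)
  next
    case False
    then show ?thesis using model_number_union_le[OF fin disj _ that, of E] hom sym by (simp add: val_def)
  qed
qed

lemma wp_merge:
  assumes ok: "state_ok n E L M \<sigma>" and sym: "symp E" and uv: "u \<in> L" "v \<in> L" "u \<noteq> v"
    and vars: "\<sigma> vu 0 0 = int u" "\<sigma> vv 0 0 = int v" and diff: "\<sigma> diff u v = 0"
  shows "wp n E merge (state_ok n E (L - {v}) (M(u := M u \<union> M v))) \<sigma>"
proof -
  let ?p = "card (M u)" and ?q = "card (M v)" and ?M = "M(u := M u \<union> M v)"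
  define val where "val = (\<lambda>a b. if E u v then join_number E (M u) (M v) a b
    else max (model_number E (M u) a) (model_number E (M v) b))"
  have mod: "modular n E L M" and alive: "\<And>x. x < n \<Longrightarrow> \<sigma> alive x 0 = of_bool (x \<in> L)"
    and size: "\<And>x. x \<in> L \<Longrightarrow> \<sigma> size_of x 0 = int (card (M x))"
    and tab: "\<And>x a. x \<in> L \<Longrightarrow> a \<le> card (M x) \<Longrightarrow> \<sigma> table x a = int (model_number E (M x) a)"
    and dif: "\<And>x y. x \<in> L \<Longrightarrow> y \<in> L \<Longrightarrow> \<sigma> diff x y = int (diff_count E L x y)"
    using ok by (auto simp: state_ok_def)
  have L: "L \<subseteq> {..<n}" and sub: "M u \<subseteq> {..<n}" "M v \<subseteq> {..<n}" and disj: "M u \<inter> M v = {}"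
    and hom: "\<forall>x\<in>M u. \<forall>y\<in>M v. E x y = E u v"
    using mod uv unfolding modular_def by blast+
  have fin: "finite (M u)" "finite (M v)" "finite L" using sub L finite_subset by blast+
  have uvn: "u < n" "v < n" using uv L by auto
  have cU: "card (M u \<union> M v) = ?p + ?q" using fin disj by (simp add: card_Un_disjoint)
  have pq: "?p + ?q \<le> n" using card_mono[of "{..<n}" "M u \<union> M v"] sub cU by simp
  have val: "val a b \<le> model_number E (M u \<union> M v) (a + b)" if "a \<le> ?p" "b \<le> ?q" for a b
    using merge_number(1)[OF sym fin(1,2) disj hom that] by (simp add: val_def)
  have val': "\<exists>a\<le>?p. \<exists>b\<le>?q. a + b = c \<and> model_number E (M u \<union> M v) c \<le> val a b"
    if "c \<le> ?p + ?q" for c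
    using merge_number(2)[OF sym fin(1,2) disj hom that] by (simp add: val_def)
  have val_n: "val a b \<le> n" if "a \<le> ?p" "b \<le> ?q" for a b
    using val[OF that] model_number_le[of "M u \<union> M v" "a + b" E] that fin cU pq by simp
  have twins: "E u w = E v w" if "w \<in> L - {u, v}" for w
  proof -
    have "diff_count E L u v = 0" using diff dif[OF uv(1,2)] by simp
    then show ?thesis using that fin(3) by (auto simp: diff_count_def)
  qed
  interpret T: tables n E u v ?p ?q "model_number E (M u)" "model_number E (M v)" val
  proof
    show "val a b = (if a < ?p \<and> b < ?q
        then max (model_number E (M u) a + model_number E (M v) b) (Suc (val (Suc a) (Suc b)))
        else model_number E (M u) a + model_number E (M v) b)"
      if "E u v" "a \<le> ?p" "b \<le> ?q" for a b
      unfolding val_def using that(1) join_number_rec[OF that(2,3), of E] by (simp only: if_True)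
    show "val a b = max (model_number E (M u) a) (model_number E (M v) b)" if "\<not> E u v" for a b
      using that by (simp add: val_def)
  qed (use uvn pq val_n in auto)
  have "T.inputs \<sigma>" using vars size tab uv by (simp add: T.inputs_def)
  from T.wp_combine[OF this] show ?thesis unfolding merge_def wp.simps(3)
  proof (rule wp_conseq)
    fix \<tau> assume cov: "covers n val ({..?p} \<times> {..?q}) (\<lambda>c. \<tau> best c 0)"
      and frame: "same_outside (written combine) \<sigma> \<tau>"
    have eq: "\<tau> r = \<sigma> r" if "r \<notin> {va, vb, vc, row, best}" for r
      using frame that by (simp add: same_outside_def combine_def combine_row_def combine_cell_def)
    \<comment> \<open>All entries of \<open>best\<close> up to index \<open>n\<close> are copied,
      also those beyond the size of the merged module, so the range check of the assignment has to
      cover them too.\<close>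
    have best_bounds: "-1 \<le> \<tau> best a 0 \<and> \<tau> best a 0 \<le> int n + 2" if "a \<le> n" for a
    proof (rule coversE[OF cov that])
      fix b c assume "(b, c) \<in> {..?p} \<times> {..?q}" "\<tau> best a 0 = int (val b c)"
      then show ?thesis using val_n[of b c] by simp
    qed simp
    have best: "\<tau> best c 0 = int (model_number E (M u \<union> M v) c)" if c: "c \<le> ?p + ?q" for c
    proof (rule antisym)
      show "\<tau> best c 0 \<le> int (model_number E (M u \<union> M v) c)"
      proof (rule coversE[OF cov])
        show "c \<le> n" using c pq by simp
      next
        fix a b assume "(a, b) \<in> {..?p} \<times> {..?q}" "a + b = c" "\<tau> best c 0 = int (val a b)"
        then show ?thesis using val[of a b] by auto
      qed simp
      show "int (model_number E (M u \<union> M v) c) \<le> \<tau> best c 0"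
      proof -
        obtain a b where "a \<le> ?p" "b \<le> ?q" "a + b = c" "model_number E (M u \<union> M v) c \<le> val a b"
          using val'[OF c] by blast
        then show ?thesis using coversD[OF cov, of a b] by simp
      qed
    qed
    show "wp n E (For va 1 (Set table (Var vu) (Var va) (Vec best (Var va))))
      (wp n E (Set_Vec size_of (Var vu) (Plus (Vec size_of (Var vu)) (Vec size_of (Var vv))))
      (wp n E (Set_Vec alive (Var vv) (Num 0)) (wp n E update_diffs (state_ok n E (L - {v}) ?M)))) \<tau>"
    proof (rule wp_For[where I = "\<lambda>i \<upsilon>. (\<forall>a<i. \<upsilon> table u a = \<tau> best a 0) \<and>
        (\<forall>x. x \<noteq> u \<longrightarrow> \<upsilon> table x = \<sigma> table x)"], goal_cases)
      case (6 a \<upsilon>)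
      have "\<upsilon> vu 0 0 = int u" "\<upsilon> best = \<tau> best" using 6(3) eq vars by (simp_all add: same_outside_def)
      then show ?case using 6(1,2) uvn best_bounds[of a] by (auto simp: upd_apply less_Suc_eq upd_def)
    next
      case (7 \<upsilon>)
      have eq': "\<upsilon> r = \<sigma> r" if "r \<notin> {va, vb, vc, row, best, table}" for r
        using 7(2) eq that by (simp add: same_outside_def)
      have tab_u: "\<upsilon> table u a = int (model_number E (M u \<union> M v) a)" if "a \<le> ?p + ?q" for a
        using 7(1) best[OF that] that pq by simp
      \<comment> \<open>The store in which \<open>update_diffs\<close> starts: the table is copied,
        the sizes are added, and \<open>v\<close> is no longer alive, so pairs with \<open>v\<close>
        are skipped.\<close>
      define \<omega> where "\<omega> = upd (upd (upd \<upsilon> va 0 0 (int (n + 1))) size_of u 0 (int ?p + int ?q)) alive v 0 0"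
      have "wp n E update_diffs (\<lambda>\<tau>. \<forall>x\<in>L - {v}. \<forall>y\<in>L - {v}. \<tau> diff x y = int (diff_count E (L - {v}) x y)) \<omega>"
        by (rule wp_update_diffs[OF _ uv(2) L])
          (use eq' vars dif alive in \<open>auto simp: \<omega>_def upd_apply\<close>)
      then have "wp n E update_diffs (state_ok n E (L - {v}) ?M) \<omega>"
      proof (rule wp_conseq)
        fix \<rho> assume d: "\<forall>x\<in>L - {v}. \<forall>y\<in>L - {v}. \<rho> diff x y = int (diff_count E (L - {v}) x y)"
          and fr: "same_outside (written update_diffs) \<omega> \<rho>"
        have er: "\<rho> r = \<omega> r" if "r \<notin> {vx, vy, diff}" for r
          using fr that by (simp add: same_outside_def update_diffs_def)
        have "modular n E (L - {v}) ?M" by (rule modular_merge[OF mod sym uv twins])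
        moreover have "\<rho> alive x 0 = of_bool (x \<in> L - {v})" if "x < n" for x
          using alive[OF that] er eq' by (auto simp: \<omega>_def upd_apply)
        moreover have "\<rho> size_of x 0 = int (card (?M x))" if "x \<in> L - {v}" for x
          using size[of x] that er eq' cU by (auto simp: \<omega>_def upd_apply)
        moreover have "\<rho> table x a = int (model_number E (?M x) a)"
          if "x \<in> L - {v}" "a \<le> card (?M x)" for x a
          using that tab[of x a] tab_u[of a] er 7(1) cU
          by (cases "x = u") (simp_all add: \<omega>_def upd_apply)
        ultimately show "state_ok n E (L - {v}) ?M \<rho>" using d by (simp add: state_ok_def)
      qed
      then show ?case using eq' vars size uv uvn pq by (simp add: \<omega>_def upd_apply)
    qed (use eq in auto)
  qed
qed

text \<open>Fewer than \<open>n\<close> merges are possible, so \<open>n\<close> rounds suffice; a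
  round that finds no twins leaves the tables as they are. The last loop looks for the surviving
  representative, and without any vertex the answer remains 0.\<close>

definition hadwiger_com :: com where
  "hadwiger_com = init_vertices ;; init_diffs ;;
     For vt 0 (find_twins ;; If (Eq (Var vfound) (Num 1)) merge Nop) ;;
     Set_Var vres (Num 0) ;;
     For vx 0 (If (Eq (Vec alive (Var vx)) (Num 1)) (Set_Var vres (Arr table (Var vx) (Num 0))) Nop)"

lemma state_ok_same_outside:
  "state_ok n E L M \<sigma> \<Longrightarrow> same_outside W \<sigma> \<tau> \<Longrightarrow> W \<inter> {alive, size_of, table, diff} = {} \<Longrightarrow>
    state_ok n E L M \<tau>"
  by (auto simp: state_ok_def same_outside_def)

lemma model_number_singleton: "a \<le> 1 \<Longrightarrow> model_number E {x} a = 1 - a"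
proof -
  assume a: "a \<le> 1"
  have "model_number E {x} a + a \<le> 1" using model_number_le[of "{x}" a E] a by simp
  moreover have "clique_model E {x} {{x}}" by (simp add: clique_model_def conn_singleton)
  then have "1 \<le> model_number E {x} 0" using card_le_model_number[of "{x}" E "{{x}}" 0] by simp
  ultimately show ?thesis using a by (cases a) auto
qed

text \<open>A failed search certifies that at most one representative is left: two or more would
  include twins, and their count would be 0.\<close>

lemma wp_find_and_merge:
  assumes ok: "state_ok n E L M \<sigma>" and sym: "symp E" and P4: "P4_free E {..<n}"
  shows "wp n E (find_twins ;; If (Eq (Var vfound) (Num 1)) merge Nop)
    (\<lambda>\<tau>. \<exists>L' M'. state_ok n E L' M' \<tau> \<and> (L' = L \<and> card L \<le> 1 \<or> L' \<noteq> {} \<and> Suc (card L') = card L)) \<sigma>"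
  unfolding wp.simps(3)
proof (rule wp_find_twins)
  fix \<tau>
  let ?good = "\<lambda>x y. \<sigma> alive x 0 = 1 \<and> \<sigma> alive y 0 = 1 \<and> x \<noteq> y \<and> \<sigma> diff x y = 0"
  assume frame: "same_outside {vx, vy, vu, vv, vfound} \<sigma> \<tau>"
    and found: "\<tau> vfound 0 0 = 0 \<and> \<not> (\<exists>x<n. \<exists>y<n. ?good x y) \<or>
      \<tau> vfound 0 0 = 1 \<and> (\<exists>x<n. \<exists>y<n. ?good x y \<and> \<tau> vu 0 0 = int x \<and> \<tau> vv 0 0 = int y)"
  have ok': "state_ok n E L M \<tau>" by (rule state_ok_same_outside[OF ok frame]) simp
  have L: "L \<subseteq> {..<n}" and alive: "\<And>x. x < n \<Longrightarrow> \<sigma> alive x 0 = of_bool (x \<in> L)"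
    and dif: "\<And>x y. x \<in> L \<Longrightarrow> y \<in> L \<Longrightarrow> \<sigma> diff x y = int (diff_count E L x y)"
    using ok by (auto simp: state_ok_def modular_def)
  have fin: "finite L" using L finite_subset by blast
  show "wp n E (If (Eq (Var vfound) (Num 1)) merge Nop)
    (\<lambda>\<tau>. \<exists>L' M'. state_ok n E L' M' \<tau> \<and> (L' = L \<and> card L \<le> 1 \<or> L' \<noteq> {} \<and> Suc (card L') = card L)) \<tau>"
    using found
  proof
    assume none: "\<tau> vfound 0 0 = 0 \<and> \<not> (\<exists>x<n. \<exists>y<n. ?good x y)"
    have "card L \<le> 1"
    proof (rule ccontr)
      assume "\<not> card L \<le> 1"
      then obtain x y where xy: "x \<in> L" "y \<in> L" "x \<noteq> y" "\<forall>w\<in>L - {x, y}. E x w = E y w"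
        using twins_exist[OF fin sym P4_free_subset[OF P4 L]] by auto
      have "{w \<in> L. w \<noteq> x \<and> w \<noteq> y \<and> E x w \<noteq> E y w} = {}" using xy(4) by blast
      then have "diff_count E L x y = 0" by (simp only: diff_count_def card.empty)
      then have "?good x y" using xy alive dif L by auto
      then show False using none xy L by blast
    qed
    then show ?thesis using none ok' by auto
  next
    assume "\<tau> vfound 0 0 = 1 \<and> (\<exists>x<n. \<exists>y<n. ?good x y \<and> \<tau> vu 0 0 = int x \<and> \<tau> vv 0 0 = int y)"
    then obtain u v where uv: "\<tau> vfound 0 0 = 1" "u < n" "v < n" "?good u v" "\<tau> vu 0 0 = int u" "\<tau> vv 0 0 = int v"
      by blast
    have mem: "u \<in> L" "v \<in> L" "u \<noteq> v" using uv alive[of u] alive[of v] by auto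
    have "\<tau> diff u v = 0" using uv(4) frame by (simp add: same_outside_def)
    from wp_merge[OF ok' sym mem uv(5,6) this]
    have "wp n E merge (\<lambda>\<tau>. \<exists>L' M'. state_ok n E L' M' \<tau> \<and>
      (L' = L \<and> card L \<le> 1 \<or> L' \<noteq> {} \<and> Suc (card L') = card L)) \<tau>"
    proof (rule wp_mono)
      fix \<upsilon> assume "state_ok n E (L - {v}) (M(u := M u \<union> M v)) \<upsilon>"
      moreover have "L - {v} \<noteq> {}" "Suc (card (L - {v})) = card L"
        using mem card_Suc_Diff1[OF fin mem(2)] by auto
      ultimately show "\<exists>L' M'. state_ok n E L' M' \<upsilon> \<and>
        (L' = L \<and> card L \<le> 1 \<or> L' \<noteq> {} \<and> Suc (card L') = card L)" by blast
    qed
    then show ?thesis using uv(1) by simp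
  qed
qed simp

lemma wp_hadwiger_com:
  assumes sym: "symp E" and P4: "P4_free E {..<n}"
  shows "wp n E hadwiger_com (\<lambda>\<tau>. \<tau> vres 0 0 = int (model_number E {..<n} 0)) (\<lambda>_ _ _. 0)"
proof -
  \<comment> \<open>The bound \<open>max 1 (n - t)\<close> falls by one per round until a single
    representative is left, and nonemptiness guarantees that one survives.\<close>
  let ?I = "\<lambda>t \<tau>. \<exists>L M. state_ok n E L M \<tau> \<and> (0 < n \<longrightarrow> L \<noteq> {}) \<and> card L \<le> max 1 (n - t)"
  have 1: "wp n E init_vertices (\<lambda>\<tau>. (\<forall>x<n. \<tau> alive x 0 = 1 \<and> \<tau> size_of x 0 = 1 \<and>
    \<tau> table x 0 = 1 \<and> \<tau> table x 1 = 0) \<and> (\<forall>x y. \<tau> diff x y = 0)) (\<lambda>_ _ _. 0)"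
    by (rule wp_conseq[OF wp_init_vertices]) (auto simp: same_outside_def init_vertices_def)
  have 2: "wp n E init_diffs (?I 0) \<tau>"
    if \<tau>: "(\<forall>x<n. \<tau> alive x 0 = 1 \<and> \<tau> size_of x 0 = 1 \<and>
    \<tau> table x 0 = 1 \<and> \<tau> table x 1 = 0) \<and> (\<forall>x y. \<tau> diff x y = 0)" for \<tau>
  proof (rule wp_conseq[OF wp_init_diffs])
    fix \<upsilon> assume d: "\<forall>x<n. \<forall>y<n. \<upsilon> diff x y = int (diff_count E {..<n} x y)"
      and fr: "same_outside (written init_diffs) \<tau> \<upsilon>"
    have eq: "\<upsilon> r = \<tau> r" if "r \<notin> {vx, vy, vz, diff}" for r
      using fr that by (simp add: same_outside_def init_diffs_def count_diff_def)
    have "\<upsilon> table x a = int (model_number E {x} a)" if "x < n" "a \<le> 1" for x a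
      using \<tau> that eq model_number_singleton[OF that(2), of E x] by (cases a) auto
    then have "state_ok n E {..<n} (\<lambda>x. {x}) \<upsilon>"
      using \<tau> d eq by (auto simp: state_ok_def modular_def)
    then show "?I 0 \<upsilon>" by (intro exI[of _ "{..<n}"] exI[of _ "\<lambda>x. {x}"]) auto
  qed (use \<tau> in simp)
  have 3: "wp n E (For vt 0 (find_twins ;; If (Eq (Var vfound) (Num 1)) merge Nop)) (?I n) \<tau>"
    if \<tau>: "?I 0 \<tau>" for \<tau>
  proof (rule wp_For[where I = ?I], goal_cases)
    case (6 i \<upsilon>)
    then obtain L M where LM: "state_ok n E L M \<upsilon>" "0 < n \<longrightarrow> L \<noteq> {}" "card L \<le> max 1 (n - i)" by blast
    have "state_ok n E L M (upd \<upsilon> vt 0 0 (int i))"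
      by (rule state_ok_same_outside[OF LM(1), of "{vt}"]) (simp_all add: same_outside_upd same_outside_refl)
    from wp_find_and_merge[OF this sym P4] show ?case
    proof (rule wp_mono)
      fix \<omega> assume "\<exists>L' M'. state_ok n E L' M' \<omega> \<and> (L' = L \<and> card L \<le> 1 \<or> L' \<noteq> {} \<and> Suc (card L') = card L)"
      then obtain L' M' where "state_ok n E L' M' \<omega>" "L' = L \<and> card L \<le> 1 \<or> L' \<noteq> {} \<and> Suc (card L') = card L"
        by blast
      then show "?I (Suc i) \<omega>" using LM by (intro exI[of _ L'] exI[of _ M']) auto
    qed
  next
    case (7 \<upsilon>)
    then obtain L M where LM: "state_ok n E L M \<upsilon>" "0 < n \<longrightarrow> L \<noteq> {}" "card L \<le> max 1 (n - n)" by auto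
    have "state_ok n E L M (upd \<upsilon> vt 0 0 (int (n + 0)))"
      by (rule state_ok_same_outside[OF LM(1), of "{vt}"]) (simp_all add: same_outside_upd same_outside_refl)
    then show ?case using LM by blast
  qed (use \<tau> in \<open>auto simp: find_twins_def merge_def combine_def combine_row_def combine_cell_def update_diffs_def\<close>)
  have 4: "wp n E (Set_Var vres (Num 0) ;;
     For vx 0 (If (Eq (Vec alive (Var vx)) (Num 1)) (Set_Var vres (Arr table (Var vx) (Num 0))) Nop))
     (\<lambda>\<tau>. \<tau> vres 0 0 = int (model_number E {..<n} 0)) \<tau>"
    if \<tau>: "?I n \<tau>" for \<tau>
  proof -
    obtain L M where ok: "state_ok n E L M \<tau>" and L: "0 < n \<longrightarrow> L \<noteq> {}" "card L \<le> 1" using \<tau> by auto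
    let ?\<tau> = "upd \<tau> vres 0 0 0"
    have fin: "finite L" using ok finite_subset[of L "{..<n}"] by (auto simp: state_ok_def modular_def)
    have alive: "\<tau> alive x 0 = of_bool (x \<in> L)" if "x < n" for x using ok that by (simp add: state_ok_def)
    have M: "M x = {..<n} \<and> \<tau> table x 0 = int (model_number E {..<n} 0) \<and> L = {x}" if "x \<in> L" for x
    proof -
      have "L = {x}" using that L(2) fin card_le_Suc0_iff_eq[of L] by auto
      moreover from this have "M x = {..<n}" using ok by (simp add: state_ok_def modular_def)
      moreover have "\<tau> table x 0 = int (model_number E (M x) 0)" using ok that by (simp add: state_ok_def)
      ultimately show ?thesis by simp
    qed
    have le: "int (model_number E {..<n} 0) \<le> int n" using model_number_le[of "{..<n}" 0 E] by simp
    have "wp n E (For vx 0 (If (Eq (Vec alive (Var vx)) (Num 1)) (Set_Var vres (Arr table (Var vx) (Num 0))) Nop))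
      (\<lambda>\<tau>. \<tau> vres 0 0 = int (model_number E {..<n} 0)) ?\<tau>"
    proof (rule wp_For[where I = "\<lambda>i \<upsilon>. \<upsilon> vres 0 0 = (if \<exists>x\<in>L. x < i then int (model_number E {..<n} 0) else 0)"], goal_cases)
      case (6 i \<upsilon>)
      have "\<upsilon> alive = \<tau> alive" "\<upsilon> table = \<tau> table" using 6(3) by (simp_all add: same_outside_def upd_def)
      then show ?case using 6(1,2) M le alive[of i] by (auto simp: upd_apply less_Suc_eq)
    next
      case (7 \<upsilon>)
      show ?case
      proof (cases "n = 0")
        case True
        then have "L = {}" using ok by (auto simp: state_ok_def modular_def)
        moreover have "model_number E {..<n} 0 = 0" using le True by simp
        ultimately show ?thesis using 7(1) by (simp add: upd_apply)
      next
        case False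
        then obtain x where "x \<in> L" using L by blast
        moreover have "x < n" using \<open>x \<in> L\<close> ok by (auto simp: state_ok_def modular_def)
        ultimately show ?thesis using 7(1) by (auto simp: upd_apply)
      qed
    qed (auto simp: upd_apply)
    then show ?thesis by simp
  qed
  note 4 = 4[unfolded wp.simps(3)]
  show ?thesis unfolding hadwiger_com_def wp.simps(3)
    by (rule wp_mono[OF 1 wp_mono[OF 2 wp_mono[OF 3 4]]])
qed

text \<open>The loop language has no access to \<open>h\<close>, so the comparison is added in
  machine code; this makes the running time independent of \<open>h\<close>. Cell 0 is overwritten
  last, because its content \<open>n\<close> enters every array address.\<close>

definition hadwiger_prog :: prog where
  "hadwiger_prog = Seq (compile hadwiger_com)
     (Cond (Less (Read (var_addr vres)) (Read (Const 1)))
       (Write (Const 0) (Const 0)) (Write (Const 0) (Const 1)))"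

lemma rep_input_memory:
  assumes "verts G = {..<n}"
  shows "rep n (adj G) h (\<lambda>_ _ _. 0) (input_memory G h)"
proof -
  have n: "card (verts G) = n" using assms by simp
  have "input_memory G h (2 + (i * n + j)) = of_bool (adj G i j)" if "i < n" "j < n" for i j
  proof -
    have "(i * n + j) div n = i" "(i * n + j) mod n = j" using that by simp_all
    then show ?thesis using input_cell_less[OF that] by (simp add: input_memory_def n adj_def)
  qed
  moreover have "input_memory G h (cell n r i j) = 0" if "1 \<le> r" for r i j
    using cell_large[OF that, of n i j] by (simp add: input_memory_def n)
  moreover have "\<bar>input_memory G h a\<bar> \<le> int n + \<bar>h\<bar> + 2" for a
    by (simp add: input_memory_def n Let_def)
  moreover have "input_memory G h 0 = int n" "input_memory G h 1 = h"
    by (simp_all add: input_memory_def n)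
  ultimately show ?thesis by (simp add: rep_def)
qed

text \<open>The comparison and the final write take 24 and 3 steps, and none of their expressions
  costs more than 21; the constants 40 and 30 leave room for this.\<close>

lemma hadwiger_prog_correct:
  assumes G: "simple_graph G" "verts G = {..<n}" "cograph G" and m: "cost 0 hadwiger_com + 30 \<le> m"
  shows "\<exists>t s. exec (word_bound n h m) hadwiger_prog (input_memory G h) t s \<and>
    t \<le> cost n hadwiger_com + 40 \<and> s 0 = (if hadwiger_number_problem G h then 1 else 0)"
proof -
  have h: "hadwiger_number G = model_number (adj G) {..<n} 0" using hadwiger_number_eq[OF G(1)] G(2) by simp
  have "P4_free (adj G) {..<n}" using cograph_P4_free[OF G(3)] G(2) by simp
  from compile_sound[OF wp_hadwiger_com[OF symp_adj this] rep_input_memory[OF G(2)], of m h] m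
  obtain t s \<sigma> where 1: "exec (word_bound n h m) (compile hadwiger_com) (input_memory G h) t s"
    "t \<le> cost n hadwiger_com" "rep n (adj G) h \<sigma> s" "\<sigma> vres 0 0 = int (hadwiger_number G)"
    unfolding h by auto
  let ?B = "word_bound n h m" and ?b = "Less (Read (var_addr vres)) (Read (Const 1))"
  have z: "tame s (Const 0) (int 0)" by (simp add: tame_def)
  have x: "tame s (Read (var_addr vres)) (int (hadwiger_number G))"
    using tame_cell[OF 1(3) z z, of vres] 1(4) by simp
  have y: "tame s (Read (Const 1)) h" using 1(3) by (simp add: tame_def rep_def)
  have ok: "expr_ok ?B s (Read (var_addr vres))" "expr_ok ?B s (Read (Const 1))"
    "expr_ok ?B s (Const 0)" "expr_ok ?B s (Const 1)"
    using tame_expr_ok[OF 1(3) x, of m] tame_expr_ok[OF 1(3) y, of m] m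
      expr_ok_word_bound[OF 1(3), of "Const 0" m] expr_ok_word_bound[OF 1(3), of "Const 1" m]
    by simp_all
  have test: "test_ok ?B s ?b" using ok by (simp only: test_ok.simps)
  have "expr_val s (Read (var_addr vres)) = int (hadwiger_number G)" "expr_val s (Read (Const 1)) = h"
    using x y by (simp_all only: tame_def)
  then have val: "test_val s ?b = (\<not> hadwiger_number_problem G h)"
    by (simp only: test_val.simps hadwiger_number_problem_def) linarith
  have wr: "exec ?B (Write (Const 0) (Const c)) s 3 (s(0 := c))" if "c = 0 \<or> c = 1" for c
    using exec_Write[of ?B s "Const 0" "Const c"] ok that by (auto simp: numeral_3_eq_3)
  have cost: "test_cost ?b = 24" by simp
  show ?thesis
  proof (cases "hadwiger_number_problem G h")
    case True
    have "exec ?B (Cond ?b (Write (Const 0) (Const 0)) (Write (Const 0) (Const 1))) s (24 + 3) (s(0 := 1))"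
      using exec_Cond_False[OF test _ wr[of 1]] val True unfolding cost by simp
    from exec_Seq[OF 1(1) this] show ?thesis using 1(2) True unfolding hadwiger_prog_def by force
  next
    case False
    have "exec ?B (Cond ?b (Write (Const 0) (Const 0)) (Write (Const 0) (Const 1))) s (24 + 3) (s(0 := 0))"
      using exec_Cond_True[OF test _ wr[of 0]] val False unfolding cost by simp
    from exec_Seq[OF 1(1) this] show ?thesis using 1(2) False unfolding hadwiger_prog_def by force
  qed
qed

lemma depth_hadwiger_com: "depth hadwiger_com = 3"
  by (simp add: hadwiger_com_def init_vertices_def init_diffs_def count_diff_def find_twins_def merge_def
      combine_def combine_row_def combine_cell_def update_diffs_def)

theorem theorem1:
  "\<exists>T :: nat \<Rightarrow> nat. (\<lambda>n. real (T n)) \<in> O(\<lambda>n. real n ^ 3) \<and>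
     solvable_in_time hadwiger_number_problem cograph T"
proof (intro exI conjI)
  let ?T = "\<lambda>n. cost n hadwiger_com + 40"
  obtain C where C: "\<And>n. cost n hadwiger_com \<le> C * (n + 1) ^ 3"
    using cost_bound[of hadwiger_com] unfolding depth_hadwiger_com by blast
  show "(\<lambda>n. real (?T n)) \<in> O(\<lambda>n. real n ^ 3)"
  proof (rule bigoI)
    show "\<forall>\<^sub>F n in sequentially. norm (real (?T n)) \<le> real (C * 8 + 40) * norm (real n ^ 3)"
      using eventually_ge_at_top[of 1]
    proof eventually_elim
      case (elim n)
      \<comment> \<open>For \<open>n \<ge> 1\<close>, \<open>n + 1\<close> is at most
        \<open>2 * n\<close>, whence the factor 8. At \<open>n = 0\<close> the cubic bound vanishes
        and no constant would do.\<close>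
      have "(n + 1) ^ 3 \<le> (2 * n) ^ 3" using elim by (intro power_mono) auto
      then have "C * (n + 1) ^ 3 \<le> C * (8 * n ^ 3)" by (simp add: power_mult_distrib)
      moreover have "40 \<le> 40 * n ^ 3" using elim by simp
      ultimately have "?T n \<le> C * (8 * n ^ 3) + 40 * n ^ 3" using C[of n] by linarith
      then have "?T n \<le> (C * 8 + 40) * n ^ 3" by (simp add: add_mult_distrib)
      then have "real (?T n) \<le> real ((C * 8 + 40) * n ^ 3)" by (rule of_nat_mono)
      then show ?case by simp
    qed
  qed
  let ?m = "cost 0 hadwiger_com + 30"
  show "solvable_in_time hadwiger_number_problem cograph ?T"
    unfolding solvable_in_time_def
  proof (rule exI[of _ hadwiger_prog], rule exI[of _ "5 * ?m"], intro allI impI)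
    fix G :: "nat graph" and h n
    assume "simple_graph G" "verts G = {..<n}" "cograph G"
    from hadwiger_prog_correct[OF this le_refl, of h]
    show "\<exists>t s. exec ((int n + \<bar>h\<bar> + 2) ^ (5 * ?m)) hadwiger_prog (input_memory G h) t s \<and>
      t \<le> ?T n \<and> s 0 = (if hadwiger_number_problem G h then 1 else 0)"
      unfolding word_bound_def .
  qed
qed

end
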